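(* Let $\lambda=(\lambda_n)$ be a frequency. The map \[ H_{\infty,+}^{\lambda}[\mathrm{Re}>0]\to\mathcal{H}_{\infty,+}(\lambda),\qquad f\mapsto\sum a_{\lambda_n}(f)e^{-\lambda_n s}, \] is a (coefficient preserving) isomorphism of Fréchet spaces.
   Context: A frequency is a strictly increasing unbounded sequence $\lambda=(\lambda_n)_{n\ge 1}$ of non-negative real numbers. Write $[\mathrm{Re}>\sigma]=\{s\in\mathbb{C}:\mathrm{Re}\,s>\sigma\}$. A continuous $g:\mathbb{R}\to\mathbb{C}$ is uniformly almost periodic if for every $\varepsilon>0$ there is $\ell>0$ such that every interval $I\subset\mathbb{R}$ of length $\ell$ contains some $\tau$ with $\sup_{x\in\mathbb{R}}|g(x)-g(x+\tau)|<\varepsilon$. For $f:[\mathrm{Re}>0]\to\mathbb{C}$ holomorphic, bounded on each half-plane $[\mathrm{Re}>\varepsilon]$, $\varepsilon>0$, and with $t\mapsto f(\sigma+it)$ uniformly almost periodic for every $\sigma>0$, the Bohr coefficients are \[ a_x(f)=\lim_{T\to\infty}\frac1{2T}\int_{-T}^T f(\sigma+it)e^{(\sigma+it)x}\,dt,\qquad x\in\mathbb{R}, \] which exist and do not depend on $\sigma>0$. $H_{\infty,+}^\lambda[\mathrm{Re}>0]$ is the space of all such $f$ with $a_x(f)=0$ whenever $x\notin\{\lambda_n:n\in\mathbb{N}\}$, with the Fréchet topology given by the norms $\|f\|_{\infty,k}=\sup_{\mathrm{Re}\,s>1/k}|f(s)|$, $k\in\mathbb{N}$. A $\lambda$-Dirichlet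 series is a formal series $D=\sum a_n e^{-\lambda_n s}$, $a_n\in\mathbb{C}$; put $D_\sigma=\sum a_n e^{-\lambda_n\sigma}e^{-\lambda_n s}$. A $\lambda$-Dirichlet group is a pair $(G,\beta)$ with $G$ a compact abelian group and $\beta:(\mathbb{R},+)\to G$ a continuous homomorphism with dense range such that for each $n$ there is a (unique) character $h_{\lambda_n}\in\widehat G$ with $h_{\lambda_n}(\beta(t))=e^{-i\lambda_n t}$ for all $t$; such groups always exist (e.g. the Bohr compactification of $\mathbb{R}$). $H_\infty^\lambda(G)$ is the space of all $f\in L_\infty(G)$ whose Fourier coefficients vanish at all characters outside $\{h_{\lambda_n}:n\in\mathbb{N}\}$. $\mathcal{H}_\infty(\lambda)$ is the Banach space of all $\sum a_n e^{-\lambda_n s}$ for which there is a (unique) $f\in H_\infty^\lambda(G)$ with $a_n=\widehat f(h_{\lambda_n})$ for all $n$, with norm $\|f\|_{L_\infty(G)}$ (independent of the choice of $(G,\beta)$). $\mathcal{H}_{\infty,+}(\lambda)$ is the space of all $\lambda$-Dirichlet series $D$ with $D_\sigma\in\mathcal{H}_\infty(\lambda)$ for all $\sigma>0$, with the Fréchet topology given by the norms $\|D_{1/k}\|_{\mathcal{H}_\infty(\lambda)}$, $k\in\mathbb{N}$. *)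

theory Defs
  imports "HOL-Analysis.Analysis" "HOL-Probability.Essential_Supremum"
begin

section \<open>Frechet spaces of complex-valued functions\<close>

text \<open>
  All Frechet spaces below are sets of functions from some index type to the complex numbers,
  with pointwise linear operations and topology given by a sequence of seminorms. A seminorm is
  a function on the whole function type, but only its values on the space itself matter.
\<close>

definition function_subspace :: "('i \<Rightarrow> complex) set \<Rightarrow> bool" where
  "function_subspace X \<longleftrightarrow>
     (\<lambda>_. 0) \<in> X \<and>
     (\<forall>u\<in>X. \<forall>v\<in>X. (\<lambda>i. u i + v i) \<in> X) \<and>
     (\<forall>c. \<forall>u\<in>X. (\<lambda>i. c * u i) \<in> X)"

definition seminorm_on :: "('i \<Rightarrow> complex) set \<Rightarrow> (('i \<Rightarrow> complex) \<Rightarrow> real) \<Rightarrow> bool" where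
  "seminorm_on X p \<longleftrightarrow>
     (\<forall>u\<in>X. 0 \<le> p u) \<and>
     (\<forall>u\<in>X. \<forall>v\<in>X. p (\<lambda>i. u i + v i) \<le> p u + p v) \<and>
     (\<forall>c. \<forall>u\<in>X. p (\<lambda>i. c * u i) = cmod c * p u)"

definition seminorm_topology ::
  "('i \<Rightarrow> complex) set \<Rightarrow> (nat \<Rightarrow> ('i \<Rightarrow> complex) \<Rightarrow> real) \<Rightarrow> ('i \<Rightarrow> complex) topology" where
  "seminorm_topology X p =
     topology_generated_by
       {{v \<in> X. p k (\<lambda>i. v i - u i) < e} | u k e. u \<in> X \<and> 0 < e}"

definition frechet_space ::
  "('i \<Rightarrow> complex) set \<Rightarrow> (nat \<Rightarrow> ('i \<Rightarrow> complex) \<Rightarrow> real) \<Rightarrow> bool" where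
  "frechet_space X p \<longleftrightarrow>
     function_subspace X \<and>
     (\<forall>k. seminorm_on X (p k)) \<and>
     (\<forall>u\<in>X. (\<forall>k. p k u = 0) \<longrightarrow> u = (\<lambda>_. 0)) \<and>
     (\<forall>u. (\<forall>n. u n \<in> X) \<and>
          (\<forall>k. \<forall>e>0. \<exists>N. \<forall>m\<ge>N. \<forall>n\<ge>N. p k (\<lambda>i. u m i - u n i) < e) \<longrightarrow>
          (\<exists>v\<in>X. \<forall>k. (\<lambda>n. p k (\<lambda>i. u n i - v i)) \<longlonglongrightarrow> 0))"

definition function_linear_on ::
  "('i \<Rightarrow> complex) set \<Rightarrow> (('i \<Rightarrow> complex) \<Rightarrow> ('j \<Rightarrow> complex)) \<Rightarrow> bool" where
  "function_linear_on X \<Phi> \<longleftrightarrow>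
     (\<forall>u\<in>X. \<forall>v\<in>X. \<Phi> (\<lambda>i. u i + v i) = (\<lambda>j. \<Phi> u j + \<Phi> v j)) \<and>
     (\<forall>c. \<forall>u\<in>X. \<Phi> (\<lambda>i. c * u i) = (\<lambda>j. c * \<Phi> u j))"

definition frechet_isomorphism ::
  "('i \<Rightarrow> complex) set \<Rightarrow> (nat \<Rightarrow> ('i \<Rightarrow> complex) \<Rightarrow> real) \<Rightarrow>
   ('j \<Rightarrow> complex) set \<Rightarrow> (nat \<Rightarrow> ('j \<Rightarrow> complex) \<Rightarrow> real) \<Rightarrow>
   (('i \<Rightarrow> complex) \<Rightarrow> ('j \<Rightarrow> complex)) \<Rightarrow> bool" where
  "frechet_isomorphism X p Y q \<Phi> \<longleftrightarrow>
     frechet_space X p \<and> frechet_space Y q \<and>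
     function_linear_on X \<Phi> \<and>
     homeomorphic_map (seminorm_topology X p) (seminorm_topology Y q) \<Phi>"


section \<open>Frequencies and almost periodic functions on the half-plane\<close>

text \<open>Frequencies are indexed from \<open>0\<close> instead of \<open>1\<close>.\<close>

definition frequency :: "(nat \<Rightarrow> real) \<Rightarrow> bool" where
  "frequency lam \<longleftrightarrow> strict_mono lam \<and> (\<forall>n. 0 \<le> lam n) \<and> \<not> bdd_above (range lam)"

definition uniformly_almost_periodic :: "(real \<Rightarrow> complex) \<Rightarrow> bool" where
  "uniformly_almost_periodic g \<longleftrightarrow>
     continuous_on UNIV g \<and>
     (\<forall>e>0. \<exists>l>0. \<forall>a. \<exists>\<tau>\<in>{a..a + l}. (SUP x. ereal (cmod (g x - g (x + \<tau>)))) < ereal e)"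

text \<open>The common value, for all \<open>\<sigma> > 0\<close>, of the limits of the means on vertical lines.\<close>

definition bohr_coeff :: "(complex \<Rightarrow> complex) \<Rightarrow> real \<Rightarrow> complex" where
  "bohr_coeff f x =
     (THE a. \<forall>\<sigma>>0.
        ((\<lambda>T. (1 / (2 * complex_of_real T)) *
               integral {-T..T} (\<lambda>t. f (Complex \<sigma> t) * exp (Complex \<sigma> t * complex_of_real x)))
          \<longlongrightarrow> a) at_top)"

text \<open>
  Functions on the half-plane are represented by their extension by zero to the whole plane,
  so that equality of functions is equality on the half-plane.
\<close>

definition H_inf_plus :: "(nat \<Rightarrow> real) \<Rightarrow> (complex \<Rightarrow> complex) set" where
  "H_inf_plus lam =
     {f. (\<forall>s. Re s \<le> 0 \<longrightarrow> f s = 0) \<and>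
         f holomorphic_on {s. 0 < Re s} \<and>
         (\<forall>e>0. bounded (f ` {s. e < Re s})) \<and>
         (\<forall>\<sigma>>0. uniformly_almost_periodic (\<lambda>t. f (Complex \<sigma> t))) \<and>
         (\<forall>x. x \<notin> range lam \<longrightarrow> bohr_coeff f x = 0)}"

text \<open>Index \<open>k\<close> stands for the half-plane \<open>Re s > 1 / (k + 1)\<close>, so that all half-planes occur.\<close>

definition H_inf_plus_norm :: "nat \<Rightarrow> (complex \<Rightarrow> complex) \<Rightarrow> real" where
  "H_inf_plus_norm k f = (SUP s\<in>{s. 1 / real (Suc k) < Re s}. cmod (f s))"


section \<open>Dirichlet groups and their Hardy spaces\<close>

text \<open>
  A compact abelian group, written additively, is a compact type of class
  \<open>topological_ab_group_add\<close> and \<open>t2_space\<close>. Its normalised Haar measure is the regular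
  translation invariant Borel probability measure.
\<close>

definition haar_measure :: "'g::{topological_ab_group_add,t2_space} measure \<Rightarrow> bool" where
  "haar_measure \<mu> \<longleftrightarrow>
     sets \<mu> = sets borel \<and> emeasure \<mu> UNIV = 1 \<and>
     (\<forall>a. distr \<mu> borel (\<lambda>x. a + x) = \<mu>) \<and>
     (\<forall>A\<in>sets borel. emeasure \<mu> A = (INF U\<in>{U. open U \<and> A \<subseteq> U}. emeasure \<mu> U)) \<and>
     (\<forall>U. open U \<longrightarrow> emeasure \<mu> U = (SUP K\<in>{K. compact K \<and> K \<subseteq> U}. emeasure \<mu> K))"

definition group_character :: "('g::{topological_ab_group_add,t2_space} \<Rightarrow> complex) \<Rightarrow> bool" where
  "group_character h \<longleftrightarrow>
     continuous_on UNIV h \<and> (\<forall>x. cmod (h x) = 1) \<and> (\<forall>x y. h (x + y) = h x * h y)"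

definition dirichlet_group ::
  "(nat \<Rightarrow> real) \<Rightarrow> (real \<Rightarrow> 'g::{topological_ab_group_add,t2_space}) \<Rightarrow> bool" where
  "dirichlet_group lam \<beta> \<longleftrightarrow>
     compact (UNIV :: 'g set) \<and>
     continuous_on UNIV \<beta> \<and> (\<forall>s t. \<beta> (s + t) = \<beta> s + \<beta> t) \<and> closure (range \<beta>) = UNIV \<and>
     (\<forall>n. \<exists>h. group_character h \<and> (\<forall>t. h (\<beta> t) = exp (- \<i> * complex_of_real (lam n * t))))"

text \<open>The character \<open>h\<^sub>x\<close> with \<open>h\<^sub>x (\<beta> t) = exp (- \<i> x t)\<close>; unique since \<open>\<beta>\<close> has dense range.\<close>

definition freq_character ::
  "(real \<Rightarrow> 'g::{topological_ab_group_add,t2_space}) \<Rightarrow> real \<Rightarrow> 'g \<Rightarrow> complex" where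
  "freq_character \<beta> x =
     (THE h. group_character h \<and> (\<forall>t. h (\<beta> t) = exp (- \<i> * complex_of_real (x * t))))"

definition fourier_coeff ::
  "'g::{topological_ab_group_add,t2_space} measure \<Rightarrow> ('g \<Rightarrow> complex) \<Rightarrow> ('g \<Rightarrow> complex) \<Rightarrow> complex"
  where
  "fourier_coeff \<mu> f h = (LINT x|\<mu>. f x * cnj (h x))"

text \<open>
  Elements of \<open>L\<^sub>\<infinity>\<close> are represented by functions, not by classes modulo null sets.
\<close>

definition L_inf :: "'g measure \<Rightarrow> ('g \<Rightarrow> complex) set" where
  "L_inf \<mu> = {f \<in> borel_measurable \<mu>. esssup \<mu> (\<lambda>x. ereal (cmod (f x))) < \<infinity>}"

definition L_inf_norm :: "'g measure \<Rightarrow> ('g \<Rightarrow> complex) \<Rightarrow> real" where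
  "L_inf_norm \<mu> f = real_of_ereal (esssup \<mu> (\<lambda>x. ereal (cmod (f x))))"

definition H_inf_group ::
  "(nat \<Rightarrow> real) \<Rightarrow> (real \<Rightarrow> 'g::{topological_ab_group_add,t2_space}) \<Rightarrow> 'g measure \<Rightarrow>
   ('g \<Rightarrow> complex) set" where
  "H_inf_group lam \<beta> \<mu> =
     {f \<in> L_inf \<mu>. \<forall>h. group_character h \<and> h \<notin> range (\<lambda>n. freq_character \<beta> (lam n)) \<longrightarrow>
                      fourier_coeff \<mu> f h = 0}"


section \<open>Hardy spaces of Dirichlet series\<close>

text \<open>
  For a fixed frequency, a formal Dirichlet series is identified with its coefficient sequence.
\<close>

definition represents ::
  "(nat \<Rightarrow> real) \<Rightarrow> (real \<Rightarrow> 'g::{topological_ab_group_add,t2_space}) \<Rightarrow> 'g measure \<Rightarrow>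
   ('g \<Rightarrow> complex) \<Rightarrow> (nat \<Rightarrow> complex) \<Rightarrow> bool" where
  "represents lam \<beta> \<mu> f a \<longleftrightarrow>
     f \<in> H_inf_group lam \<beta> \<mu> \<and> (\<forall>n. a n = fourier_coeff \<mu> f (freq_character \<beta> (lam n)))"

definition DH_inf ::
  "(nat \<Rightarrow> real) \<Rightarrow> (real \<Rightarrow> 'g::{topological_ab_group_add,t2_space}) \<Rightarrow> 'g measure \<Rightarrow>
   (nat \<Rightarrow> complex) set" where
  "DH_inf lam \<beta> \<mu> = {a. \<exists>f. represents lam \<beta> \<mu> f a}"

text \<open>The representing function is unique up to null sets, so the choice is immaterial.\<close>

definition DH_inf_norm ::
  "(nat \<Rightarrow> real) \<Rightarrow> (real \<Rightarrow> 'g::{topological_ab_group_add,t2_space}) \<Rightarrow> 'g measure \<Rightarrow>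
   (nat \<Rightarrow> complex) \<Rightarrow> real" where
  "DH_inf_norm lam \<beta> \<mu> a = L_inf_norm \<mu> (SOME f. represents lam \<beta> \<mu> f a)"

definition translate_series :: "(nat \<Rightarrow> real) \<Rightarrow> real \<Rightarrow> (nat \<Rightarrow> complex) \<Rightarrow> (nat \<Rightarrow> complex)" where
  "translate_series lam \<sigma> a = (\<lambda>n. a n * complex_of_real (exp (- lam n * \<sigma>)))"

definition DH_inf_plus ::
  "(nat \<Rightarrow> real) \<Rightarrow> (real \<Rightarrow> 'g::{topological_ab_group_add,t2_space}) \<Rightarrow> 'g measure \<Rightarrow>
   (nat \<Rightarrow> complex) set" where
  "DH_inf_plus lam \<beta> \<mu> = {a. \<forall>\<sigma>>0. translate_series lam \<sigma> a \<in> DH_inf lam \<beta> \<mu>}"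

definition DH_inf_plus_norm ::
  "(nat \<Rightarrow> real) \<Rightarrow> (real \<Rightarrow> 'g::{topological_ab_group_add,t2_space}) \<Rightarrow> 'g measure \<Rightarrow>
   nat \<Rightarrow> (nat \<Rightarrow> complex) \<Rightarrow> real" where
  "DH_inf_plus_norm lam \<beta> \<mu> k a =
     DH_inf_norm lam \<beta> \<mu> (translate_series lam (1 / real (Suc k)) a)"

end

theory Submission
  imports Defs "HOL-Library.Real_Mod" "HOL-Probability.Sinc_Integral"
    "HOL-Complex_Analysis.Complex_Analysis"
begin

text \<open>
  The map turns out to be isometric: for every \<open>\<sigma> > 0\<close> the supremum of \<open>\<bar>f\<bar>\<close> on \<open>Re s > \<sigma>\<close> equals the
  \<open>L\<^sub>\<infinity>\<close>-norm of the function on the group that represents the coefficients \<open>a\<^sub>n exp (- \<lambda>\<^sub>n \<sigma>)\<close>. A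
  linear isometry of \<open>H_inf_plus lam\<close> onto \<open>DH_inf_plus lam \<beta> \<mu>\<close> transports the whole Frechet
  structure (lemma \<open>frechet_isomorphism_of_isometry\<close>), so completeness only has to be shown on
  the half-plane, where it holds because uniform limits preserve both holomorphy and almost
  periodicity.

  What links the two spaces are the Riesz means
  \<open>R\<^sub>x(s) = (\<Sum>\<lambda>\<^sub>n < x. (1 - \<lambda>\<^sub>n / x) a\<^sub>n exp (- \<lambda>\<^sub>n s))\<close>. The Fourier transform of the Fejer kernel of
  the real line is the hat function \<open>max 0 (1 - \<bar>y\<bar> / x)\<close>. Hence the convolution of an almost
  periodic function whose spectrum lies in \<open>\<lambda>\<close> with this kernel has only finitely many non-zero
  mean coefficients, namely those of \<open>R\<^sub>x\<close>, and it equals the Riesz mean by Bohr's uniqueness theorem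
  (\<open>fejer_conv_eq_riesz_mean\<close>). As the kernel is positive with integral one, Riesz means are bounded
  by the function and converge to it uniformly.

  From the half-plane to the group: on the line \<open>Re s = \<sigma>\<close> the Riesz means of \<open>f\<close> converge uniformly.
  Each of them is the restriction to the dense subgroup \<open>range \<beta>\<close> of a finite sum of characters, so
  these sums converge uniformly on the group. Their limit is a continuous function that represents
  the coefficients and restricts to \<open>f\<close> on the line (\<open>H_inf_plus_line_on_group\<close>). By density its
  supremum is the one over the line, and by the maximum principle this is the one over the half-plane.

  From the group to the half-plane: an element of \<open>L\<^sub>\<infinity>\<close> of the group has no values on the null set
  \<open>range \<beta>\<close>, but its convolution with a continuous bump does. Shrinking the bump shows that
  all Riesz means of the coefficients are bounded by the \<open>L\<^sub>\<infinity>\<close>-norm (\<open>riesz_mean_bound\<close>). Boundedness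
  on the line \<open>Re s = \<sigma> / 2\<close> gives, by the maximum principle and the Cauchy estimates, a common Lipschitz
  constant on \<open>Re s = \<sigma>\<close>. Therefore Fejer smoothing is uniformly accurate on the whole family \<open>R\<^sub>x\<close>;
  since the smoothed \<open>R\<^sub>x\<close> tends to \<open>R\<^sub>y\<close> for \<open>x \<rightarrow> \<infinity>\<close>, the Riesz means are uniformly Cauchy
  (\<open>riesz_poly_Cauchy_on_line\<close>), and their limit is the function sought.

  Two uniqueness theorems enter. Bohr's theorem, that an almost periodic function all of whose
  mean coefficients vanish is zero, is derived from Parseval's identity on a finite cyclic group:
  almost periodicity makes a positive proportion of all translates almost equal to the function,
  which is incompatible with uniformly small Fourier coefficients. Uniqueness of Fourier coefficients
  on the group follows from it: convolutions with continuous functions restrict to almost periodic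
  functions on the subgroup, and a non-zero mean coefficient along \<open>\<beta>\<close> produces the character
  of the group that it belongs to (\<open>twisted_mean\<close>).
\<close>

section \<open>Almost periodic functions and precompactness of translates\<close>

abbreviation uap :: "(real \<Rightarrow> complex) \<Rightarrow> bool" where
  "uap \<equiv> uniformly_almost_periodic"

text \<open>
  The criterion of Bochner, with a finite net of translates. Unlike translation numbers, nets of
  two functions can be refined to a common one.
\<close>

definition precompact_translates :: "(real \<Rightarrow> complex) \<Rightarrow> bool" where
  "precompact_translates g \<longleftrightarrow>
     (\<forall>e>0. \<exists>A. finite A \<and> (\<forall>a. \<exists>b\<in>A. \<forall>x. cmod (g (x + a) - g (x + b)) \<le> e))"

lemma uap_continuous: "uap g \<Longrightarrow> continuous_on UNIV g"
  by (simp add: uniformly_almost_periodic_def)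

lemma uap_translation_number:
  assumes "uap g" "e > 0"
  obtains l where "l > 0" "\<And>a. \<exists>\<tau>\<in>{a..a + l}. \<forall>x. cmod (g x - g (x + \<tau>)) \<le> e"
proof -
  obtain l where l: "l > 0" "\<forall>a. \<exists>\<tau>\<in>{a..a + l}. (SUP x. ereal (cmod (g x - g (x + \<tau>)))) < ereal e"
    using assms unfolding uniformly_almost_periodic_def by blast
  have "\<exists>\<tau>\<in>{a..a + l}. \<forall>x. cmod (g x - g (x + \<tau>)) \<le> e" for a
  proof -
    obtain \<tau> where \<tau>: "\<tau> \<in> {a..a + l}" "(SUP x. ereal (cmod (g x - g (x + \<tau>)))) < ereal e"
      using l(2) by blast
    have "ereal (cmod (g x - g (x + \<tau>))) < ereal e" for x
      by (rule le_less_trans[OF SUP_upper \<tau>(2)]) simp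
    then show ?thesis using \<tau>(1) by (auto intro!: bexI[of _ \<tau>] less_imp_le)
  qed
  with l(1) show ?thesis by (rule that)
qed

text \<open>
  Halving \<open>e\<close> absorbs the loss of strictness when passing to the supremum.
\<close>

lemma uapI:
  assumes "continuous_on UNIV g"
    and "\<And>e. e > 0 \<Longrightarrow> \<exists>l>0. \<forall>a. \<exists>\<tau>\<in>{a..a + l}. \<forall>x. cmod (g x - g (x + \<tau>)) \<le> e"
  shows "uap g"
  unfolding uniformly_almost_periodic_def
proof (intro conjI assms(1) allI impI)
  fix e :: real assume e: "e > 0"
  obtain l where l: "l > 0" "\<forall>a. \<exists>\<tau>\<in>{a..a + l}. \<forall>x. cmod (g x - g (x + \<tau>)) \<le> e / 2"
    using assms(2)[of "e / 2"] e by auto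
  have "\<exists>\<tau>\<in>{a..a + l}. (SUP x. ereal (cmod (g x - g (x + \<tau>)))) < ereal e" for a
  proof -
    obtain \<tau> where \<tau>: "\<tau> \<in> {a..a + l}" "\<forall>x. cmod (g x - g (x + \<tau>)) \<le> e / 2"
      using l(2) by blast
    have "(SUP x. ereal (cmod (g x - g (x + \<tau>)))) \<le> ereal (e / 2)"
      by (rule SUP_least) (use \<tau> in simp)
    also have "\<dots> < ereal e" using e by simp
    finally show ?thesis using \<tau>(1) by blast
  qed
  with l(1) show "\<exists>l>0. \<forall>a. \<exists>\<tau>\<in>{a..a + l}. (SUP x. ereal (cmod (g x - g (x + \<tau>)))) < ereal e"
    by blast
qed

text \<open>
  Every point can be moved into the compact interval \<open>{0..l}\<close> by an almost period.
\<close>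

lemma uap_bounded:
  assumes "uap g" obtains M where "M > 0" "\<And>x. cmod (g x) \<le> M"
proof -
  obtain l where l: "l > 0" "\<And>a. \<exists>\<tau>\<in>{a..a + l}. \<forall>x. cmod (g x - g (x + \<tau>)) \<le> 1"
    using uap_translation_number[OF assms, of 1] by auto
  have "compact (g ` {0..l})"
    by (intro compact_continuous_image continuous_on_subset[OF uap_continuous[OF assms]]) auto
  then obtain B where B: "\<forall>z\<in>g ` {0..l}. cmod z \<le> B"
    using compact_imp_bounded bounded_iff by metis
  have "cmod (g x) \<le> \<bar>B\<bar> + 1" for x
  proof -
    obtain \<tau> where "\<tau> \<in> {-x..-x + l}" "\<forall>x. cmod (g x - g (x + \<tau>)) \<le> 1" using l(2) by blast
    then have "cmod (g x - g (x + \<tau>)) \<le> 1" "x + \<tau> \<in> {0..l}" by auto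
    then have "cmod (g x - g (x + \<tau>)) \<le> 1" "cmod (g (x + \<tau>)) \<le> B" using B by auto
    moreover have "cmod (g x) \<le> cmod (g x - g (x + \<tau>)) + cmod (g (x + \<tau>))"
      by norm
    ultimately show ?thesis by linarith
  qed
  then show ?thesis by (intro that[of "\<bar>B\<bar> + 1"]) auto
qed

lemma uap_uniformly_continuous:
  assumes "uap g" shows "uniformly_continuous_on UNIV g"
  unfolding uniformly_continuous_on_def
proof (intro allI impI)
  fix e :: real assume e: "e > 0"
  obtain l where l: "l > 0" "\<And>a. \<exists>\<tau>\<in>{a..a + l}. \<forall>x. cmod (g x - g (x + \<tau>)) \<le> e / 4"
    using uap_translation_number[OF assms, of "e / 4"] e by auto
  have uc: "uniformly_continuous_on {-1..l + 1} g"
    by (intro compact_uniformly_continuous continuous_on_subset[OF uap_continuous[OF assms]]) auto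
  have "e / 4 > 0" using e by simp
  then obtain d where d: "d > 0"
    "\<And>x y. x \<in> {-1..l+1} \<Longrightarrow> y \<in> {-1..l+1} \<Longrightarrow> dist y x < d \<Longrightarrow> dist (g y) (g x) < e / 4"
    using uniformly_continuous_onE[OF uc] by blast
  have "dist (g y) (g x) < e" if "dist y x < min d 1" for x y
  proof -
    obtain \<tau> where \<tau>: "\<tau> \<in> {-x..-x + l}" "\<forall>x. cmod (g x - g (x + \<tau>)) \<le> e / 4" using l(2) by blast
    have "dist (g (y + \<tau>)) (g (x + \<tau>)) < e / 4"
      using \<tau>(1) that l(1) by (intro d(2)) (auto simp: dist_real_def)
    moreover have "cmod (g x - g (x + \<tau>)) \<le> e / 4" "cmod (g y - g (y + \<tau>)) \<le> e / 4"
      using \<tau>(2) by auto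
    moreover have "dist (g y) (g x) \<le> cmod (g y - g (y + \<tau>)) + dist (g (y + \<tau>)) (g (x + \<tau>)) + cmod (g x - g (x + \<tau>))"
      unfolding dist_norm by norm
    ultimately show ?thesis using e by linarith
  qed
  then show "\<exists>d>0. \<forall>x\<in>UNIV. \<forall>x'\<in>UNIV. dist x' x < d \<longrightarrow> dist (g x') (g x) < e"
    using d(1) by (intro exI[of _ "min d 1"]) auto
qed

lemma uap_modulus:
  assumes "uap g" "e > 0"
  obtains d where "d > 0" "\<And>x y. \<bar>x - y\<bar> < d \<Longrightarrow> cmod (g x - g y) < e"
proof -
  have "\<exists>d>0. \<forall>x y. \<bar>x - y\<bar> < d \<longrightarrow> cmod (g x - g y) < e"
    using uap_uniformly_continuous[OF assms(1)] assms(2)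
    by (simp add: uniformly_continuous_on_def dist_norm) (simp add: abs_minus_commute norm_minus_commute)
  then show ?thesis using that by (elim exE conjE) simp
qed

text \<open>
  Up to an almost period every translation is one by an element of \<open>{0..l}\<close>, and this
  interval has a finite net for the modulus of uniform continuity.
\<close>

lemma uap_precompact:
  assumes "uap g" shows "precompact_translates g"
  unfolding precompact_translates_def
proof (intro allI impI)
  fix e :: real assume e: "e > 0"
  obtain l where l: "l > 0" "\<And>a. \<exists>\<tau>\<in>{a..a + l}. \<forall>x. cmod (g x - g (x + \<tau>)) \<le> e / 2"
    using uap_translation_number[OF assms, of "e / 2"] e by auto
  obtain d where d: "d > 0" "\<And>x y. \<bar>x - y\<bar> < d \<Longrightarrow> cmod (g x - g y) < e / 2"
    using uap_modulus[OF assms half_gt_zero[OF e]] by blast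
  have "compact {0..l}" by simp
  then obtain A where A: "finite A" "{0..l} \<subseteq> (\<Union>x\<in>A. ball x d)"
    using d(1) seq_compact_imp_totally_bounded[of "{0..l}"] compact_imp_seq_compact by metis
  have "\<exists>b\<in>A. \<forall>x. cmod (g (x + a) - g (x + b)) \<le> e" for a
  proof -
    obtain \<tau> where \<tau>: "\<tau> \<in> {-a..-a+l}" "\<forall>x. cmod (g x - g (x + \<tau>)) \<le> e / 2"
      using l(2) by blast
    then have "a + \<tau> \<in> {0..l}" by auto
    then obtain b where b: "b \<in> A" "dist b (a + \<tau>) < d" using A(2) by auto
    have "cmod (g (x + a) - g (x + b)) \<le> e" for x
    proof -
      have "cmod (g (x + a) - g (x + a + \<tau>)) \<le> e / 2" using \<tau>(2) by blast
      moreover have "cmod (g (x + (a + \<tau>)) - g (x + b)) < e / 2"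
        using b(2) by (intro d(2)) (auto simp: dist_real_def)
      moreover have "cmod (g (x + a) - g (x + b)) \<le>
         cmod (g (x + a) - g (x + a + \<tau>)) + cmod (g (x + (a + \<tau>)) - g (x + b))"
        unfolding add.assoc by norm
      ultimately show ?thesis by linarith
    qed
    with b(1) show ?thesis by blast
  qed
  with A(1) show "\<exists>A. finite A \<and> (\<forall>a. \<exists>b\<in>A. \<forall>x. cmod (g (x + a) - g (x + b)) \<le> e)" by blast
qed

text \<open>
  Two translations with close results differ by an almost period. Translating by \<open>a + L\<close> instead of \<open>a\<close> places the difference in an interval that starts at
  \<open>a\<close>.
\<close>

lemma precompact_imp_uap:
  assumes "continuous_on UNIV g" "precompact_translates g" shows "uap g"
proof (rule uapI[OF assms(1)])
  fix e :: real assume "e > 0"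
  then obtain A where A: "finite A" "\<And>a. \<exists>b\<in>A. \<forall>x. cmod (g (x + a) - g (x + b)) \<le> e"
    using assms(2) unfolding precompact_translates_def by meson
  define L where "L = Max (insert 1 (abs ` A))"
  have L: "\<bar>b\<bar> \<le> L" if "b \<in> A" for b
    unfolding L_def using A(1) that by (intro Max_ge) auto
  have L1: "L \<ge> 1" unfolding L_def using A(1) by (intro Max_ge) auto
  have "\<exists>\<tau>\<in>{a..a + 2 * L}. \<forall>x. cmod (g x - g (x + \<tau>)) \<le> e" for a
  proof -
    obtain b where b: "b \<in> A" "\<forall>x. cmod (g (x + (a + L)) - g (x + b)) \<le> e" using A(2) by blast
    have "cmod (g x - g (x + (a + L - b))) \<le> e" for x
      using b(2)[rule_format, of "x - b"] by (simp add: norm_minus_commute add_ac algebra_simps)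
    moreover have "a + L - b \<in> {a..a + 2 * L}" using L[OF b(1)] by auto
    ultimately show ?thesis by blast
  qed
  with L1 show "\<exists>l>0. \<forall>a. \<exists>\<tau>\<in>{a..a + l}. \<forall>x. cmod (g x - g (x + \<tau>)) \<le> e"
    by (intro exI[of _ "2 * L"]) auto
qed

text \<open>
  Colour each \<open>a\<close> by the pair of net points for \<open>f\<close> and
  \<open>g\<close>. There are finitely many colours, and one representative of each colour serves
  both functions.
\<close>

lemma uap_common_net:
  assumes "uap f" "uap g" "e > 0"
  obtains A where "finite A" "\<And>a. \<exists>b\<in>A. \<forall>x. cmod (f (x + a) - f (x + b)) \<le> e \<and> cmod (g (x + a) - g (x + b)) \<le> e"
proof -
  obtain A where A: "finite A" "\<And>a. \<exists>b\<in>A. \<forall>x. cmod (f (x + a) - f (x + b)) \<le> e / 2"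
    using uap_precompact[OF assms(1)] assms(3) unfolding precompact_translates_def
    by (meson half_gt_zero)
  obtain B where B: "finite B" "\<And>a. \<exists>b\<in>B. \<forall>x. cmod (g (x + a) - g (x + b)) \<le> e / 2"
    using uap_precompact[OF assms(2)] assms(3) unfolding precompact_translates_def
    by (meson half_gt_zero)
  obtain p where p: "\<And>a. p a \<in> A" "\<And>a x. cmod (f (x + a) - f (x + p a)) \<le> e / 2"
    using A(2) by metis
  obtain q where q: "\<And>a. q a \<in> B" "\<And>a x. cmod (g (x + a) - g (x + q a)) \<le> e / 2"
    using B(2) by metis
  \<comment> \<open>\<open>r\<close> selects a representative of every colour.\<close>
  define r where "r = (\<lambda>c. SOME a. (p a, q a) = c)"
  have r: "p (r (p a, q a)) = p a \<and> q (r (p a, q a)) = q a" for a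
    unfolding r_def using someI[of "\<lambda>a'. (p a', q a') = (p a, q a)" a] by auto
  have "finite (range (\<lambda>a. (p a, q a)))"
    by (rule finite_subset[of _ "A \<times> B"]) (use p(1) q(1) A(1) B(1) in auto)
  then have fin: "finite (r ` range (\<lambda>a. (p a, q a)))" by simp
  show ?thesis
  proof (rule that[OF fin])
    fix a
    let ?b = "r (p a, q a)"
    have "cmod (f (x + a) - f (x + ?b)) \<le> e \<and> cmod (g (x + a) - g (x + ?b)) \<le> e" for x
      using norm_triangle_le_diff[of "f (x + a) - f (x + p a)" "f (x + ?b) - f (x + p a)" e]
        norm_triangle_le_diff[of "g (x + a) - g (x + q a)" "g (x + ?b) - g (x + q a)" e]
        p(2)[of x a] p(2)[of x ?b] q(2)[of x a] q(2)[of x ?b] r[of a]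
      by (simp add: field_simps)
    then show "\<exists>b\<in>r ` range (\<lambda>a. (p a, q a)). \<forall>x. cmod (f (x + a) - f (x + b)) \<le> e \<and> cmod (g (x + a) - g (x + b)) \<le> e"
      by blast
  qed
qed

lemma uap_combine:
  assumes "uap f" "uap g" "continuous_on UNIV h"
    and "\<And>e. e > 0 \<Longrightarrow> \<exists>d>0. \<forall>u v. cmod (f u - f v) \<le> d \<longrightarrow> cmod (g u - g v) \<le> d \<longrightarrow> cmod (h u - h v) \<le> e"
  shows "uap h"
proof (rule precompact_imp_uap[OF assms(3)], unfold precompact_translates_def, intro allI impI)
  fix e :: real assume e: "e > 0"
  from assms(4)[OF e] obtain d where d0: "d > 0" and
    "\<forall>u v. cmod (f u - f v) \<le> d \<longrightarrow> cmod (g u - g v) \<le> d \<longrightarrow> cmod (h u - h v) \<le> e"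
    by (elim exE conjE)
  then have d: "\<And>u v. cmod (f u - f v) \<le> d \<Longrightarrow> cmod (g u - g v) \<le> d \<Longrightarrow> cmod (h u - h v) \<le> e"
    by simp
  obtain A where A: "finite A"
    "\<And>a. \<exists>b\<in>A. \<forall>x. cmod (f (x + a) - f (x + b)) \<le> d \<and> cmod (g (x + a) - g (x + b)) \<le> d"
    using uap_common_net[OF assms(1,2) d0] by blast
  have "\<exists>b\<in>A. \<forall>x. cmod (h (x + a) - h (x + b)) \<le> e" for a
  proof -
    obtain b where "b \<in> A" "\<And>x. cmod (f (x + a) - f (x + b)) \<le> d \<and> cmod (g (x + a) - g (x + b)) \<le> d"
      using A(2) by blast
    then show ?thesis by (intro bexI[of _ b]) (simp add: d)
  qed
  with A(1) show "\<exists>A. finite A \<and> (\<forall>a. \<exists>b\<in>A. \<forall>x. cmod (h (x + a) - h (x + b)) \<le> e)"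
    by (intro exI[of _ A]) simp
qed

lemma uap_add:
  assumes "uap f" "uap g" shows "uap (\<lambda>t. f t + g t)"
proof (rule uap_combine[OF assms])
  show "continuous_on UNIV (\<lambda>t. f t + g t)"
    using assms by (intro continuous_intros uap_continuous)
  fix e :: real assume e: "e > 0"
  have "cmod (f u + g u - (f v + g v)) \<le> e" if "cmod (f u - f v) \<le> e / 2" "cmod (g u - g v) \<le> e / 2" for u v
    using norm_triangle_ineq[of "f u - f v" "g u - g v"] that
    by (simp only: add_diff_add field_sum_of_halves)
  then show "\<exists>d>0. \<forall>u v. cmod (f u - f v) \<le> d \<longrightarrow> cmod (g u - g v) \<le> d \<longrightarrow> cmod (f u + g u - (f v + g v)) \<le> e"
    using e by (intro exI[of _ "e / 2"] conjI allI impI) simp_all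
qed

lemma uap_mult:
  assumes "uap f" "uap g" shows "uap (\<lambda>t. f t * g t)"
proof (rule uap_combine[OF assms])
  show "continuous_on UNIV (\<lambda>t. f t * g t)"
    using assms by (intro continuous_intros uap_continuous)
  obtain M where M: "M > 0" "\<And>x. cmod (f x) \<le> M" using uap_bounded[OF assms(1)] by blast
  obtain N where N: "N > 0" "\<And>x. cmod (g x) \<le> N" using uap_bounded[OF assms(2)] by blast
  fix e :: real assume e: "e > 0"
  define d where "d = e / (M + N)"
  have d: "d > 0" using e M N by (simp add: d_def)
  have "cmod (f u * g u - f v * g v) \<le> e" if "cmod (f u - f v) \<le> d" "cmod (g u - g v) \<le> d" for u v
  proof -
    have "cmod (f u * g u - f v * g v) = cmod (f u * (g u - g v) + (f u - f v) * g v)"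
      by (simp add: algebra_simps)
    also have "\<dots> \<le> cmod (f u) * cmod (g u - g v) + cmod (f u - f v) * cmod (g v)"
      by (rule order_trans[OF norm_triangle_ineq]) (simp add: norm_mult)
    also have "\<dots> \<le> M * d + d * N"
      using that M N d by (intro add_mono mult_mono) auto
    also have "\<dots> = (M + N) * d" by (simp add: algebra_simps)
    also have "\<dots> = e" using M N by (simp add: d_def)
    finally show ?thesis .
  qed
  then show "\<exists>d>0. \<forall>u v. cmod (f u - f v) \<le> d \<longrightarrow> cmod (g u - g v) \<le> d \<longrightarrow> cmod (f u * g u - f v * g v) \<le> e"
    using d by (intro exI[of _ d] conjI allI impI)
qed

lemma uap_const: "uap (\<lambda>t. c)"
proof (rule uapI)
  fix e :: real assume "e > 0"
  then show "\<exists>l>0. \<forall>a::real. \<exists>\<tau>\<in>{a..a + l}. \<forall>x::real. cmod (c - c) \<le> e"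
    by (intro exI[of _ 1]) (auto intro: bexI[of _ a for a])
qed simp

lemma uap_cis: "uap (\<lambda>t. cis (y * t))"
proof (cases "y = 0")
  case False
  show ?thesis
  proof (rule uapI)
    show "continuous_on UNIV (\<lambda>t. cis (y * t))" by (intro continuous_intros)
    fix e :: real assume e: "e > 0"
    define p where "p = 2 * pi / \<bar>y\<bar>"
    have p: "p > 0" using False by (simp add: p_def)
    have "\<exists>\<tau>\<in>{a..a + p}. \<forall>x. cmod (cis (y * x) - cis (y * (x + \<tau>))) \<le> e" for a
    proof -
      define \<tau> where "\<tau> = p * of_int \<lceil>a / p\<rceil>"
      have "of_int \<lceil>a / p\<rceil> \<le> a / p + 1" by linarith
      then have "\<tau> \<in> {a..a + p}" using p ceiling_divide_upper[OF p, of a]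
        by (auto simp: \<tau>_def field_simps)
      moreover have "cis (y * \<tau>) = 1"
        using cis_multiple_2pi[of "of_int \<lceil>a / p\<rceil>"] cis_multiple_2pi[of "- of_int \<lceil>a / p\<rceil>"] False
        by (auto simp: \<tau>_def p_def abs_if)
      then have "cis (y * (x + \<tau>)) = cis (y * x)" for x
        by (simp add: distrib_left flip: cis_mult)
      ultimately show ?thesis using e by (intro bexI[of _ \<tau>]) auto
    qed
    with p show "\<exists>l>0. \<forall>a. \<exists>\<tau>\<in>{a..a + l}. \<forall>x. cmod (cis (y * x) - cis (y * (x + \<tau>))) \<le> e" by blast
  qed
qed (simp add: uap_const)

lemma uap_cmult: "uap f \<Longrightarrow> uap (\<lambda>t. c * f t)"
  by (intro uap_mult uap_const)

lemma uap_mult_cis: "uap f \<Longrightarrow> uap (\<lambda>t. f t * cis (y * t))"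
  by (intro uap_mult uap_cis)

lemma uap_sum: "(\<And>i. i \<in> I \<Longrightarrow> uap (f i)) \<Longrightarrow> uap (\<lambda>t. \<Sum>i\<in>I. f i t)"
  by (induction I rule: infinite_finite_induct) (auto intro: uap_const uap_add)

lemma uap_diff: "uap f \<Longrightarrow> uap g \<Longrightarrow> uap (\<lambda>t. f t - g t)"
  using uap_add[of f "\<lambda>t. (-1) * g t"] uap_cmult[of g "-1"] by simp

lemma uap_uniform_limit:
  assumes "\<And>e. e > 0 \<Longrightarrow> \<exists>h. uap h \<and> (\<forall>t. cmod (g t - h t) \<le> e)"
  shows "uap g"
proof (rule uapI)
  have "continuous_on UNIV g"
    unfolding continuous_on_iff
  proof (intro ballI allI impI)
    fix x e :: real assume e: "e > 0"
    obtain h where h: "uap h" "\<And>t. cmod (g t - h t) \<le> e / 4" using assms[of "e / 4"] e by auto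
    have "e / 4 > 0" using e by simp
    from uap_modulus[OF h(1) this] obtain d where
      d: "d > 0" "\<And>x y. \<bar>x - y\<bar> < d \<Longrightarrow> cmod (h x - h y) < e / 4" by blast
    have "dist (g x') (g x) < e" if "dist x' x < d" for x'
    proof -
      have "cmod (h x' - h x) < e / 4" using that by (intro d(2)) (simp add: dist_real_def)
      moreover have "dist (g x') (g x) \<le> cmod (g x' - h x') + cmod (h x' - h x) + cmod (g x - h x)"
        unfolding dist_norm by norm
      ultimately show ?thesis using h(2)[of x] h(2)[of x'] e by linarith
    qed
    with d(1) show "\<exists>d>0. \<forall>x'\<in>UNIV. dist x' x < d \<longrightarrow> dist (g x') (g x) < e" by blast
  qed
  then show "continuous_on UNIV g" .
  fix e :: real assume e: "e > 0"
  obtain h where h: "uap h" "\<And>t. cmod (g t - h t) \<le> e / 3" using assms[of "e / 3"] e by auto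
  obtain l where l: "l > 0" "\<And>a. \<exists>\<tau>\<in>{a..a + l}. \<forall>x. cmod (h x - h (x + \<tau>)) \<le> e / 3"
    using uap_translation_number[OF h(1), of "e / 3"] e by auto
  have "cmod (g x - g (x + \<tau>)) \<le> e" if "cmod (h x - h (x + \<tau>)) \<le> e / 3" for x \<tau>
  proof -
    have "cmod (g x - g (x + \<tau>)) \<le> cmod (g x - h x) + cmod (h x - h (x + \<tau>)) + cmod (g (x + \<tau>) - h (x + \<tau>))"
      by norm
    then show ?thesis using h(2)[of x] h(2)[of "x + \<tau>"] that by linarith
  qed
  then have "\<exists>\<tau>\<in>{a..a + l}. \<forall>x. cmod (g x - g (x + \<tau>)) \<le> e" for a
    using l(2)[of a] by auto
  with l(1) show "\<exists>l>0. \<forall>a. \<exists>\<tau>\<in>{a..a + l}. \<forall>x. cmod (g x - g (x + \<tau>)) \<le> e"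
    by (intro exI[of _ l]) simp
qed

lemma uap_translate: "uap g \<Longrightarrow> uap (\<lambda>t. g (t + s))"
proof (rule uapI)
  assume g: "uap g"
  show "continuous_on UNIV (\<lambda>t. g (t + s))"
    by (rule continuous_on_compose2[OF uap_continuous[OF g]]) (auto intro: continuous_intros)
  fix e :: real assume e: "e > 0"
  obtain l where l: "l > 0" "\<And>a. \<exists>\<tau>\<in>{a..a + l}. \<forall>x. cmod (g x - g (x + \<tau>)) \<le> e"
    using uap_translation_number[OF g e] by blast
  show "\<exists>l>0. \<forall>a. \<exists>\<tau>\<in>{a..a + l}. \<forall>x. cmod (g (x + s) - g (x + \<tau> + s)) \<le> e"
  proof (intro exI[of _ l] conjI l(1) allI)
    fix a
    obtain \<tau> where \<tau>: "\<tau> \<in> {a..a + l}" "\<And>x. cmod (g x - g (x + \<tau>)) \<le> e" using l(2) by blast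
    have "cmod (g (x + s) - g (x + \<tau> + s)) \<le> e" for x
      using \<tau>(2)[of "x + s"] by (simp add: add_ac)
    then show "\<exists>\<tau>\<in>{a..a + l}. \<forall>x. cmod (g (x + s) - g (x + \<tau> + s)) \<le> e" using \<tau>(1) by blast
  qed
qed

section \<open>Mean values\<close>

definition has_mean :: "(real \<Rightarrow> complex) \<Rightarrow> complex \<Rightarrow> bool" where
  "has_mean g m \<longleftrightarrow>
     ((\<lambda>T. (1 / (2 * complex_of_real T)) * integral {-T..T} g) \<longlongrightarrow> m) at_top"

definition mean :: "(real \<Rightarrow> complex) \<Rightarrow> complex" where
  "mean g = Lim at_top (\<lambda>T. (1 / (2 * complex_of_real T)) * integral {-T..T} g)"

lemma mean_eqI: "has_mean g m \<Longrightarrow> mean g = m"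
  unfolding has_mean_def mean_def by (rule tendsto_Lim) auto

lemma integral_shift_interval:
  fixes g :: "real \<Rightarrow> complex"
  shows "integral {a..a + T} g = integral {0..T} (\<lambda>t. g (t + a))"
  using integral_shift_real_ivl[of a a "a + T" g] by simp

text \<open>
  An interval is cut into blocks of length \<open>S\<close>; the trivial bound is used only for
  the remainder.
\<close>

lemma integral_block_bound:
  fixes g :: "real \<Rightarrow> complex"
  assumes g: "continuous_on UNIV g" and M: "\<And>x. cmod (g x) \<le> M"
    and S: "S > 0" "\<And>a. cmod (integral {a..a + S} g) \<le> k * S" and T: "T \<ge> 0"
  shows "cmod (integral {b..b + T} g) \<le> k * T + M * S"
proof -
  have int: "g integrable_on {u..v}" for u v
    by (intro integrable_continuous_interval continuous_on_subset[OF g]) simp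
  have k: "k \<ge> 0" using order_trans[OF norm_ge_zero S(2)] S(1) by (simp add: zero_le_mult_iff)
  have M0: "M \<ge> 0" using M norm_ge_zero order_trans by blast
  have blocks: "cmod (integral {b..b + real n * S} g) \<le> k * (real n * S)" for n
  proof (induction n)
    case (Suc n)
    have "integral {b..b + real (Suc n) * S} g =
        integral {b..b + real n * S} g + integral {b + real n * S..b + real n * S + S} g"
      using S(1) by (subst Henstock_Kurzweil_Integration.integral_combine[of b "b + real n * S"])
        (auto intro: int simp: algebra_simps)
    then have "cmod (integral {b..b + real (Suc n) * S} g) \<le> k * (real n * S) + k * S"
      using norm_triangle_le[OF add_mono[OF Suc S(2)]] by simp
    then show ?case by (simp add: algebra_simps)
  qed simp
  define n where "n = nat \<lfloor>T / S\<rfloor>"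
  have "real n = of_int \<lfloor>T / S\<rfloor>" using S(1) T by (simp add: n_def)
  then have "real n \<le> T / S" "T / S < real n + 1" by linarith+
  then have n: "real n * S \<le> T" "T \<le> real n * S + S" using S(1) by (auto simp: field_simps)
  have "integral {b..b + T} g = integral {b..b + real n * S} g + integral {b + real n * S..b + T} g"
    using S(1) n by (subst Henstock_Kurzweil_Integration.integral_combine[of b "b + real n * S"])
      (auto intro: int)
  moreover have "cmod (integral {b + real n * S..b + T} g) \<le> M * (b + T - (b + real n * S))"
    using n M by (intro integral_bound continuous_on_subset[OF g]) auto
  moreover have "M * (b + T - (b + real n * S)) \<le> M * S" using n M0 by (intro mult_left_mono) auto
  moreover have "k * (real n * S) \<le> k * T" using n k by (intro mult_left_mono)
  ultimately show ?thesis
    using norm_triangle_ineq[of "integral {b..b + real n * S} g" "integral {b + real n * S..b + T} g"] blocks[of n]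
    by simp
qed

text \<open>
  The mean over a long block depends only slightly on its position: up to \<open>e / 2\<close> the
  translation may be taken from a finite set, and a bounded shift changes the integral by a
  bounded amount.
\<close>

lemma uap_block_mean:
  assumes "uap g" "e > 0"
  shows "\<exists>S>0. \<exists>m. \<forall>a. cmod (integral {a..a + S} g - of_real S * m) \<le> e * S"
proof -
  have cont: "continuous_on X g" for X
    using continuous_on_subset[OF uap_continuous[OF assms(1)]] by simp
  have int: "g integrable_on {u..v}" for u v
    by (intro integrable_continuous_interval cont)
  obtain M where M: "M > 0" "\<And>x. cmod (g x) \<le> M" using uap_bounded[OF assms(1)] by blast
  obtain A where A: "finite A" "\<And>a. \<exists>b\<in>A. \<forall>x. cmod (g (x + a) - g (x + b)) \<le> e / 2"
    using uap_precompact[OF assms(1)] half_gt_zero[OF assms(2)] unfolding precompact_translates_def by blast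
  define L where "L = Max (insert 1 (abs ` A))"
  have L: "\<bar>b\<bar> \<le> L" if "b \<in> A" for b
    unfolding L_def using A(1) that by (intro Max_ge) auto
  have L1: "L \<ge> 1" unfolding L_def using A(1) by (intro Max_ge) auto
  define S where "S = 4 * M * L / e"
  have S: "S > 0" using M L1 assms(2) by (simp add: S_def)
  have SL: "2 * M * L = (e / 2) * S" using assms(2) by (simp add: S_def)
  have near: "cmod (integral {b..b + S} g - integral {0..S} g) \<le> 2 * M * L" if b: "b \<in> A" for b
  proof -
    have bd: "cmod (integral {u..v} g) \<le> M * (v - u)" if "u \<le> v" for u v
      using that M(2) by (intro integral_bound cont) auto
    have split: "integral {u..w} g = integral {u..v} g + integral {v..w} g" if "u \<le> v" "v \<le> w" for u v w
      by (rule Henstock_Kurzweil_Integration.integral_combine[symmetric]) (use that int in auto)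
    have "cmod (integral {b..b + S} g - integral {0..S} g) \<le> 2 * (M * \<bar>b\<bar>)"
    proof (cases "b \<ge> 0")
      case True
      have "integral {0..b} g + integral {b..b + S} g = integral {0..S} g + integral {S..b + S} g"
        using split[of 0 b "b + S"] split[of 0 S "b + S"] True S by auto
      then have "integral {b..b + S} g - integral {0..S} g = integral {S..b + S} g - integral {0..b} g"
        by (simp add: algebra_simps)
      then show ?thesis
        using norm_triangle_ineq4[of "integral {S..b + S} g" "integral {0..b} g"] bd[of S "b + S"] bd[of 0 b] True
        by simp
    next
      case False
      have "integral {b..b + S} g + integral {b + S..S} g = integral {b..0} g + integral {0..S} g"
        using split[of b 0 S] split[of b "b + S" S] False S by auto
      then have "integral {b..b + S} g - integral {0..S} g = integral {b..0} g - integral {b + S..S} g"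
        by (simp add: algebra_simps)
      then show ?thesis
        using norm_triangle_ineq4[of "integral {b..0} g" "integral {b + S..S} g"] bd[of "b + S" S] bd[of b 0] False
        by simp
    qed
    also have "\<dots> \<le> 2 * (M * L)" using L[OF b] M by (intro mult_left_mono) auto
    finally show ?thesis by simp
  qed
  define m where "m = integral {0..S} g / of_real S"
  have "cmod (integral {a..a + S} g - of_real S * m) \<le> e * S" for a
  proof -
    obtain b where b: "b \<in> A" "\<And>x. cmod (g (x + a) - g (x + b)) \<le> e / 2" using A(2) by blast
    have shift: "continuous_on {0..S} (\<lambda>x. g (x + c))" for c
      by (rule continuous_on_compose2[OF cont[of UNIV]]) (auto intro: continuous_intros)
    have "integral {a..a + S} g - integral {b..b + S} g = integral {0..S} (\<lambda>x. g (x + a) - g (x + b))"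
      using S by (simp add: integral_shift_interval cont Henstock_Kurzweil_Integration.integral_diff
          integrable_continuous_interval shift)
    also have "cmod \<dots> \<le> e / 2 * (S - 0)"
      using S b(2) by (intro integral_bound continuous_intros shift) auto
    finally have 1: "cmod (integral {a..a + S} g - integral {b..b + S} g) \<le> e / 2 * S" by simp
    have 2: "cmod (integral {b..b + S} g - integral {0..S} g) \<le> e / 2 * S" using near[OF b(1)] SL by simp
    have "integral {a..a + S} g - of_real S * m =
        (integral {a..a + S} g - integral {b..b + S} g) + (integral {b..b + S} g - integral {0..S} g)"
      using S by (simp add: m_def)
    then show ?thesis using norm_triangle_le[OF add_mono[OF 1 2]] by (simp add: field_simps)
  qed
  with S show ?thesis by blast
qed

lemma uap_approx_mean:
  assumes "uap g" "e > 0"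
  shows "\<exists>m T0. T0 > 0 \<and> (\<forall>T\<ge>T0. \<forall>b. cmod (integral {b..b + T} g - of_real T * m) \<le> e * T)"
proof -
  obtain S m where S: "S > 0" "\<And>a. cmod (integral {a..a + S} g - of_real S * m) \<le> (e / 2) * S"
    using uap_block_mean[OF assms(1) half_gt_zero[OF assms(2)]] by blast
  obtain M where M: "M > 0" "\<And>x. cmod (g x) \<le> M" using uap_bounded[OF assms(1)] by blast
  have cont: "continuous_on X g" for X
    using continuous_on_subset[OF uap_continuous[OF assms(1)]] by simp
  have int: "integral {b..b + T} (\<lambda>x. g x - m) = integral {b..b + T} g - of_real T * m" if "T \<ge> 0" for b T
    using that by (subst Henstock_Kurzweil_Integration.integral_diff)
      (auto intro: integrable_continuous_interval cont simp: scaleR_conv_of_real)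
  define B where "B = M + cmod m"
  define T0 where "T0 = 2 * B * S / e"
  have "T0 > 0" using S(1) M(1) assms(2) by (simp add: T0_def B_def add_pos_nonneg)
  moreover have "cmod (integral {b..b + T} g - of_real T * m) \<le> e * T" if "T \<ge> T0" for T b
  proof -
    have T: "T \<ge> 0" using that \<open>T0 > 0\<close> by simp
    have "cmod (integral {b..b + T} (\<lambda>x. g x - m)) \<le> (e / 2) * T + B * S"
    proof (rule integral_block_bound[OF _ _ S(1) _ T])
      show "continuous_on UNIV (\<lambda>x. g x - m)" by (intro continuous_intros cont)
      show "cmod (g x - m) \<le> B" for x using norm_triangle_ineq4[of "g x" m] M(2)[of x] by (simp add: B_def)
      show "cmod (integral {a..a + S} (\<lambda>x. g x - m)) \<le> e / 2 * S" for a
        using S by (simp add: int)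
    qed
    moreover have "B * S \<le> e / 2 * T" using that assms(2) by (simp add: T0_def field_simps)
    ultimately show ?thesis using int[OF T] by simp
  qed
  ultimately show ?thesis by blast
qed

text \<open>
  Block means for different precisions are compared on one very long interval; this makes them a
  Cauchy sequence.
\<close>

theorem uap_uniform_mean:
  assumes "uap g"
  shows "\<exists>m. \<forall>e>0. \<exists>T0>0. \<forall>T\<ge>T0. \<forall>b. cmod (integral {b..b + T} g - of_real T * m) \<le> e * T"
proof -
  have "\<forall>k::nat. \<exists>m T0. T0 > 0 \<and> (\<forall>T\<ge>T0. \<forall>b. cmod (integral {b..b + T} g - of_real T * m) \<le> (1 / Suc k) * T)"
    using uap_approx_mean[OF assms] by (metis of_nat_0_less_iff zero_less_Suc zero_less_divide_1_iff)
  then obtain m T where T: "\<And>k. T k > 0"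
    and m: "\<And>k t b. t \<ge> T k \<Longrightarrow> cmod (integral {b..b + t} g - of_real t * m k) \<le> (1 / Suc k) * t"
    unfolding choice_iff by blast
  have close: "cmod (m j - m k) \<le> 1 / Suc j + 1 / Suc k" for j k
  proof -
    define t where "t = max (T j) (T k)"
    have t: "t \<ge> T j" "t \<ge> T k" "t > 0" using T[of j] by (auto simp: t_def)
    have "cmod (of_real t * (m j - m k)) \<le> (1 / Suc j) * t + (1 / Suc k) * t"
      using norm_triangle_le_diff[OF add_mono[OF m[OF t(2), of 0] m[OF t(1), of 0]]]
      by (simp add: algebra_simps)
    also have "\<dots> = t * (1 / Suc j + 1 / Suc k)" by (simp only: distrib_left mult.commute)
    finally show ?thesis using t(3) by (simp add: norm_mult)
  qed
  have inv: "\<exists>N. \<forall>k\<ge>N. 1 / real (Suc k) < e" if e: "e > 0" for e :: real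
  proof -
    obtain N where N: "inverse (real (Suc N)) < e" using reals_Archimedean[OF e] by blast
    have "1 / real (Suc k) < e" if "k \<ge> N" for k
    proof -
      have "1 / real (Suc k) \<le> 1 / real (Suc N)" using that by (intro divide_left_mono) auto
      then show ?thesis using N by (simp add: inverse_eq_divide)
    qed
    then show ?thesis by blast
  qed
  have "Cauchy m"
  proof (rule metric_CauchyI)
    fix e :: real assume e: "e > 0"
    obtain N where N: "\<And>k. k \<ge> N \<Longrightarrow> 1 / real (Suc k) < e / 2" using inv[OF half_gt_zero[OF e]] by blast
    have "dist (m j) (m k) < e" if "j \<ge> N" "k \<ge> N" for j k
      using close[of j k] N[OF that(1)] N[OF that(2)] by (simp add: dist_norm)
    then show "\<exists>N. \<forall>j\<ge>N. \<forall>k\<ge>N. dist (m j) (m k) < e" by blast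
  qed
  then obtain l where l: "m \<longlonglongrightarrow> l" using Cauchy_convergent_iff convergent_def by blast
  have "\<exists>T0>0. \<forall>t\<ge>T0. \<forall>b. cmod (integral {b..b + t} g - of_real t * l) \<le> e * t" if e: "e > 0" for e
  proof -
    obtain N where N: "\<And>k. k \<ge> N \<Longrightarrow> 1 / real (Suc k) < e / 2" using inv[OF half_gt_zero[OF e]] by blast
    obtain N' where N': "\<And>k. k \<ge> N' \<Longrightarrow> cmod (m k - l) < e / 2"
      using LIMSEQ_D[OF l half_gt_zero[OF e]] by blast
    define k where "k = max N N'"
    have k: "1 / real (Suc k) < e / 2" "cmod (m k - l) < e / 2" using N N' by (auto simp: k_def)
    have "cmod (integral {b..b + t} g - of_real t * l) \<le> e * t" if t: "t \<ge> T k" for t b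
    proof -
      have t0: "t > 0" using t T[of k] by linarith
      have "integral {b..b + t} g - of_real t * l = (integral {b..b + t} g - of_real t * m k) + of_real t * (m k - l)"
        by (simp add: algebra_simps)
      also have "cmod \<dots> \<le> (1 / Suc k) * t + t * cmod (m k - l)"
        by (rule norm_triangle_le, rule add_mono[OF m[OF t]]) (use t0 in \<open>simp add: norm_mult\<close>)
      also have "\<dots> \<le> (e / 2) * t + t * (e / 2)"
        using k t0 by (intro add_mono mult_right_mono mult_left_mono) auto
      finally show ?thesis by (simp add: field_simps)
    qed
    then show ?thesis using T[of k] by blast
  qed
  then show ?thesis by blast
qed

lemma uap_has_mean_mean: "uap g \<Longrightarrow> has_mean g (mean g)"
  and uap_mean_uniform: "uap g \<Longrightarrow> e > 0 \<Longrightarrow>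
    \<exists>T0>0. \<forall>T\<ge>T0. \<forall>b. cmod (integral {b..b + T} g - of_real T * mean g) \<le> e * T"
proof -
  assume "uap g"
  then obtain m where m: "\<And>e. e > 0 \<Longrightarrow>
      \<exists>T0>0. \<forall>T\<ge>T0. \<forall>b. cmod (integral {b..b + T} g - of_real T * m) \<le> e * T"
    using uap_uniform_mean by blast
  have "has_mean g m"
    unfolding has_mean_def tendsto_iff
  proof (intro allI impI)
    fix e :: real assume e: "e > 0"
    obtain T0 where T0: "T0 > 0"
      "\<And>T b. T \<ge> T0 \<Longrightarrow> cmod (integral {b..b + T} g - of_real T * m) \<le> (e / 2) * T"
      using m[OF half_gt_zero[OF e]] by blast
    have "dist (1 / (2 * complex_of_real T) * integral {-T..T} g) m < e" if T: "T \<ge> T0" for T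
    proof -
      have pos: "T > 0" using T T0(1) by simp
      have "cmod (integral {-T..T} g - of_real (2 * T) * m) \<le> (e / 2) * (2 * T)"
        using T0(2)[of "2 * T" "-T"] T pos by simp
      moreover have "1 / (2 * complex_of_real T) * integral {-T..T} g - m =
          (integral {-T..T} g - of_real (2 * T) * m) / of_real (2 * T)"
        using pos by (simp add: field_simps)
      ultimately have "cmod (1 / (2 * complex_of_real T) * integral {-T..T} g - m) \<le> e / 2"
        using pos by (simp add: norm_divide pos_divide_le_eq mult_ac)
      then show ?thesis using e by (simp add: dist_norm)
    qed
    then show "\<forall>\<^sub>F T in at_top. dist (1 / (2 * complex_of_real T) * integral {-T..T} g) m < e"
      by (rule eventually_mono[OF eventually_ge_at_top])
  qed
  then have "mean g = m" by (rule mean_eqI)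
  with \<open>has_mean g m\<close> show "has_mean g (mean g)" by simp
  show "e > 0 \<Longrightarrow> \<exists>T0>0. \<forall>T\<ge>T0. \<forall>b. cmod (integral {b..b + T} g - of_real T * mean g) \<le> e * T"
    using m[of e] \<open>mean g = m\<close> by simp
qed

lemma has_mean_cmult: "has_mean f m \<Longrightarrow> has_mean (\<lambda>t. c * f t) (c * m)"
  unfolding has_mean_def by (drule tendsto_mult_left[of _ _ _ c]) simp

lemma mean_cmult: "uap f \<Longrightarrow> mean (\<lambda>t. c * f t) = c * mean f"
  by (intro mean_eqI has_mean_cmult uap_has_mean_mean)

lemma mean_add:
  assumes "uap f" "uap g" shows "mean (\<lambda>t. f t + g t) = mean f + mean g"
proof (rule mean_eqI)
  have "integral {-T..T} (\<lambda>t. f t + g t) = integral {-T..T} f + integral {-T..T} g" for T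
    using assms[THEN uap_continuous]
    by (intro Henstock_Kurzweil_Integration.integral_add integrable_continuous_interval)
      (auto intro: continuous_on_subset)
  then show "has_mean (\<lambda>t. f t + g t) (mean f + mean g)"
    using tendsto_add[OF uap_has_mean_mean[OF assms(1), unfolded has_mean_def]
        uap_has_mean_mean[OF assms(2), unfolded has_mean_def]]
    by (simp add: has_mean_def distrib_left)
qed

lemma mean_diff: "uap f \<Longrightarrow> uap g \<Longrightarrow> mean (\<lambda>t. f t - g t) = mean f - mean g"
  using mean_add[of f "\<lambda>t. (-1) * g t"] uap_cmult[of g "-1"] mean_cmult[of g "-1"] by simp

lemma mean_const: "mean (\<lambda>t. c) = c"
proof (rule mean_eqI)
  have "\<forall>\<^sub>F T in at_top. 1 / (2 * complex_of_real T) * integral {-T..T} (\<lambda>t. c) = c"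
    using eventually_gt_at_top[of 0] by eventually_elim (simp add: scaleR_conv_of_real)
  then show "has_mean (\<lambda>t. c) c"
    unfolding has_mean_def by (rule tendsto_eventually)
qed

lemma mean_sum:
  "(\<And>i. i \<in> I \<Longrightarrow> uap (f i)) \<Longrightarrow> mean (\<lambda>t. \<Sum>i\<in>I. f i t) = (\<Sum>i\<in>I. mean (f i))"
  by (induction I rule: infinite_finite_induct) (auto simp: mean_const mean_add uap_sum)

lemma mean_bound:
  assumes "uap g" "\<And>t. cmod (g t) \<le> B" shows "cmod (mean g) \<le> B"
proof (rule tendsto_upperbound[OF tendsto_norm[OF uap_has_mean_mean[OF assms(1), unfolded has_mean_def]]])
  have "cmod (1 / (2 * complex_of_real T) * integral {-T..T} g) \<le> B" if "T > 0" for T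
  proof -
    have "cmod (integral {-T..T} g) \<le> B * (T - (-T))"
      using that assms(2) by (intro integral_bound continuous_on_subset[OF uap_continuous[OF assms(1)]]) auto
    then show ?thesis using that by (simp add: norm_mult norm_divide field_simps)
  qed
  then show "\<forall>\<^sub>F T in at_top. cmod (1 / (2 * complex_of_real T) * integral {-T..T} g) \<le> B"
    by (rule eventually_mono[OF eventually_gt_at_top])
qed auto

lemma mean_close:
  assumes "uap f" "uap g" "\<And>t. cmod (f t - g t) \<le> e" shows "cmod (mean f - mean g) \<le> e"
  using mean_bound[OF uap_diff[OF assms(1,2)] assms(3)] mean_diff[OF assms(1,2)] by simp

text \<open>
  Immediate from the uniformity of the mean with respect to the position of the interval.
\<close>

lemma mean_translate:
  assumes "uap g" shows "mean (\<lambda>t. g (t + s)) = mean g"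
proof -
  have "cmod (mean (\<lambda>t. g (t + s)) - mean g) \<le> e" if e: "e > 0" for e
  proof -
    obtain T1 where T1: "T1 > 0" "\<And>T b. T \<ge> T1 \<Longrightarrow> cmod (integral {b..b + T} g - of_real T * mean g) \<le> (e / 2) * T"
      using uap_mean_uniform[OF assms half_gt_zero[OF e]] by blast
    obtain T2 where T2: "T2 > 0" "\<And>T b. T \<ge> T2 \<Longrightarrow>
        cmod (integral {b..b + T} (\<lambda>t. g (t + s)) - of_real T * mean (\<lambda>t. g (t + s))) \<le> (e / 2) * T"
      using uap_mean_uniform[OF uap_translate[OF assms] half_gt_zero[OF e]] by blast
    define T where "T = max T1 T2"
    have T: "T > 0" "T \<ge> T1" "T \<ge> T2" using T1(1) by (auto simp: T_def)
    have "integral {s..s + T} g = integral {0..0 + T} (\<lambda>t. g (t + s))"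
      by (simp add: integral_shift_interval[of s])
    then have "cmod (of_real T * (mean (\<lambda>t. g (t + s)) - mean g)) \<le> e / 2 * T + e / 2 * T"
      using norm_triangle_le_diff[OF add_mono[OF T1(2)[OF T(2), of s] T2(2)[OF T(3), of 0]]]
      by (simp add: algebra_simps)
    then show ?thesis using T(1) by (simp add: norm_mult)
  qed
  then have "cmod (mean (\<lambda>t. g (t + s)) - mean g) \<le> 0" by (rule field_le_epsilon) simp
  then show ?thesis by simp
qed

text \<open>
  Translation by half a period changes the sign.
\<close>

lemma mean_cis: "mean (\<lambda>t. cis (y * t)) = (if y = 0 then 1 else 0)"
proof (cases "y = 0")
  case False
  define s where "s = pi / y"
  have "cis (y * (t + s)) = - 1 * cis (y * t)" for t
    using False by (simp add: s_def distrib_left flip: cis_mult)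
  then have "mean (\<lambda>t. cis (y * (t + s))) = - mean (\<lambda>t. cis (y * t))"
    using mean_cmult[OF uap_cis, of "-1" y] by simp
  then show ?thesis using mean_translate[OF uap_cis, of y s] False by simp
qed (simp add: mean_const)

section \<open>Recurrence and the discrete Fourier transform\<close>

definition dft :: "nat \<Rightarrow> (nat \<Rightarrow> complex) \<Rightarrow> nat \<Rightarrow> complex" where
  "dft N u k = (\<Sum>j<N. u j * cis (- (2 * pi * real k * real j / real N)))"

lemma cis_sum_orthogonal:
  assumes "a < N" "b < N"
  shows "(\<Sum>k<N. cis (2 * pi * real k * real a / real N) * cis (- (2 * pi * real k * real b / real N))) =
         (if a = b then of_nat N else 0)"
proof -
  define z where "z = cis (2 * pi * (real a - real b) / real N)"
  have N: "N > 0" using assms by simp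
  have "cis (2 * pi * real k * real a / real N) * cis (- (2 * pi * real k * real b / real N)) = z ^ k" for k
    unfolding z_def cis_mult Complex.DeMoivre by (rule arg_cong[of _ _ cis]) (simp add: algebra_simps diff_divide_distrib)
  then have eq: "(\<Sum>k<N. cis (2 * pi * real k * real a / real N) * cis (- (2 * pi * real k * real b / real N))) =
      (\<Sum>k<N. z ^ k)" by simp
  show ?thesis
  proof (cases "a = b")
    case True
    then have "z = 1" by (simp add: z_def)
    with eq True show ?thesis by simp
  next
    case False
    have "z \<noteq> 1"
    proof
      assume "z = 1"
      then obtain n :: int where n: "2 * pi * (real a - real b) / real N = of_int n * (2 * pi)"
        unfolding z_def cis_eq_1_iff by blast
      then have "(2 * pi) * (real a - real b) = (2 * pi) * (of_int n * real N)"
        using N by (simp add: field_simps)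
      then have "real a - real b = of_int n * real N" by (simp only: mult_cancel_left) simp
      then have "int a - int b = n * int N"
        by (metis of_int_diff of_int_eq_iff of_int_mult of_int_of_nat_eq)
      moreover have "\<bar>int a - int b\<bar> < int N" using assms by auto
      ultimately have "\<bar>n\<bar> * int N < 1 * int N" by (simp add: abs_mult)
      then have "n = 0" by (simp only: mult_less_cancel_right) auto
      with \<open>int a - int b = n * int N\<close> False show False by simp
    qed
    moreover have "z ^ N = 1"
      unfolding z_def Complex.DeMoivre
    proof -
      have "real N * (2 * pi * (real a - real b) / real N) = 2 * pi * of_int (int a - int b)"
        using N by simp
      then show "cis (real N * (2 * pi * (real a - real b) / real N)) = 1"
        by (simp only: cis_multiple_2pi Ints_of_int)
    qed
    ultimately show ?thesis using eq False by (simp add: geometric_sum)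
  qed
qed

lemma dft_parseval:
  "(\<Sum>k<N. dft N v k * cnj (dft N u k)) = of_nat N * (\<Sum>j<N. v j * cnj (u j))"
proof -
  have "(\<Sum>k<N. dft N v k * cnj (dft N u k)) =
      (\<Sum>k<N. \<Sum>b<N. \<Sum>a<N. v b * cnj (u a) *
        (cis (2 * pi * real k * real a / real N) * cis (- (2 * pi * real k * real b / real N))))"
    unfolding dft_def by (simp add: sum_product cis_cnj mult_ac)
  also have "\<dots> = (\<Sum>b<N. \<Sum>a<N. \<Sum>k<N. v b * cnj (u a) *
        (cis (2 * pi * real k * real a / real N) * cis (- (2 * pi * real k * real b / real N))))"
    by (subst sum.swap, rule sum.cong[OF refl], subst sum.swap) simp
  also have "\<dots> = (\<Sum>b<N. \<Sum>a<N. v b * cnj (u a) * (if a = b then of_nat N else 0))"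
    by (intro sum.cong refl) (simp only: sum_distrib_left[symmetric] cis_sum_orthogonal lessThan_iff)
  also have "\<dots> = (\<Sum>b<N. v b * cnj (u b) * of_nat N)"
    by (intro sum.cong refl) (simp add: if_distrib[of "\<lambda>x. _ * x"] sum.delta cong: if_cong)
  finally show ?thesis by (simp add: sum_distrib_left mult_ac)
qed

lemma bij_betw_add_mod:
  assumes "m < N" shows "bij_betw (\<lambda>j. (j + m) mod N) {..<N} {..<N::nat}"
proof -
  have "inj_on (\<lambda>j. (j + m) mod N) {..<N}"
  proof (rule inj_onI)
    fix i j assume ij: "i \<in> {..<N}" "j \<in> {..<N}" "(i + m) mod N = (j + m) mod N"
    have "(k + m) mod N = (if k + m < N then k + m else k + m - N)" if "k \<in> {..<N}" for k
      using that assms by (simp add: le_mod_geq)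
    with ij show "i = j" using assms by (auto split: if_splits)
  qed
  moreover have "(\<lambda>j. (j + m) mod N) ` {..<N} \<subseteq> {..<N}" using assms by auto
  ultimately show ?thesis
    by (simp add: bij_betw_def endo_inj_surj)
qed

lemma cis_mod_period:
  assumes "N > 0"
  shows "cis (2 * pi * real k * real (i mod N) / real N) = cis (2 * pi * real k * real i / real N)"
proof -
  have "real i = real N * real (i div N) + real (i mod N)"
    by (metis mult_div_mod_eq of_nat_add of_nat_mult)
  then have "2 * pi * real k * real i / real N =
      2 * pi * real k * real (i mod N) / real N + 2 * pi * of_nat (k * (i div N))"
    using assms by (simp add: field_simps)
  then show ?thesis by (simp only: cis_mult[symmetric] cis_multiple_2pi Ints_of_nat mult_1_right)
qed

text \<open>
  Cyclic shifts are diagonalised by the transform, since \<open>cis (2 * pi * k * i / N)\<close>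
  depends on \<open>i\<close> only modulo \<open>N\<close>.
\<close>

lemma dft_shift:
  assumes "m < N"
  shows "dft N (\<lambda>j. u ((j + m) mod N)) k = cis (2 * pi * real k * real m / real N) * dft N u k"
proof -
  have N: "N > 0" using assms by simp
  have "cis (- (2 * pi * real k * real j / real N)) =
      cis (2 * pi * real k * real m / real N) * cis (- (2 * pi * real k * real ((j + m) mod N) / real N))" for j
  proof -
    have "cis (- (2 * pi * real k * real ((j + m) mod N) / real N)) =
        cis (- (2 * pi * real k * real (j + m) / real N))"
      using arg_cong[OF cis_mod_period[OF N, of k "j + m"], of cnj] by (simp only: cis_cnj)
    then show ?thesis by (simp add: cis_mult) (simp add: add_divide_distrib distrib_left)
  qed
  then have "dft N (\<lambda>j. u ((j + m) mod N)) k =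
     (\<Sum>j<N. cis (2 * pi * real k * real m / real N) *
        (u ((j + m) mod N) * cis (- (2 * pi * real k * real ((j + m) mod N) / real N))))"
    unfolding dft_def by (intro sum.cong refl) (simp add: mult_ac)
  also have "\<dots> = cis (2 * pi * real k * real m / real N) * dft N u k"
    unfolding dft_def sum_distrib_left[symmetric]
    by (subst sum.reindex_bij_betw[OF bij_betw_add_mod[OF assms]]) simp
  finally show ?thesis .
qed

text \<open>
  If \<open>S\<close> is a set of almost periods of \<open>u\<close>, then the sum of the shifts
  of \<open>u\<close> by \<open>S\<close> is close to \<open>card S * u\<close>, so its inner
  product with \<open>u\<close> is about \<open>card S * E\<close>. On the Fourier side this inner
  product is the sum of \<open>\<bar>dft N u k\<bar>\<^sup>2\<close> against the transform of
  \<open>S\<close>; one factor \<open>\<bar>dft N u k\<bar>\<close> is bounded by \<open>\<kappa> * N\<close> and the rest by the inequality of Cauchy and Schwarz together with Parseval's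
  identity.
\<close>

lemma dft_recurrence_bound:
  fixes u :: "nat \<Rightarrow> complex"
  assumes N: "N > 0" and S: "S \<subseteq> {..<N}"
    and small: "\<And>k. k < N \<Longrightarrow> cmod (dft N u k) \<le> \<kappa> * real N"
    and rec: "\<And>m j. m \<in> S \<Longrightarrow> j < N \<Longrightarrow> cmod (u ((j + m) mod N) - u j) \<le> \<epsilon>"
    and M: "\<And>j. j < N \<Longrightarrow> cmod (u j) \<le> M" and E: "E = (\<Sum>j<N. (cmod (u j))\<^sup>2)"
  shows "real (card S) * (E - \<epsilon> * M * real N) \<le> \<kappa> * real N * sqrt E * sqrt (real (card S))"
proof (cases "S = {}")
  case False
  have finS: "finite S" using S finite_subset by blast
  have eps: "\<epsilon> \<ge> 0" using False rec[of _ 0] N by (metis equals0I norm_ge_zero order_trans)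
  have \<kappa>: "\<kappa> * real N \<ge> 0" using small[of 0] N norm_ge_zero order_trans by blast
  define P where "P = (\<Sum>m\<in>S. \<Sum>j<N. u ((j + m) mod N) * cnj (u j))"
  define s where "s = (\<lambda>k. \<Sum>m\<in>S. cis (2 * pi * real k * real m / real N))"
  have E': "complex_of_real E = (\<Sum>j<N. u j * cnj (u j))"
    by (simp only: E of_real_sum complex_norm_square)
  have lower: "Re (\<Sum>j<N. u ((j + m) mod N) * cnj (u j)) \<ge> E - \<epsilon> * M * real N" if m: "m \<in> S" for m
  proof -
    have "cmod ((\<Sum>j<N. u ((j + m) mod N) * cnj (u j)) - complex_of_real E) =
        cmod (\<Sum>j<N. (u ((j + m) mod N) - u j) * cnj (u j))"
      by (simp add: E' sum_subtractf left_diff_distrib)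
    also have "\<dots> \<le> (\<Sum>j<N. \<epsilon> * M)"
      by (intro sum_norm_le) (use rec[OF m] M eps in \<open>auto simp: norm_mult intro!: mult_mono\<close>)
    finally have "cmod ((\<Sum>j<N. u ((j + m) mod N) * cnj (u j)) - complex_of_real E) \<le> \<epsilon> * M * real N"
      by (simp add: mult_ac)
    then show ?thesis
      using abs_Re_le_cmod[of "(\<Sum>j<N. u ((j + m) mod N) * cnj (u j)) - complex_of_real E"] by simp
  qed
  have "real (card S) * (E - \<epsilon> * M * real N) \<le> Re P"
    unfolding P_def Re_sum using sum_bounded_below[OF lower] by simp
  also have "\<dots> \<le> cmod P" by (rule complex_Re_le_cmod)
  finally have 1: "real (card S) * (E - \<epsilon> * M * real N) \<le> cmod P" .
  have "of_nat N * P = (\<Sum>m\<in>S. \<Sum>k<N. dft N (\<lambda>j. u ((j + m) mod N)) k * cnj (dft N u k))"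
    by (simp add: P_def sum_distrib_left dft_parseval)
  also have "\<dots> = (\<Sum>m\<in>S. \<Sum>k<N. cis (2 * pi * real k * real m / real N) * (dft N u k * cnj (dft N u k)))"
    by (intro sum.cong refl) (use S in \<open>auto simp: dft_shift mult.assoc\<close>)
  also have "\<dots> = (\<Sum>k<N. s k * (dft N u k * cnj (dft N u k)))"
    by (subst sum.swap) (simp add: s_def sum_distrib_right)
  finally have P: "of_nat N * P = (\<Sum>k<N. s k * (dft N u k * cnj (dft N u k)))" .
  have sumU: "(\<Sum>k<N. (cmod (dft N u k))\<^sup>2) = real N * E"
  proof -
    have "complex_of_real (\<Sum>k<N. (cmod (dft N u k))\<^sup>2) = complex_of_real (real N * E)"
      using dft_parseval[of N u u] by (simp only: E' of_real_sum complex_norm_square of_real_mult of_real_of_nat_eq)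
    then show ?thesis by (simp only: of_real_eq_iff)
  qed
  have sums: "(\<Sum>k<N. (cmod (s k))\<^sup>2) = real N * real (card S)"
  proof -
    define i where "i = (\<lambda>j. if j \<in> S then 1 else 0 :: complex)"
    have sk: "s k = cnj (dft N i k)" for k
    proof -
      have "dft N i k = (\<Sum>j\<in>S. cis (- (2 * pi * real k * real j / real N)))"
        unfolding dft_def i_def using S
        by (simp add: if_distrib[of "\<lambda>x. x * _"] sum.If_cases Int_absorb1 cong: if_cong)
      then show ?thesis by (simp add: s_def cis_cnj)
    qed
    have "(\<Sum>j<N. i j * cnj (i j)) = of_nat (card S)"
      unfolding i_def using S
      by (simp add: if_distrib[of "\<lambda>x. x * _"] if_distrib[of cnj] sum.If_cases Int_absorb1 cong: if_cong)
    then have "complex_of_real (\<Sum>k<N. (cmod (s k))\<^sup>2) = complex_of_real (real N * real (card S))"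
      using dft_parseval[of N i i]
      by (simp only: sk complex_mod_cnj of_real_sum complex_norm_square of_real_mult of_real_of_nat_eq)
    then show ?thesis by (simp only: of_real_eq_iff)
  qed
  have "real N * cmod P = cmod (\<Sum>k<N. s k * (dft N u k * cnj (dft N u k)))"
    by (simp add: norm_mult flip: P)
  also have "\<dots> \<le> (\<Sum>k<N. (\<kappa> * real N) * (cmod (dft N u k) * cmod (s k)))"
  proof (rule sum_norm_le)
    fix k assume "k \<in> {..<N}"
    then have "cmod (dft N u k) * (cmod (dft N u k) * cmod (s k)) \<le> (\<kappa> * real N) * (cmod (dft N u k) * cmod (s k))"
      by (intro mult_right_mono small) auto
    then show "cmod (s k * (dft N u k * cnj (dft N u k))) \<le> (\<kappa> * real N) * (cmod (dft N u k) * cmod (s k))"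
      by (simp add: norm_mult mult_ac)
  qed
  also have "\<dots> = (\<kappa> * real N) * (\<Sum>k<N. cmod (dft N u k) * cmod (s k))" by (simp add: sum_distrib_left)
  also have "\<dots> \<le> (\<kappa> * real N) * (real N * sqrt E * sqrt (real (card S)))"
  proof (rule mult_left_mono[OF _ \<kappa>])
    have "(\<Sum>k<N. cmod (dft N u k) * cmod (s k))\<^sup>2 \<le> (real N * E) * (real N * real (card S))"
      using Cauchy_Schwarz_ineq_sum[of "\<lambda>k. cmod (dft N u k)" "\<lambda>k. cmod (s k)" "{..<N}"] sumU sums by simp
    then have "(\<Sum>k<N. cmod (dft N u k) * cmod (s k)) \<le> sqrt ((real N * E) * (real N * real (card S)))"
      by (rule real_le_rsqrt)
    also have "\<dots> = real N * sqrt E * sqrt (real (card S))"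
      by (simp add: real_sqrt_mult mult_ac)
    finally show "(\<Sum>k<N. cmod (dft N u k) * cmod (s k)) \<le> real N * sqrt E * sqrt (real (card S))" .
  qed
  finally have "real N * cmod P \<le> real N * (\<kappa> * real N * sqrt E * sqrt (real (card S)))" by (simp add: mult_ac)
  then have "cmod P \<le> \<kappa> * real N * sqrt E * sqrt (real (card S))" using N by simp
  with 1 show ?thesis by simp
qed simp

section \<open>Bohr's uniqueness theorem\<close>

text \<open>
  By the pigeonhole principle a fixed proportion of the indices below \<open>N\<close> share a
  point of a finite net, and differences of two such indices are almost periods. It is essential
  for the uniqueness theorem that \<open>\<rho>\<close> does not depend on the sampling distance
  \<open>\<delta>\<close>.
\<close>

lemma uap_many_almost_periods:
  assumes "uap g" "e > 0"
  shows "\<exists>\<rho>>0. \<forall>\<delta> N. real (card {m. m < N \<and> (\<forall>x. cmod (g (x + real m * \<delta>) - g x) \<le> e)}) \<ge> \<rho> * real N"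
proof -
  obtain A where A: "finite A" "\<And>a. \<exists>b\<in>A. \<forall>x. cmod (g (x + a) - g (x + b)) \<le> e / 2"
    using uap_precompact[OF assms(1)] half_gt_zero[OF assms(2)] unfolding precompact_translates_def by blast
  have "\<forall>a. \<exists>b. b \<in> A \<and> (\<forall>x. cmod (g (x + a) - g (x + b)) \<le> e / 2)" using A(2) by blast
  then obtain p where p: "\<And>a. p a \<in> A" "\<And>a x. cmod (g (x + a) - g (x + p a)) \<le> e / 2"
    unfolding choice_iff by blast
  have cA: "card A > 0" using A(1) p(1) by (auto simp: card_gt_0_iff)
  have "real (card {m. m < N \<and> (\<forall>x. cmod (g (x + real m * \<delta>) - g x) \<le> e)}) \<ge> (1 / card A) * real N" for \<delta> N
  proof -
    define S where "S = {m. m < N \<and> (\<forall>x. cmod (g (x + real m * \<delta>) - g x) \<le> e)}"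
    define C where "C = (\<lambda>b. {m. m < N \<and> p (real m * \<delta>) = b})"
    have le: "card (C b) \<le> card S" for b
    proof (cases "C b = {}")
      case False
      define m0 where "m0 = Min (C b)"
      have fin: "finite (C b)" by (simp add: C_def)
      have m0: "m0 \<in> C b" "\<And>m. m \<in> C b \<Longrightarrow> m0 \<le> m" unfolding m0_def using fin False by auto
      have "(\<lambda>m. m - m0) ` C b \<subseteq> S"
      proof clarify
        fix m assume m: "m \<in> C b"
        have "cmod (g (x + real (m - m0) * \<delta>) - g x) \<le> e" for x
        proof -
          have eq: "x + real (m - m0) * \<delta> = (x - real m0 * \<delta>) + real m * \<delta>"
            using m0(2)[OF m] by (simp add: of_nat_diff algebra_simps)
          have pb: "p (real m * \<delta>) = b" "p (real m0 * \<delta>) = b" using m m0(1) by (auto simp: C_def)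
          have "cmod (g ((x - real m0 * \<delta>) + real m * \<delta>) - g ((x - real m0 * \<delta>) + b)) \<le> e / 2"
               "cmod (g ((x - real m0 * \<delta>) + real m0 * \<delta>) - g ((x - real m0 * \<delta>) + b)) \<le> e / 2"
            using p(2)[of "x - real m0 * \<delta>" "real m * \<delta>"] p(2)[of "x - real m0 * \<delta>" "real m0 * \<delta>"] pb by auto
          then have "cmod (g ((x - real m0 * \<delta>) + real m * \<delta>) - g ((x - real m0 * \<delta>) + real m0 * \<delta>)) \<le> e / 2 + e / 2"
            by norm
          then show ?thesis unfolding eq by simp
        qed
        then show "m - m0 \<in> S" using m by (auto simp: S_def C_def intro: le_less_trans[OF diff_le_self])
      qed
      moreover have "inj_on (\<lambda>m. m - m0) (C b)"
        by (rule inj_onI) (metis m0(2) le_add_diff_inverse2)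
      ultimately show ?thesis
        using card_inj_on_le[of "\<lambda>m. m - m0" "C b" S] by (simp add: S_def)
    qed simp
    have "{..<N} = (\<Union>b\<in>A. C b)" using p(1) by (auto simp: C_def)
    then have "N = card (\<Union>b\<in>A. C b)" by (metis card_lessThan)
    also have "\<dots> \<le> (\<Sum>b\<in>A. card (C b))" by (rule card_UN_le[OF A(1)])
    also have "\<dots> \<le> card A * card S" using sum_bounded_above[of A "\<lambda>b. card (C b)" "card S"] le by simp
    finally have "real N \<le> real (card A) * real (card S)" by (metis of_nat_le_iff of_nat_mult)
    then show ?thesis using cA by (simp add: S_def field_simps)
  qed
  then show ?thesis using cA by (intro exI[of _ "1 / card A"]) simp
qed

text \<open>
  Vanishing of the means at each single frequency becomes uniform on compact frequency ranges: a
  bound for one frequency on blocks of one length persists for nearby frequencies, because over a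
  block the two exponentials differ little up to a constant factor.
\<close>

lemma uap_mean_zero_uniform_frequency:
  assumes g: "uap g" and zero: "\<And>y. mean (\<lambda>t. g t * cis (y * t)) = 0" and k: "k > 0"
  shows "\<exists>T0>0. \<forall>T\<ge>T0. \<forall>y. \<bar>y\<bar> \<le> Y \<longrightarrow> cmod (integral {0..T} (\<lambda>t. g t * cis (y * t))) \<le> k * T"
proof -
  obtain M where M: "M > 0" "\<And>x. cmod (g x) \<le> M" using uap_bounded[OF g] by blast
  have cont: "continuous_on X (\<lambda>t. g t * cis (y * t))" for X y
    using continuous_on_subset[OF uap_continuous[OF uap_mult_cis[OF g]]] by simp
  have local: "\<exists>d>0. \<exists>T0>0. \<forall>T\<ge>T0. \<forall>y. \<bar>y - z\<bar> < d \<longrightarrow> cmod (integral {0..T} (\<lambda>t. g t * cis (y * t))) \<le> k * T" for z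
  proof -
    have k4: "k / 4 > 0" using k by simp
    obtain S where S: "S > 0" "\<And>T b. T \<ge> S \<Longrightarrow> cmod (integral {b..b + T} (\<lambda>t. g t * cis (z * t))) \<le> k / 4 * T"
      using uap_mean_uniform[OF uap_mult_cis[OF g] k4, of z] zero[of z] by auto
    define d where "d = k / (4 * M * S)"
    have d: "d > 0" using k M S by (simp add: d_def)
    define T0 where "T0 = 2 * M * S / k"
    have T0: "T0 > 0" using k M S by (simp add: T0_def)
    have "cmod (integral {0..T} (\<lambda>t. g t * cis (y * t))) \<le> k * T" if T: "T \<ge> T0" and y: "\<bar>y - z\<bar> < d" for T y
    proof -
      have "cmod (integral {0..0 + T} (\<lambda>t. g t * cis (y * t))) \<le> (k / 2) * T + M * S"
      proof (rule integral_block_bound[OF cont _ S(1)])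
        show "cmod (g x * cis (y * x)) \<le> M" for x using M(2) by (simp add: norm_mult)
        show "T \<ge> 0" using T T0 by simp
        fix a
        define w where "w = cis ((y - z) * a)"
        have bd: "cmod (g t * cis (y * t) - w * (g t * cis (z * t))) \<le> M * (d * S)" if "t \<in> {a..a + S}" for t
        proof -
          have "cis (y * t) = w * cis (z * t) * cis ((y - z) * (t - a))"
            unfolding w_def cis_mult by (simp add: algebra_simps)
          then have "g t * cis (y * t) - w * (g t * cis (z * t)) = g t * (w * cis (z * t)) * (cis ((y - z) * (t - a)) - 1)"
            by (simp add: algebra_simps)
          then have "cmod (g t * cis (y * t) - w * (g t * cis (z * t))) = cmod (g t) * cmod (cis ((y - z) * (t - a)) - 1)"
            by (simp add: norm_mult w_def)
          also have "\<dots> \<le> M * (d * S)"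
          proof (intro mult_mono M(2))
            have "cmod (cis ((y - z) * (t - a)) - 1) \<le> \<bar>(y - z) * (t - a)\<bar>"
              using dist_exp_i_1 [of "(y - z) * (t - a)"] abs_sin_x_le_abs_x[of "(y - z) * (t - a) / 2"]
              by (simp add: cis_conv_exp)
            also have "\<dots> \<le> d * S" unfolding abs_mult using y that d by (intro mult_mono) auto
            finally show "cmod (cis ((y - z) * (t - a)) - 1) \<le> d * S" .
          qed (use M in auto)
          finally show ?thesis .
        qed
        have "cmod (integral {a..a + S} (\<lambda>t. g t * cis (y * t) - w * (g t * cis (z * t)))) \<le> M * (d * S) * (a + S - a)"
          using S(1) bd by (intro integral_bound continuous_intros cont) auto
        also have "integral {a..a + S} (\<lambda>t. g t * cis (y * t) - w * (g t * cis (z * t))) =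
            integral {a..a + S} (\<lambda>t. g t * cis (y * t)) - w * integral {a..a + S} (\<lambda>t. g t * cis (z * t))"
          by (subst Henstock_Kurzweil_Integration.integral_diff)
            (auto intro!: integrable_continuous_interval continuous_intros cont)
        also have "M * (d * S) * (a + S - a) = k / 4 * S" using M S by (simp add: d_def)
        finally have 1: "cmod (integral {a..a + S} (\<lambda>t. g t * cis (y * t)) - w * integral {a..a + S} (\<lambda>t. g t * cis (z * t))) \<le> k / 4 * S" .
        have 2: "cmod (w * integral {a..a + S} (\<lambda>t. g t * cis (z * t))) \<le> k / 4 * S"
          using S(2)[OF order_refl, of a] by (simp add: norm_mult w_def)
        show "cmod (integral {a..a + S} (\<lambda>t. g t * cis (y * t))) \<le> k / 2 * S"
          using norm_triangle_le[OF add_mono[OF 1 2]] by (simp add: field_simps)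
      qed
      moreover have "M * S \<le> k / 2 * T" using T k by (simp add: T0_def field_simps)
      ultimately show ?thesis by simp
    qed
    then show ?thesis using d T0 by blast
  qed
  then obtain d T where dT: "\<And>z. d z > 0" "\<And>z. T z > 0"
    "\<And>z t y. t \<ge> T z \<Longrightarrow> \<bar>y - z\<bar> < d z \<Longrightarrow> cmod (integral {0..t} (\<lambda>t. g t * cis (y * t))) \<le> k * t"
    by metis
  have "compact {-Y..Y}" by simp
  then obtain Z where Z: "Z \<subseteq> {-Y..Y}" "finite Z" "{-Y..Y} \<subseteq> (\<Union>z\<in>Z. ball z (d z))"
    by (rule compactE_image[of _ "{-Y..Y}" "\<lambda>z. ball z (d z)"]) (use dT(1) in auto)
  define T0 where "T0 = Max (insert 1 (T ` Z))"
  have T0: "T0 \<ge> 1" "\<And>z. z \<in> Z \<Longrightarrow> T z \<le> T0" unfolding T0_def using Z(2) by auto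
  have "cmod (integral {0..t} (\<lambda>t. g t * cis (y * t))) \<le> k * t" if t: "t \<ge> T0" and y: "\<bar>y\<bar> \<le> Y" for t y
  proof -
    have "y \<in> {-Y..Y}" using y by auto
    then obtain z where "z \<in> Z" "y \<in> ball z (d z)" using Z(3) by blast
    then show ?thesis using T0(2) t by (intro dT(3)[of z]) (force simp: dist_real_def)+
  qed
  then show ?thesis using T0(1) by (intro exI[of _ T0]) auto
qed

lemma cos_ge_quadratic: "cos x \<ge> 1 - x\<^sup>2 / 2" for x :: real
proof -
  have "(sin (x / 2))\<^sup>2 \<le> (x / 2)\<^sup>2"
    using abs_sin_x_le_abs_x[of "x / 2"] abs_le_square_iff by blast
  moreover have "cos x = 1 - 2 * (sin (x / 2))\<^sup>2" using cos_double_sin[of "x / 2"] by simp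
  ultimately show ?thesis by (simp add: power_divide)
qed

text \<open>
  After rotation by \<open>cis (- y * \<delta> / 2)\<close> the integrand has real part \<open>cos (y * (t - \<delta> / 2))\<close>, for which the quadratic lower bound of the cosine suffices as
  long as \<open>\<bar>y\<bar> * \<delta> \<le> pi\<close>.
\<close>

lemma cmod_integral_cis_lower:
  assumes "\<delta> > 0" "\<bar>y\<bar> * \<delta> \<le> pi"
  shows "\<delta> / 4 \<le> cmod (integral {0..\<delta>} (\<lambda>t. cis (y * t)))"
proof -
  define F where "F = (\<lambda>t. t + y\<^sup>2 * (\<delta> / 2 - t) ^ 3 / 6)"
  have "((\<lambda>t. 1 - (y * (t - \<delta> / 2))\<^sup>2 / 2) has_integral (F \<delta> - F 0)) {0..\<delta>}"
    using assms(1)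
    by (intro fundamental_theorem_of_calculus)
      (auto simp: F_def has_real_derivative_iff_has_vector_derivative[symmetric] power2_eq_square power3_eq_cube
        intro!: derivative_eq_intros, simp add: field_simps)
  moreover have "continuous_on {0..\<delta>} (\<lambda>t. cos (y * (t - \<delta> / 2)))" by (intro continuous_intros)
  then have "((\<lambda>t. cos (y * (t - \<delta> / 2))) has_integral integral {0..\<delta>} (\<lambda>t. cos (y * (t - \<delta> / 2)))) {0..\<delta>}"
    by (intro integrable_integral integrable_continuous_interval)
  ultimately have "F \<delta> - F 0 \<le> integral {0..\<delta>} (\<lambda>t. cos (y * (t - \<delta> / 2)))"
    by (rule has_integral_le) (rule cos_ge_quadratic)
  moreover have "F \<delta> - F 0 \<ge> \<delta> / 4"
  proof -
    have "F \<delta> - F 0 = \<delta> - (\<bar>y\<bar> * \<delta>)\<^sup>2 * \<delta> / 24"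
      by (simp add: F_def power2_eq_square power3_eq_cube field_simps)
    moreover have "(\<bar>y\<bar> * \<delta>)\<^sup>2 \<le> 4\<^sup>2"
      using assms pi_less_4 by (intro power_mono) auto
    then have "(\<bar>y\<bar> * \<delta>)\<^sup>2 * \<delta> \<le> 16 * \<delta>" using assms(1) by (intro mult_right_mono) auto
    ultimately show ?thesis using assms(1) by linarith
  qed
  moreover have "integral {0..\<delta>} (\<lambda>t. cos (y * (t - \<delta> / 2))) \<le> cmod (integral {0..\<delta>} (\<lambda>t. cis (y * t)))"
  proof -
    have int: "(\<lambda>t. cis (y * t)) integrable_on {0..\<delta>}" "(\<lambda>t. cis (- (y * \<delta> / 2)) * cis (y * t)) integrable_on {0..\<delta>}"
      by (intro integrable_continuous_interval continuous_intros)+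
    have "integral {0..\<delta>} (\<lambda>t. cos (y * (t - \<delta> / 2))) = integral {0..\<delta>} (\<lambda>t. Re (cis (- (y * \<delta> / 2)) * cis (y * t)))"
      by (simp only: cis_mult cis.sel) (simp add: algebra_simps)
    also have "\<dots> = Re (integral {0..\<delta>} (\<lambda>t. cis (- (y * \<delta> / 2)) * cis (y * t)))"
      using integral_linear[OF int(2) bounded_linear_Re] by (simp add: o_def)
    also have "\<dots> \<le> cmod (cis (- (y * \<delta> / 2)) * integral {0..\<delta>} (\<lambda>t. cis (y * t)))"
      by (simp only: Henstock_Kurzweil_Integration.integral_mult_right complex_Re_le_cmod)
    finally show ?thesis by (simp add: norm_mult)
  qed
  ultimately show ?thesis by linarith
qed

text \<open>
  On each cell of length \<open>\<delta>\<close> replace \<open>g\<close> by its value at the left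
  end. The integral then becomes the sampled sum times the integral of the exponential over one
  cell, which stays away from zero.
\<close>

lemma sampled_sum_le_integral:
  assumes g: "continuous_on UNIV g" and \<delta>: "\<delta> > 0" "\<bar>y\<bar> * \<delta> \<le> pi"
    and w: "\<And>s t. \<bar>s - t\<bar> \<le> \<delta> \<Longrightarrow> cmod (g s - g t) \<le> w"
    and I: "cmod (integral {0..real N * \<delta>} (\<lambda>t. g t * cis (y * t))) \<le> k * (real N * \<delta>)"
  shows "cmod (\<Sum>j<N. g (real j * \<delta>) * cis (y * (real j * \<delta>))) \<le> 4 * (k + w) * real N"
proof -
  define W where "W = integral {0..\<delta>} (\<lambda>t. cis (y * t))"
  have cont: "continuous_on X (\<lambda>t. g t * cis (y * t))" for X
    by (intro continuous_intros continuous_on_subset[OF g]) simp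
  have step: "cmod (integral {real j * \<delta>..real j * \<delta> + \<delta>} (\<lambda>t. g t * cis (y * t))
      - g (real j * \<delta>) * cis (y * (real j * \<delta>)) * W) \<le> w * \<delta>" for j
  proof -
    have "integral {real j * \<delta>..real j * \<delta> + \<delta>} (\<lambda>t. g (real j * \<delta>) * cis (y * t)) =
       g (real j * \<delta>) * integral {0..\<delta>} (\<lambda>t. cis (y * (t + real j * \<delta>)))"
      by (simp add: integral_shift_interval[of "real j * \<delta>"])
    also have "(\<lambda>t. cis (y * (t + real j * \<delta>))) = (\<lambda>t. cis (y * (real j * \<delta>)) * cis (y * t))"
      by (simp add: cis_mult algebra_simps)
    finally have eq: "g (real j * \<delta>) * cis (y * (real j * \<delta>)) * W =
       integral {real j * \<delta>..real j * \<delta> + \<delta>} (\<lambda>t. g (real j * \<delta>) * cis (y * t))"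
      by (auto simp: W_def)
    have "integral {real j * \<delta>..real j * \<delta> + \<delta>} (\<lambda>t. g t * cis (y * t)) - g (real j * \<delta>) * cis (y * (real j * \<delta>)) * W =
       integral {real j * \<delta>..real j * \<delta> + \<delta>} (\<lambda>t. g t * cis (y * t) - g (real j * \<delta>) * cis (y * t))"
      unfolding eq by (intro Henstock_Kurzweil_Integration.integral_diff[symmetric] integrable_continuous_interval continuous_intros cont)
    also have "cmod \<dots> \<le> w * (real j * \<delta> + \<delta> - real j * \<delta>)"
    proof (intro integral_bound)
      fix t assume t: "t \<in> {real j * \<delta>..real j * \<delta> + \<delta>}"
      have "cmod (g t * cis (y * t) - g (real j * \<delta>) * cis (y * t)) = cmod (g t - g (real j * \<delta>))"
        by (simp add: norm_mult flip: left_diff_distrib)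
      also have "\<dots> \<le> w" using t by (intro w) auto
      finally show "cmod (g t * cis (y * t) - g (real j * \<delta>) * cis (y * t)) \<le> w" .
    qed (use \<delta>(1) in \<open>auto intro!: continuous_intros cont\<close>)
    finally show ?thesis by simp
  qed
  have split: "integral {0..real n * \<delta>} (\<lambda>t. g t * cis (y * t)) =
      (\<Sum>j<n. integral {real j * \<delta>..real j * \<delta> + \<delta>} (\<lambda>t. g t * cis (y * t)))" for n
  proof (induction n)
    case (Suc n)
    have "integral {0..real (Suc n) * \<delta>} (\<lambda>t. g t * cis (y * t)) =
       integral {0..real n * \<delta>} (\<lambda>t. g t * cis (y * t)) + integral {real n * \<delta>..real n * \<delta> + \<delta>} (\<lambda>t. g t * cis (y * t))"
    proof -
      have eq: "real (Suc n) * \<delta> = real n * \<delta> + \<delta>" by (simp add: distrib_right)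
      show ?thesis unfolding eq using \<delta>(1)
        by (intro Henstock_Kurzweil_Integration.integral_combine[symmetric] integrable_continuous_interval cont) auto
    qed
    then show ?case using Suc by simp
  qed simp
  have "cmod (integral {0..real N * \<delta>} (\<lambda>t. g t * cis (y * t)) - (\<Sum>j<N. g (real j * \<delta>) * cis (y * (real j * \<delta>))) * W)
     \<le> (\<Sum>j<N. w * \<delta>)"
    unfolding split sum_distrib_right sum_subtractf[symmetric] by (rule sum_norm_le) (rule step)
  then have "cmod ((\<Sum>j<N. g (real j * \<delta>) * cis (y * (real j * \<delta>))) * W) \<le> k * (real N * \<delta>) + real N * (w * \<delta>)"
    using I norm_triangle_ineq2[of "(\<Sum>j<N. g (real j * \<delta>) * cis (y * (real j * \<delta>))) * W" "integral {0..real N * \<delta>} (\<lambda>t. g t * cis (y * t))"]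
    by (simp add: norm_minus_commute)
  moreover have "cmod (\<Sum>j<N. g (real j * \<delta>) * cis (y * (real j * \<delta>))) * (\<delta> / 4) \<le>
      cmod ((\<Sum>j<N. g (real j * \<delta>) * cis (y * (real j * \<delta>))) * W)"
    unfolding norm_mult W_def using cmod_integral_cis_lower[OF \<delta>] by (intro mult_left_mono) auto
  ultimately have "cmod (\<Sum>j<N. g (real j * \<delta>) * cis (y * (real j * \<delta>))) * (\<delta> / 4) \<le> (4 * (k + w) * real N) * (\<delta> / 4)"
    by (simp add: algebra_simps)
  then show ?thesis using \<delta>(1) by (simp only: mult_le_cancel_right_pos divide_pos_pos zero_less_numeral)
qed

text \<open>
  All frequencies of the discrete transform can be represented in the range \<open>\<bar>y\<bar> \<le> pi / \<delta>\<close>, which is fixed once \<open>\<delta>\<close> is; so the uniform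
  estimate on compact frequency ranges applies.
\<close>

lemma uap_sampled_dft_small:
  assumes g: "uap g" and zero: "\<And>y. mean (\<lambda>t. g t * cis (y * t)) = 0" and k: "k > 0"
  shows "\<exists>\<delta>>0. \<exists>N0. \<forall>N\<ge>N0. \<forall>l<N. cmod (dft N (\<lambda>j. g (real j * \<delta>)) l) \<le> k * real N"
proof -
  have k8: "k / 8 > 0" using k by simp
  obtain d where d: "d > 0" "\<And>x y. \<bar>x - y\<bar> < d \<Longrightarrow> cmod (g x - g y) < k / 8"
    using uap_modulus[OF g k8] by blast
  define \<delta> where "\<delta> = d / 2"
  have \<delta>: "\<delta> > 0" "\<And>s t. \<bar>s - t\<bar> \<le> \<delta> \<Longrightarrow> cmod (g s - g t) \<le> k / 8"
    using d by (auto simp: \<delta>_def intro!: less_imp_le d(2))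
  obtain T0 where T0: "T0 > 0"
    "\<And>T y. T \<ge> T0 \<Longrightarrow> \<bar>y\<bar> \<le> pi / \<delta> \<Longrightarrow> cmod (integral {0..T} (\<lambda>t. g t * cis (y * t))) \<le> k / 8 * T"
    using uap_mean_zero_uniform_frequency[OF g zero k8, of "pi / \<delta>"] by blast
  obtain N0 :: nat where N0: "T0 / \<delta> \<le> real N0" using real_arch_simple by blast
  have "cmod (dft N (\<lambda>j. g (real j * \<delta>)) l) \<le> k * real N" if N: "N \<ge> N0" and l: "l < N" for N l
  proof -
    have Npos: "N > 0" using l by simp
    \<comment> \<open>The representative of \<open>l\<close> modulo \<open>N\<close> of least modulus, so that \<open>\<bar>y\<bar> * \<delta> \<le> pi\<close> below.\<close>
    define L :: int where "L = (if 2 * l \<le> N then int l else int l - int N)"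
    have L: "\<bar>real_of_int L\<bar> * 2 \<le> real N" using l by (auto simp: L_def)
    define y where "y = - (2 * pi * real_of_int L / (real N * \<delta>))"
    have ph: "cis (- (2 * pi * real l * real j / real N)) = cis (y * (real j * \<delta>))" for j
    proof -
      have yj: "y * (real j * \<delta>) = - (2 * pi * real_of_int L * real j / real N)"
        using \<delta>(1) by (simp add: y_def field_simps)
      show ?thesis
      proof (cases "2 * l \<le> N")
        case False
        have "y * (real j * \<delta>) = - (2 * pi * real l * real j / real N) + 2 * pi * real j"
          unfolding yj using False Npos by (simp add: L_def field_simps)
        then show ?thesis by (simp only: cis_mult[symmetric] cis_multiple_2pi Ints_of_nat mult_1_right)
      qed (simp add: yj L_def)
    qed
    have yd: "\<bar>y\<bar> * \<delta> \<le> pi"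
    proof -
      have "\<bar>y\<bar> * \<delta> = pi * (\<bar>real_of_int L\<bar> * 2) / real N"
        using \<delta>(1) by (simp add: y_def abs_mult)
      also have "\<dots> \<le> pi * real N / real N" using L by (intro divide_right_mono mult_left_mono) auto
      finally show ?thesis using Npos by simp
    qed
    have "T0 \<le> real N * \<delta>" using N0 N \<delta>(1) by (simp add: divide_le_eq) (meson mult_right_mono of_nat_le_iff order_trans less_imp_le)
    moreover have "\<bar>y\<bar> \<le> pi / \<delta>" using yd \<delta>(1) by (simp add: field_simps)
    ultimately have "cmod (integral {0..real N * \<delta>} (\<lambda>t. g t * cis (y * t))) \<le> k / 8 * (real N * \<delta>)"
      by (intro T0(2))
    then have "cmod (\<Sum>j<N. g (real j * \<delta>) * cis (y * (real j * \<delta>))) \<le> 4 * (k / 8 + k / 8) * real N"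
      by (intro sampled_sum_le_integral uap_continuous[OF g] \<delta> yd)
    then show ?thesis by (simp add: dft_def ph)
  qed
  then show ?thesis using \<delta>(1) by blast
qed

text \<open>
  Sample \<open>g\<close> at the multiples of \<open>\<delta>\<close>, with period \<open>N * \<delta>\<close> an almost period. If \<open>g 0 \<noteq> 0\<close>, then the almost periods at
  level \<open>\<bar>g 0\<bar> / 2\<close> give a lower bound \<open>e0\<close> for the energy per
  sample, while those at level \<open>\<epsilon>\<close> have density at least
  \<open>\<rho>\<close>. Both \<open>e0\<close> and \<open>\<rho>\<close> are independent of
  \<open>\<delta>\<close> and \<open>N\<close>, so that \<open>\<delta>\<close> and then
  \<open>N\<close> can be chosen to make the discrete Fourier coefficients too small for
  \<open>dft_recurrence_bound\<close>.
\<close>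

lemma uap_vanish_at_0:
  assumes g: "uap g" and zero: "\<And>y. mean (\<lambda>t. g t * cis (y * t)) = 0"
  shows "g 0 = 0"
proof (rule ccontr)
  assume "g 0 \<noteq> 0"
  define c where "c = cmod (g 0)"
  have c: "c > 0" using \<open>g 0 \<noteq> 0\<close> by (simp add: c_def)
  obtain M where M: "M > 0" "\<And>x. cmod (g x) \<le> M" using uap_bounded[OF g] by blast
  obtain \<rho>1 where \<rho>1: "\<rho>1 > 0"
    "\<And>\<delta> N. real (card {m. m < N \<and> (\<forall>x. cmod (g (x + real m * \<delta>) - g x) \<le> c / 2)}) \<ge> \<rho>1 * real N"
    using uap_many_almost_periods[OF g half_gt_zero[OF c]] by blast
  define e0 where "e0 = \<rho>1 * (c / 2)\<^sup>2"
  have e0: "e0 > 0" using \<rho>1(1) c by (simp add: e0_def)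
  have energy: "(\<Sum>j<N. (cmod (g (real j * \<delta>)))\<^sup>2) \<ge> e0 * real N" for \<delta> N
  proof -
    define S where "S = {m. m < N \<and> (\<forall>x. cmod (g (x + real m * \<delta>) - g x) \<le> c / 2)}"
    have "e0 * real N \<le> real (card S) * (c / 2)\<^sup>2"
      using mult_right_mono[OF \<rho>1(2)[where N=N and \<delta>=\<delta>], of "(c / 2)\<^sup>2"] by (simp add: e0_def S_def mult_ac)
    also have "\<dots> = (\<Sum>j\<in>S. (c / 2)\<^sup>2)" by simp
    also have "\<dots> \<le> (\<Sum>j\<in>S. (cmod (g (real j * \<delta>)))\<^sup>2)"
    proof (intro sum_mono power_mono)
      fix j assume "j \<in> S"
      then have "\<forall>x. cmod (g (x + real j * \<delta>) - g x) \<le> c / 2" by (simp add: S_def)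
      then have "cmod (g (0 + real j * \<delta>) - g 0) \<le> c / 2" by blast
      then show "c / 2 \<le> cmod (g (real j * \<delta>))"
        using norm_triangle_ineq2[of "g 0" "g (real j * \<delta>)"] by (simp add: c_def norm_minus_commute)
    qed (use c in auto)
    also have "\<dots> \<le> (\<Sum>j<N. (cmod (g (real j * \<delta>)))\<^sup>2)"
      by (rule sum_mono2) (auto simp: S_def)
    finally show ?thesis .
  qed
  \<comment> \<open>With the doubled error \<open>2 * \<epsilon>\<close> from wrapping around, the loss \<open>2 * \<epsilon> * M\<close> is half of the energy \<open>e0\<close>.\<close>
  define \<epsilon> where "\<epsilon> = e0 / (4 * M)"
  have \<epsilon>: "\<epsilon> > 0" using e0 M(1) by (simp add: \<epsilon>_def)
  obtain \<rho> where \<rho>: "\<rho> > 0"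
    "\<And>\<delta> N. real (card {m. m < N \<and> (\<forall>x. cmod (g (x + real m * \<delta>) - g x) \<le> \<epsilon>)}) \<ge> \<rho> * real N"
    using uap_many_almost_periods[OF g \<epsilon>] by blast
  \<comment> \<open>Half the size of the coefficients that the recurrence inequality enforces.\<close>
  define k where "k = sqrt \<rho> * e0 / (4 * M)"
  have k: "k > 0" using \<rho>(1) e0 M(1) by (simp add: k_def)
  obtain \<delta> N0 where \<delta>: "\<delta> > 0"
    and small: "\<And>N l. N \<ge> N0 \<Longrightarrow> l < N \<Longrightarrow> cmod (dft N (\<lambda>j. g (real j * \<delta>)) l) \<le> k * real N"
    using uap_sampled_dft_small[OF g zero k] by blast
  \<comment> \<open>Almost periods among the multiples of \<open>\<delta>\<close> have positive density, so there are arbitrarily large ones.\<close>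
  obtain N where N: "N > N0" "\<And>x. cmod (g (x + real N * \<delta>) - g x) \<le> \<epsilon>"
  proof -
    obtain N' :: nat where N': "real (N0 + 2) / \<rho> \<le> real N'" using real_arch_simple by blast
    define S where "S = {m. m < N' \<and> (\<forall>x. cmod (g (x + real m * \<delta>) - g x) \<le> \<epsilon>)}"
    have "real (N0 + 2) \<le> \<rho> * real N'" using N' \<rho>(1) by (simp add: field_simps)
    then have "N0 + 2 \<le> card S" using \<rho>(2)[of N' \<delta>] unfolding S_def by linarith
    moreover have "card S \<le> N0 + 1" if "S \<subseteq> {..<N0 + 1}" using card_mono[OF _ that] by simp
    ultimately have "\<not> S \<subseteq> {..<N0 + 1}" by linarith
    then obtain m where "m \<in> S" "\<not> m < N0 + 1" by auto
    then show thesis by (intro that[of m]) (auto simp: S_def)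
  qed
  have Npos: "N > 0" using N(1) by simp
  define S where "S = {m. m < N \<and> (\<forall>x. cmod (g (x + real m * \<delta>) - g x) \<le> \<epsilon>)}"
  define E where "E = (\<Sum>j<N. (cmod (g (real j * \<delta>)))\<^sup>2)"
  have rec: "cmod (g (real ((j + m) mod N) * \<delta>) - g (real j * \<delta>)) \<le> 2 * \<epsilon>" if m: "m \<in> S" and j: "j < N" for m j
  proof -
    have a: "cmod (g (real j * \<delta> + real m * \<delta>) - g (real j * \<delta>)) \<le> \<epsilon>" using m by (simp add: S_def)
    show ?thesis
    proof (cases "j + m < N")
      case True
      then show ?thesis using a \<epsilon> by (simp add: distrib_right)
    next
      case False
      then have "(j + m) mod N = j + m - N" using m j by (auto simp: S_def le_mod_geq intro!: mod_less)
      moreover have "real (j + m - N) * \<delta> + real N * \<delta> = real j * \<delta> + real m * \<delta>"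
        using False by (simp add: of_nat_diff algebra_simps)
      ultimately have "cmod (g (real j * \<delta> + real m * \<delta>) - g (real ((j + m) mod N) * \<delta>)) \<le> \<epsilon>"
        using N(2)[of "real (j + m - N) * \<delta>"] by simp
      with a show ?thesis by norm
    qed
  qed
  have main: "real (card S) * (E - 2 * \<epsilon> * M * real N) \<le> k * real N * sqrt E * sqrt (real (card S))"
    by (rule dft_recurrence_bound[OF Npos _ small rec _ E_def]) (use N(1) M(2) in \<open>auto simp: S_def\<close>)
  have cS: "real (card S) \<ge> \<rho> * real N" using \<rho>(2)[of N \<delta>] by (simp add: S_def)
  then have cS0: "real (card S) > 0" using \<rho>(1) Npos by (smt (verit) mult_pos_pos of_nat_0_less_iff)
  have "E \<le> (\<Sum>j<N. M\<^sup>2)" unfolding E_def by (intro sum_mono power_mono M(2)) auto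
  then have "sqrt E \<le> sqrt (real N * M\<^sup>2)" by simp
  then have sE: "sqrt E \<le> M * sqrt (real N)" using M(1) by (simp add: real_sqrt_mult mult.commute)
  define r where "r = sqrt (real (card S))"
  have r: "r > 0" "r * r = real (card S)" using cS0 by (auto simp: r_def)
  have "e0 * real N / 2 \<le> E - 2 * \<epsilon> * M * real N"
    using energy[of N \<delta>] M(1) by (simp add: E_def \<epsilon>_def field_simps)
  then have "r * r * (e0 * real N / 2) \<le> r * r * (E - 2 * \<epsilon> * M * real N)"
    using r(1) by (intro mult_left_mono) auto
  also have "\<dots> \<le> k * real N * sqrt E * r" using main unfolding r(2) by (simp only: r_def)
  also have "\<dots> \<le> k * real N * (M * sqrt (real N)) * r"
    using k r sE by (intro mult_right_mono mult_left_mono) auto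
  finally have "(r * real N) * (r * (e0 / 2)) \<le> (r * real N) * (k * (M * sqrt (real N)))" by (simp add: mult_ac)
  then have 1: "r * (e0 / 2) \<le> k * M * sqrt (real N)" using r Npos by (simp only: mult_le_cancel_left) (simp add: mult_ac)
  have "sqrt (\<rho> * real N) \<le> r" unfolding r_def using cS by simp
  then have "sqrt \<rho> * sqrt (real N) * (e0 / 2) \<le> r * (e0 / 2)"
    using e0 by (intro mult_right_mono) (auto simp: real_sqrt_mult)
  moreover have "k * M * sqrt (real N) = sqrt \<rho> * sqrt (real N) * (e0 / 4)"
    using M(1) by (simp add: k_def)
  ultimately have "sqrt \<rho> * sqrt (real N) * (e0 / 2) \<le> sqrt \<rho> * sqrt (real N) * (e0 / 4)"
    using 1 by linarith
  moreover have "sqrt \<rho> * sqrt (real N) > 0" using \<rho>(1) Npos by simp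
  ultimately have "e0 / 2 \<le> e0 / 4" by (simp only: mult_le_cancel_left_pos)
  then show False using e0 by simp
qed

text \<open>
  The translate of \<open>g\<close> by \<open>x\<close> has the same mean coefficients up to
  unimodular factors, and its value at \<open>0\<close> is \<open>g x\<close>.
\<close>

theorem uap_uniqueness:
  assumes g: "uap g" and zero: "\<And>y. mean (\<lambda>t. g t * cis (y * t)) = 0"
  shows "g x = 0"
proof -
  have "mean (\<lambda>t. g (t + x) * cis (y * t)) = 0" for y
  proof -
    have "g (t + x) * cis (y * t) = cis (- (y * x)) * (g (t + x) * cis (y * (t + x)))" for t
    proof -
      have "cis (y * t) = cis (- (y * x)) * cis (y * (t + x))" by (simp add: cis_mult algebra_simps)
      then show ?thesis by (simp only: mult.left_commute)
    qed
    then have "mean (\<lambda>t. g (t + x) * cis (y * t)) = cis (- (y * x)) * mean (\<lambda>t. g (t + x) * cis (y * (t + x)))"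
      by (simp only: mean_cmult[OF uap_translate[OF uap_mult_cis[OF g]]])
    also have "mean (\<lambda>t. g (t + x) * cis (y * (t + x))) = 0"
      using mean_translate[OF uap_mult_cis[OF g]] zero by simp
    finally show ?thesis by simp
  qed
  from uap_vanish_at_0[OF uap_translate[OF g] this] show ?thesis by simp
qed

section \<open>Means of parameter integrals\<close>

text \<open>
  Fubini's theorem for intervals \<open>{- n..n}\<close>, followed by dominated convergence for
  \<open>n \<rightarrow> \<infinity>\<close>. It is applied both to convolutions on the line and
  to convolutions on the group.
\<close>

lemma mean_integral_swap:
  fixes K :: "real \<Rightarrow> 'z \<Rightarrow> complex"
  assumes "sigma_finite_measure M"
    and meas[measurable]: "(\<lambda>(z, t). K t z) \<in> borel_measurable (M \<Otimes>\<^sub>M lborel)"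
    and w: "integrable M w" "\<And>t z. cmod (K t z) \<le> w z"
    and ap: "\<And>z. uap (\<lambda>t. K t z)" "uap (\<lambda>t. LINT z|M. K t z)"
  shows "mean (\<lambda>t. LINT z|M. K t z) = (LINT z|M. mean (\<lambda>t. K t z))"
proof -
  interpret M: sigma_finite_measure M by fact
  interpret P: pair_sigma_finite M lborel ..
  define \<Phi> where "\<Phi> = (\<lambda>t. LINT z|M. K t z)"
  define A where "A = (\<lambda>n z. (1 / (2 * complex_of_real (real n))) * integral {-real n..real n} (\<lambda>t. K t z))"
  have [measurable]: "w \<in> borel_measurable M" using w(1) by simp
  have wpos: "w z \<ge> 0" for z using w(2)[of undefined z] norm_ge_zero order_trans by blast
  have sect[measurable]: "(\<lambda>z. K t z) \<in> borel_measurable M" for t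
  proof -
    have "(\<lambda>z. (z, t)) \<in> M \<rightarrow>\<^sub>M M \<Otimes>\<^sub>M lborel" by simp
    from measurable_compose[OF this meas] show ?thesis by simp
  qed
  have slab: "integral {-T..T} g = (LINT t|lborel. indicator {-T..T} t *\<^sub>R g t)" if "uap g" for g T
    using set_borel_integral_eq_integral(2)[OF borel_integrable_atLeastAtMost'[OF continuous_on_subset[OF uap_continuous[OF that]]], of "-T" T]
    by (simp add: set_lebesgue_integral_def)
  have K_slab: "integral {-T..T} (\<lambda>t. K t z) = (LINT t|lborel. indicator {-T..T} t *\<^sub>R K t z)" for z T
    by (rule slab[OF ap(1)])
  have swap: "integral {-T..T} \<Phi> = (LINT z|M. integral {-T..T} (\<lambda>t. K t z))" if T: "T \<ge> 0" for T
  proof -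
    let ?f = "\<lambda>z t. indicator {-T..T} t *\<^sub>R K t z"
    have "integrable (M \<Otimes>\<^sub>M lborel) (case_prod ?f)"
    proof (rule P.Fubini_integrable)
      show "case_prod ?f \<in> borel_measurable (M \<Otimes>\<^sub>M lborel)"
      proof -
        have "(\<lambda>p. indicator {-T..T} (snd p) *\<^sub>R (case p of (z, t) \<Rightarrow> K t z)) \<in> borel_measurable (M \<Otimes>\<^sub>M lborel)"
          by measurable
        then show ?thesis by (simp add: case_prod_unfold)
      qed
      have sect2: "(\<lambda>t. K t z) \<in> borel_measurable borel" for z
        by (intro borel_measurable_continuous_onI uap_continuous ap)
      show inner: "AE z in M. integrable lborel (\<lambda>t. case_prod ?f (z, t))"
        using borel_integrable_atLeastAtMost'[OF continuous_on_subset[OF uap_continuous[OF ap(1)]]]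
        by (simp add: set_integrable_def)
      show "integrable M (\<lambda>z. LINT t|lborel. norm (case_prod ?f (z, t)))"
      proof (rule Bochner_Integration.integrable_bound)
        show "integrable M (\<lambda>z. w z * (2 * T))" using w(1) by simp
        have "(\<lambda>p. norm (indicator {-T..T} (snd p) *\<^sub>R (case p of (z, t) \<Rightarrow> K t z))) \<in> borel_measurable (M \<Otimes>\<^sub>M lborel)"
          by measurable
        then have "(\<lambda>(z, t). norm (?f z t)) \<in> borel_measurable (M \<Otimes>\<^sub>M lborel)" by (simp add: case_prod_unfold)
        then show "(\<lambda>z. LINT t|lborel. norm (case_prod ?f (z, t))) \<in> borel_measurable M"
          using lborel.borel_measurable_lebesgue_integral[of "\<lambda>z t. norm (?f z t)" M] by simp
        have "(LINT t|lborel. norm (?f z t)) \<le> (LINT t|lborel. indicator {-T..T} t * w z)" for z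
        proof (rule integral_mono)
          show "integrable lborel (\<lambda>t. norm (?f z t))"
            using borel_integrable_atLeastAtMost'[OF continuous_on_subset[OF uap_continuous[OF ap(1)]], of "-T" T z]
            by (intro integrable_norm) (simp add: set_integrable_def)
          show "integrable lborel (\<lambda>t. indicator {-T..T} t * w z)"
            by (intro integrable_mult_left integrable_real_indicator) (auto simp: emeasure_lborel_Icc_eq)
        qed (use w(2) in \<open>auto simp: indicator_def\<close>)
        also have "(LINT t|lborel. indicator {-T..T} t * w z) = w z * (2 * T)" for z
          using T by simp
        finally have "(LINT t|lborel. norm (?f z t)) \<le> w z * (2 * T)" for z .
        moreover have "(LINT t|lborel. norm (?f z t)) \<ge> 0" for z by simp
        ultimately show "AE z in M. norm (LINT t|lborel. norm (case_prod ?f (z, t))) \<le> norm (w z * (2 * T))"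
          using wpos T by (auto simp: abs_of_nonneg)
      qed
    qed
    from P.Fubini_integral[OF this]
    have "(LINT t|lborel. LINT z|M. ?f z t) = (LINT z|M. LINT t|lborel. ?f z t)" .
    moreover have "(LINT z|M. ?f z t) = indicator {-T..T} t *\<^sub>R \<Phi> t" for t
      by (simp add: \<Phi>_def)
    ultimately show ?thesis
      by (simp add: slab[OF ap(2), folded \<Phi>_def] K_slab)
  qed
  have meanlim: "(\<lambda>n. (1 / (2 * complex_of_real (real n))) * integral {-real n..real n} g) \<longlonglongrightarrow> mean g" if "uap g" for g
    using filterlim_compose[OF uap_has_mean_mean[OF that, unfolded has_mean_def] filterlim_real_sequentially] .
  have A_meas: "A n \<in> borel_measurable M" for n
  proof -
    have "(\<lambda>p. indicator {-real n..real n} (snd p) *\<^sub>R (case p of (z, t) \<Rightarrow> K t z)) \<in> borel_measurable (M \<Otimes>\<^sub>M lborel)"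
      by measurable
    then have "(\<lambda>z. LINT t|lborel. indicator {-real n..real n} t *\<^sub>R K t z) \<in> borel_measurable M"
      by (intro lborel.borel_measurable_lebesgue_integral) (simp add: case_prod_unfold)
    then show ?thesis unfolding A_def K_slab by measurable
  qed
  have A_lim: "(\<lambda>n. A n z) \<longlonglongrightarrow> mean (\<lambda>t. K t z)" for z
    unfolding A_def by (rule meanlim[OF ap(1)])
  have A_bd: "cmod (A n z) \<le> w z" for n z
  proof (cases "n = 0")
    case False
    have "cmod (integral {-real n..real n} (\<lambda>t. K t z)) \<le> w z * (real n - (-real n))"
      by (intro integral_bound w(2) continuous_on_subset[OF uap_continuous[OF ap(1)]]) auto
    then show ?thesis using False by (simp add: A_def norm_mult norm_divide field_simps)
  qed (simp add: A_def wpos)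
  have "(\<lambda>n. LINT z|M. A n z) \<longlonglongrightarrow> (LINT z|M. mean (\<lambda>t. K t z))"
  proof (rule integral_dominated_convergence[where w = w])
    show "(\<lambda>z. mean (\<lambda>t. K t z)) \<in> borel_measurable M"
      by (rule borel_measurable_LIMSEQ_metric[OF A_meas A_lim])
  qed (use A_meas A_lim A_bd w(1) in auto)
  moreover have "(LINT z|M. A n z) = (1 / (2 * complex_of_real (real n))) * integral {-real n..real n} \<Phi>" for n
    unfolding A_def by (simp add: swap)
  moreover have "(\<lambda>n. (1 / (2 * complex_of_real (real n))) * integral {-real n..real n} \<Phi>) \<longlonglongrightarrow> mean \<Phi>"
    by (rule meanlim) (use ap(2) in \<open>simp add: \<Phi>_def\<close>)
  ultimately show ?thesis using LIMSEQ_unique by (simp add: \<Phi>_def)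
qed

section \<open>The Fejer kernel of the real line\<close>

definition fejer_profile :: "real \<Rightarrow> real" where
  "fejer_profile s = (1 - cos s) / s\<^sup>2"

definition fejer_mass :: real where
  "fejer_mass = (LINT s|lborel. fejer_profile s)"

text \<open>
  The Fejer kernel of the real line, normalised by the integral of its profile. Its value at the
  origin is \<open>0\<close>, by the convention on division by zero, but the origin is a null set.
\<close>

definition fejer_kernel :: "real \<Rightarrow> real \<Rightarrow> real" where
  "fejer_kernel x s = (1 - cos (x * s)) / (fejer_mass * x * s\<^sup>2)"

lemma one_minus_cos_le: "1 - cos s \<le> s\<^sup>2 / 2" for s :: real
  using cos_ge_quadratic[of s] by simp

lemma fejer_profile_nonneg: "fejer_profile s \<ge> 0"
  by (simp add: fejer_profile_def)

lemma fejer_profile_measurable[measurable]: "fejer_profile \<in> borel_measurable borel"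
  unfolding fejer_profile_def[abs_def] by measurable

lemma fejer_profile_bound: "fejer_profile s \<le> 4 * inverse (1 + s\<^sup>2)"
proof (cases "s = 0")
  case False
  then have s: "s\<^sup>2 > 0" by simp
  have "(1 - cos s) * (1 + s\<^sup>2) \<le> 4 * s\<^sup>2"
  proof -
    have "1 - cos s \<le> s\<^sup>2 / 2" by (rule one_minus_cos_le)
    moreover have "(1 - cos s) * s\<^sup>2 \<le> 2 * s\<^sup>2"
      using cos_ge_minus_one[of s] by (intro mult_right_mono) auto
    ultimately show ?thesis using s by (simp only: distrib_left mult_1_right)
  qed
  then have "(1 - cos s) \<le> 4 * s\<^sup>2 / (1 + s\<^sup>2)" using s by (simp add: pos_le_divide_eq add_pos_pos)
  then show ?thesis using s by (simp add: fejer_profile_def pos_divide_le_eq inverse_eq_divide mult_ac)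
qed (simp add: fejer_profile_def)

lemma integrable_inverse_1_plus_square': "integrable lborel (\<lambda>s::real. inverse (1 + s\<^sup>2))"
  using integrable_inverse_1_plus_square by (simp add: set_integrable_def einterval_eq)

lemma fejer_profile_integrable: "integrable lborel fejer_profile"
  by (rule Bochner_Integration.integrable_bound[where f = "\<lambda>s. 4 * inverse (1 + s\<^sup>2)"])
    (use integrable_inverse_1_plus_square' fejer_profile_bound fejer_profile_nonneg in
      \<open>auto simp: abs_of_nonneg\<close>)

lemma one_minus_cos_eq_profile: "(1 - cos (a * s)) / s\<^sup>2 = a\<^sup>2 * fejer_profile (a * s)" for a s :: real
  by (simp add: fejer_profile_def power_mult_distrib)

lemma one_minus_cos_integrable: "integrable lborel (\<lambda>s. (1 - cos (a * s)) / s\<^sup>2)" for a :: real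
proof (cases "a = 0")
  case False
  then have "integrable lborel (\<lambda>s. fejer_profile (0 + a * s))"
    using lborel_integrable_real_affine_iff[of a fejer_profile 0] fejer_profile_integrable by simp
  then show ?thesis unfolding one_minus_cos_eq_profile by simp
qed simp

text \<open>
  Homogeneity: substituting \<open>a * s\<close> for \<open>s\<close> turns a factor
  \<open>a\<^sup>2\<close> into \<open>\<bar>a\<bar>\<close>.
\<close>

lemma one_minus_cos_integral: "(LINT s|lborel. (1 - cos (a * s)) / s\<^sup>2) = fejer_mass * \<bar>a\<bar>" for a :: real
proof (cases "a = 0")
  case False
  have "fejer_mass = \<bar>a\<bar> * (LINT s|lborel. fejer_profile (a * s))"
    using lborel_integral_real_affine[OF False, of fejer_profile 0] by (simp add: fejer_mass_def)
  moreover have "(LINT s|lborel. a\<^sup>2 * fejer_profile (a * s)) = \<bar>a\<bar> * (\<bar>a\<bar> * (LINT s|lborel. fejer_profile (a * s)))"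
    by (simp add: power2_eq_square flip: mult.assoc)
  ultimately show ?thesis unfolding one_minus_cos_eq_profile by simp
qed simp

lemma fejer_mass_pos: "fejer_mass > 0"
proof -
  have pos: "1 - cos (1::real) > 0" using cos_monotone_0_pi[of 0 1] pi_gt3 by simp
  have "(1 - cos 1) / 4 = (LINT s|lborel. indicator {1..2::real} s * ((1 - cos (1::real)) / 4))" by simp
  also have "\<dots> \<le> fejer_mass"
    unfolding fejer_mass_def
  proof (rule integral_mono[OF _ fejer_profile_integrable])
    show "integrable lborel (\<lambda>s. indicator {1..2::real} s * ((1 - cos (1::real)) / 4))"
      by (intro integrable_mult_left integrable_real_indicator) (auto simp: emeasure_lborel_Icc_eq)
    fix s :: real
    show "indicator {1..2} s * ((1 - cos 1) / 4) \<le> fejer_profile s"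
    proof (cases "s \<in> {1..2}")
      case True
      then have "cos s \<le> cos 1" using cos_monotone_0_pi_le[of 1 s] pi_gt3 by simp
      moreover have "s\<^sup>2 \<le> 2\<^sup>2" using True by (intro power_mono) auto
      ultimately have "(1 - cos 1) / 4 \<le> (1 - cos s) / s\<^sup>2"
        using True by (intro frac_le) auto
      then show ?thesis using True by (simp add: fejer_profile_def)
    qed (simp add: fejer_profile_nonneg)
  qed
  finally show ?thesis using pos by simp
qed

lemma fejer_kernel_nonneg: "x > 0 \<Longrightarrow> fejer_kernel x s \<ge> 0"
  using fejer_mass_pos by (simp add: fejer_kernel_def)

lemma fejer_kernel_measurable[measurable]: "fejer_kernel x \<in> borel_measurable borel"
  unfolding fejer_kernel_def[abs_def] by measurable

lemma fejer_kernel_eq: "fejer_kernel x s = (1 / (fejer_mass * x)) * ((1 - cos (x * s)) / s\<^sup>2)"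
  by (simp add: fejer_kernel_def)

lemma fejer_kernel_integrable: "integrable lborel (fejer_kernel x)"
  unfolding fejer_kernel_eq[abs_def] by (intro integrable_mult_right one_minus_cos_integrable)

lemma fejer_kernel_integral: "x > 0 \<Longrightarrow> (LINT s|lborel. fejer_kernel x s) = 1"
  unfolding fejer_kernel_eq integral_mult_right_zero one_minus_cos_integral using fejer_mass_pos by simp

text \<open>
  The addition theorem writes \<open>(1 - cos (x * s)) * cos (y * s)\<close> as a combination of
  functions \<open>1 - cos (a * s)\<close> with \<open>a = x + y\<close>, \<open>x - y\<close>,
  \<open>y\<close>, whose integrals are known. The resulting \<open>(\<bar>x + y\<bar> + \<bar>x - y\<bar>) / 2 - \<bar>y\<bar>\<close> is the hat function.
\<close>

lemma fejer_kernel_cos_transform: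
  assumes "x > 0"
  shows "(LINT s|lborel. fejer_kernel x s * cos (y * s)) = max 0 (1 - \<bar>y\<bar> / x)"
proof -
  have "fejer_kernel x s * cos (y * s) = (1 / (fejer_mass * x)) *
      ((1 / 2) * ((1 - cos ((x + y) * s)) / s\<^sup>2) + (1 / 2) * ((1 - cos ((x - y) * s)) / s\<^sup>2)
        - (1 - cos (y * s)) / s\<^sup>2)" for s
  proof -
    have "cos ((x + y) * s) + cos ((x - y) * s) = 2 * (cos (x * s) * cos (y * s))"
      by (simp add: distrib_right left_diff_distrib cos_add cos_diff)
    then have "(1 - cos (x * s)) * cos (y * s) =
        (1 / 2) * (1 - cos ((x + y) * s)) + (1 / 2) * (1 - cos ((x - y) * s)) - (1 - cos (y * s))"
      by (simp add: field_simps)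
    moreover have "(1 / 2) * (P / d) + (1 / 2) * (Q / d) - R / d = ((1 / 2) * P + (1 / 2) * Q - R) / d"
      for P Q R d :: real by (simp add: add_divide_distrib diff_divide_distrib)
    ultimately show ?thesis unfolding fejer_kernel_eq by simp
  qed
  then have "(LINT s|lborel. fejer_kernel x s * cos (y * s)) = (1 / (fejer_mass * x)) *
      ((1 / 2) * (fejer_mass * \<bar>x + y\<bar>) + (1 / 2) * (fejer_mass * \<bar>x - y\<bar>) - fejer_mass * \<bar>y\<bar>)"
    by (simp only: integral_mult_right_zero Bochner_Integration.integral_diff
        Bochner_Integration.integral_add Bochner_Integration.integrable_add
        integrable_mult_right one_minus_cos_integrable one_minus_cos_integral)
  also have "\<dots> = ((1 / 2) * \<bar>x + y\<bar> + (1 / 2) * \<bar>x - y\<bar> - \<bar>y\<bar>) / x"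
    using fejer_mass_pos assms by (simp add: field_simps)
  also have "(1 / 2) * \<bar>x + y\<bar> + (1 / 2) * \<bar>x - y\<bar> - \<bar>y\<bar> = max 0 (x - \<bar>y\<bar>)"
  proof -
    have "\<bar>x + y\<bar> + \<bar>x - y\<bar> - 2 * \<bar>y\<bar> = 2 * max 0 (x - \<bar>y\<bar>)"
      using assms by (auto simp: abs_if max_def)
    then show ?thesis by linarith
  qed
  also have "max 0 (x - \<bar>y\<bar>) / x = max 0 (1 - \<bar>y\<bar> / x)"
    using assms by (auto simp: max_def field_simps)
  finally show ?thesis .
qed

lemma fejer_kernel_transform:
  assumes "x > 0"
  shows "(LINT s|lborel. complex_of_real (fejer_kernel x s) * cis (y * s)) = of_real (max 0 (1 - \<bar>y\<bar> / x))"
proof -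
  have int: "integrable lborel (\<lambda>s. complex_of_real (fejer_kernel x s) * cis (y * s))"
  proof (rule Bochner_Integration.integrable_bound[OF fejer_kernel_integrable[of x]])
    have [measurable]: "(\<lambda>s. cis (y * s)) \<in> borel_measurable borel"
      by (intro borel_measurable_continuous_onI continuous_intros)
    show "(\<lambda>s. complex_of_real (fejer_kernel x s) * cis (y * s)) \<in> borel_measurable lborel" by measurable
  qed (simp add: norm_mult)
  define I where "I = (LINT s|lborel. complex_of_real (fejer_kernel x s) * cis (y * s))"
  have "Re I = (LINT s|lborel. fejer_kernel x s * cos (y * s))"
    unfolding I_def by (subst integral_Re[OF int, symmetric]) simp
  moreover have "Im I = 0"
  proof -
    have Im: "Im I = (LINT s|lborel. fejer_kernel x s * sin (y * s))"
      unfolding I_def by (subst integral_Im[OF int, symmetric]) simp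
    also have "\<dots> = (LINT s|lborel. - (fejer_kernel x s * sin (y * s)))"
      using lborel_integral_real_affine[of "-1" "\<lambda>s. fejer_kernel x s * sin (y * s)" 0]
      by (simp add: fejer_kernel_def)
    also have "\<dots> = - Im I" unfolding Im by simp
    finally show ?thesis by simp
  qed
  ultimately show ?thesis
    unfolding I_def[symmetric] by (simp add: complex_eq_iff fejer_kernel_cos_transform[OF assms])
qed

lemma fejer_kernel_tail:
  assumes "x > 0" "r > 0"
  shows "(LINT s|lborel. indicator {s. \<bar>s\<bar> \<ge> r} s * fejer_kernel x s) \<le>
     (2 / fejer_mass) * (1 + 1 / r\<^sup>2) * (LINT s|lborel. inverse (1 + s\<^sup>2)) / x"
proof -
  let ?c = "(2 / fejer_mass) * (1 + 1 / r\<^sup>2) / x"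
  have "(LINT s|lborel. indicator {s. \<bar>s\<bar> \<ge> r} s * fejer_kernel x s) \<le> (LINT s|lborel. ?c * inverse (1 + s\<^sup>2))"
  proof (rule integral_mono)
    show "integrable lborel (\<lambda>s. indicator {s. \<bar>s\<bar> \<ge> r} s * fejer_kernel x s)"
      using integrable_real_mult_indicator[OF _ fejer_kernel_integrable, of "{s. \<bar>s\<bar> \<ge> r}" x]
      by (simp add: mult.commute)
    show "integrable lborel (\<lambda>s. ?c * inverse (1 + s\<^sup>2))"
      by (intro integrable_mult_right integrable_inverse_1_plus_square')
    fix s :: real
    show "indicator {s. \<bar>s\<bar> \<ge> r} s * fejer_kernel x s \<le> ?c * inverse (1 + s\<^sup>2)"
    proof (cases "\<bar>s\<bar> \<ge> r")
      case True
      then have s: "s\<^sup>2 \<ge> r\<^sup>2" "s\<^sup>2 > 0" using assms(2) abs_le_square_iff[of r s] by auto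
      have r: "r\<^sup>2 > 0" using assms(2) by simp
      have key: "1 / s\<^sup>2 \<le> (1 + 1 / r\<^sup>2) * inverse (1 + s\<^sup>2)"
        using s r by (simp add: divide_simps add_pos_pos) (simp add: algebra_simps)
      have "fejer_kernel x s \<le> 2 / (fejer_mass * x * s\<^sup>2)"
        unfolding fejer_kernel_def using assms(1) fejer_mass_pos cos_ge_minus_one[of "x * s"]
        by (intro divide_right_mono) auto
      also have "\<dots> = (2 / (fejer_mass * x)) * (1 / s\<^sup>2)" by simp
      also have "\<dots> \<le> (2 / (fejer_mass * x)) * ((1 + 1 / r\<^sup>2) * inverse (1 + s\<^sup>2))"
        using assms(1) fejer_mass_pos by (intro mult_left_mono key) simp
      also have "\<dots> = ?c * inverse (1 + s\<^sup>2)"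
        by (simp only: times_divide_eq_left times_divide_eq_right divide_divide_eq_left mult_ac)
      finally show ?thesis using True by simp
    qed (use assms fejer_mass_pos in \<open>auto intro!: divide_nonneg_nonneg mult_nonneg_nonneg add_nonneg_nonneg\<close>)
  qed
  then show ?thesis by simp
qed

text \<open>
  The constant in the bound \<open>fejer_tail r / x\<close> for the mass of the kernel outside
  \<open>{- r..r}\<close>.
\<close>

definition fejer_tail :: "real \<Rightarrow> real" where
  "fejer_tail r = (2 / fejer_mass) * (1 + 1 / r\<^sup>2) * (LINT s|lborel. inverse (1 + s\<^sup>2))"

definition fejer_conv :: "(real \<Rightarrow> complex) \<Rightarrow> real \<Rightarrow> real \<Rightarrow> complex" where
  "fejer_conv g x t = (LINT s|lborel. g (t - s) * complex_of_real (fejer_kernel x s))"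

lemma fejer_conv_integrable:
  assumes "continuous_on UNIV g" "\<And>t. cmod (g t) \<le> M"
  shows "integrable lborel (\<lambda>s. g (t - s) * complex_of_real (fejer_kernel x s))"
proof (rule Bochner_Integration.integrable_bound)
  show "integrable lborel (\<lambda>s. M * fejer_kernel x s)"
    by (intro integrable_mult_right fejer_kernel_integrable)
  have [measurable]: "g \<in> borel_measurable borel" by (intro borel_measurable_continuous_onI assms)
  show "(\<lambda>s. g (t - s) * complex_of_real (fejer_kernel x s)) \<in> borel_measurable lborel" by measurable
  have "M \<ge> 0" using assms(2) norm_ge_zero order_trans by blast
  then show "AE s in lborel. norm (g (t - s) * complex_of_real (fejer_kernel x s)) \<le> norm (M * fejer_kernel x s)"
    using assms(2) by (auto simp: norm_mult abs_mult intro!: mult_right_mono)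
qed

lemma norm_integral_fejer_le:
  assumes x: "x > 0" and int: "integrable lborel (\<lambda>s. h s * complex_of_real (fejer_kernel x s))"
    and e: "\<And>s. cmod (h s) \<le> e"
  shows "cmod (LINT s|lborel. h s * complex_of_real (fejer_kernel x s)) \<le> e"
proof -
  have "cmod (LINT s|lborel. h s * complex_of_real (fejer_kernel x s)) \<le>
      (LINT s|lborel. e * fejer_kernel x s)"
    by (rule Bochner_Integration.integral_norm_bound_integral[OF int])
      (auto intro!: integrable_mult_right fejer_kernel_integrable mult_right_mono e
        simp: norm_mult fejer_kernel_nonneg[OF x])
  then show ?thesis using fejer_kernel_integral[OF x] by simp
qed

lemma fejer_conv_bound:
  assumes "continuous_on UNIV g" "\<And>t. cmod (g t) \<le> M" "x > 0"
  shows "cmod (fejer_conv g x t) \<le> M"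
  unfolding fejer_conv_def
  by (rule norm_integral_fejer_le[OF assms(3) fejer_conv_integrable[OF assms(1,2)] assms(2)])

lemma fejer_conv_diff_bound:
  assumes "continuous_on UNIV g" "\<And>t. cmod (g t) \<le> M" "x > 0" "\<And>s. cmod (g (t - s) - g (t' - s)) \<le> e"
  shows "cmod (fejer_conv g x t - fejer_conv g x t') \<le> e"
proof -
  note int = fejer_conv_integrable[OF assms(1,2)]
  have "fejer_conv g x t - fejer_conv g x t' =
      (LINT s|lborel. (g (t - s) - g (t' - s)) * complex_of_real (fejer_kernel x s))"
    unfolding fejer_conv_def
    by (subst Bochner_Integration.integral_diff[OF int int, symmetric]) (simp add: left_diff_distrib)
  moreover have "integrable lborel (\<lambda>s. (g (t - s) - g (t' - s)) * complex_of_real (fejer_kernel x s))"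
    using Bochner_Integration.integrable_diff[OF int int, of t x t' x] by (simp add: left_diff_distrib)
  ultimately show ?thesis using norm_integral_fejer_le[OF assms(3) _ assms(4)] by simp
qed

lemma uap_fejer_conv:
  assumes g: "uap g" and x: "x > 0" shows "uap (fejer_conv g x)"
proof (rule uapI)
  obtain M where M: "\<And>t. cmod (g t) \<le> M" using uap_bounded[OF g] by blast
  note diff = fejer_conv_diff_bound[OF uap_continuous[OF g] M x]
  show "continuous_on UNIV (fejer_conv g x)"
    unfolding continuous_on_iff
  proof (intro ballI allI impI)
    fix t e :: real assume e: "e > 0"
    obtain d where d: "d > 0" "\<And>x y. \<bar>x - y\<bar> < d \<Longrightarrow> cmod (g x - g y) < e / 2"
      using uap_modulus[OF g half_gt_zero[OF e]] by blast
    have "dist (fejer_conv g x t') (fejer_conv g x t) < e" if "dist t' t < d" for t'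
    proof -
      have "cmod (fejer_conv g x t' - fejer_conv g x t) \<le> e / 2"
        by (rule diff, rule less_imp_le, rule d(2)) (use that in \<open>simp add: dist_real_def\<close>)
      then show ?thesis using e by (simp add: dist_norm)
    qed
    then show "\<exists>d>0. \<forall>t'\<in>UNIV. dist t' t < d \<longrightarrow> dist (fejer_conv g x t') (fejer_conv g x t) < e"
      using d(1) by (intro exI[of _ d]) simp
  qed
  fix e :: real assume e: "e > 0"
  obtain l where l: "l > 0" "\<And>a. \<exists>\<tau>\<in>{a..a + l}. \<forall>x. cmod (g x - g (x + \<tau>)) \<le> e"
    using uap_translation_number[OF g e] by blast
  have "\<exists>\<tau>\<in>{a..a + l}. \<forall>t. cmod (fejer_conv g x t - fejer_conv g x (t + \<tau>)) \<le> e" for a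
  proof -
    obtain \<tau> where \<tau>: "\<tau> \<in> {a..a + l}" "\<And>x. cmod (g x - g (x + \<tau>)) \<le> e" using l(2) by blast
    have "cmod (g (t - s) - g (t + \<tau> - s)) \<le> e" for t s
      using \<tau>(2)[of "t - s"] by (simp add: algebra_simps)
    then have "cmod (fejer_conv g x t - fejer_conv g x (t + \<tau>)) \<le> e" for t by (rule diff)
    with \<tau>(1) show ?thesis by (intro bexI[of _ \<tau>]) simp_all
  qed
  with l(1) show "\<exists>l>0. \<forall>a. \<exists>\<tau>\<in>{a..a + l}. \<forall>t. cmod (fejer_conv g x t - fejer_conv g x (t + \<tau>)) \<le> e"
    by (intro exI[of _ l]) simp
qed

text \<open>
  The error depends only on \<open>M\<close>, \<open>r\<close> and \<open>e\<close>, so the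
  estimate is uniform over all functions with a common bound and a common modulus of continuity.
\<close>

lemma fejer_conv_close:
  assumes g: "continuous_on UNIV g" and M: "\<And>t. cmod (g t) \<le> M" and x: "x > 0" and r: "r > 0"
    and mod: "\<And>u. \<bar>u\<bar> < r \<Longrightarrow> cmod (g (t - u) - g t) \<le> e"
  shows "cmod (fejer_conv g x t - g t) \<le> e + 2 * M * fejer_tail r / x"
proof -
  have e0: "e \<ge> 0" using mod[of 0] r by simp
  have M0: "M \<ge> 0" using M norm_ge_zero order_trans by blast
  note int = fejer_conv_integrable[OF g M]
  have intF: "integrable lborel (\<lambda>s. g t * complex_of_real (fejer_kernel x s))"
    by (intro integrable_mult_right integrable_of_real fejer_kernel_integrable)
  have "(LINT s|lborel. g t * complex_of_real (fejer_kernel x s)) = g t"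
    using fejer_kernel_integral[OF x] by (simp add: integral_complex_of_real)
  then have "fejer_conv g x t - g t = (LINT s|lborel. (g (t - s) - g t) * complex_of_real (fejer_kernel x s))"
    unfolding fejer_conv_def
    by (simp add: left_diff_distrib Bochner_Integration.integral_diff[OF int intF])
  also have "cmod \<dots> \<le> (LINT s|lborel. e * fejer_kernel x s + 2 * M * (indicator {s. \<bar>s\<bar> \<ge> r} s * fejer_kernel x s))"
  proof (rule Bochner_Integration.integral_norm_bound_integral)
    show "integrable lborel (\<lambda>s. (g (t - s) - g t) * complex_of_real (fejer_kernel x s))"
      using Bochner_Integration.integrable_diff[OF int intF, of t x] by (simp add: left_diff_distrib)
    have tail: "integrable lborel (\<lambda>s. indicator {s. \<bar>s\<bar> \<ge> r} s * fejer_kernel x s)"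
      using integrable_real_mult_indicator[OF _ fejer_kernel_integrable, of "{s. \<bar>s\<bar> \<ge> r}" x]
      by (simp add: mult.commute)
    show "integrable lborel (\<lambda>s. e * fejer_kernel x s + 2 * M * (indicator {s. \<bar>s\<bar> \<ge> r} s * fejer_kernel x s))"
      by (intro Bochner_Integration.integrable_add integrable_mult_right fejer_kernel_integrable tail)
    fix s
    have F: "fejer_kernel x s \<ge> 0" by (rule fejer_kernel_nonneg[OF x])
    have "cmod (g (t - s) - g t) \<le> e + 2 * M * indicator {s. \<bar>s\<bar> \<ge> r} s"
    proof (cases "\<bar>s\<bar> < r")
      case False
      have "cmod (g (t - s) - g t) \<le> M + M" using norm_triangle_ineq4[of "g (t - s)" "g t"] M[of t] M[of "t - s"] by linarith
      with False e0 show ?thesis by simp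
    qed (use mod in simp)
    then have "cmod (g (t - s) - g t) * fejer_kernel x s \<le> (e + 2 * M * indicator {s. \<bar>s\<bar> \<ge> r} s) * fejer_kernel x s"
      using F by (intro mult_right_mono)
    then show "norm ((g (t - s) - g t) * complex_of_real (fejer_kernel x s)) \<le>
        e * fejer_kernel x s + 2 * M * (indicator {s. \<bar>s\<bar> \<ge> r} s * fejer_kernel x s)"
      using F by (simp add: norm_mult distrib_right mult.assoc)
  qed
  also have "\<dots> = e * (LINT s|lborel. fejer_kernel x s) + 2 * M * (LINT s|lborel. indicator {s. \<bar>s\<bar> \<ge> r} s * fejer_kernel x s)"
    using integrable_real_mult_indicator[OF _ fejer_kernel_integrable, of "{s. \<bar>s\<bar> \<ge> r}" x]
    by (subst Bochner_Integration.integral_add)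
      (auto intro!: integrable_mult_right fejer_kernel_integrable simp: mult.commute)
  also have "\<dots> \<le> e * 1 + 2 * M * (fejer_tail r / x)"
    using fejer_kernel_tail[OF x r] fejer_kernel_integral[OF x] M0 e0
    by (intro add_mono mult_left_mono) (auto simp: fejer_tail_def)
  finally show ?thesis by simp
qed

lemma fejer_conv_approx:
  assumes g: "uap g" and e: "e > 0"
  shows "\<exists>x0>0. \<forall>x\<ge>x0. \<forall>t. cmod (fejer_conv g x t - g t) \<le> e"
proof -
  obtain M where M: "M > 0" "\<And>t. cmod (g t) \<le> M" using uap_bounded[OF g] by blast
  obtain r where r: "r > 0" "\<And>x y. \<bar>x - y\<bar> < r \<Longrightarrow> cmod (g x - g y) < e / 2"
    using uap_modulus[OF g half_gt_zero[OF e]] by blast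
  define x0 where "x0 = max 1 (4 * M * fejer_tail r / e)"
  have "cmod (fejer_conv g x t - g t) \<le> e" if "x \<ge> x0" for x t
  proof -
    have x: "x > 0" "x \<ge> 4 * M * fejer_tail r / e" using that by (auto simp: x0_def)
    have "cmod (fejer_conv g x t - g t) \<le> e / 2 + 2 * M * fejer_tail r / x"
      by (rule fejer_conv_close[OF uap_continuous[OF g] M(2) x(1) r(1)], rule less_imp_le, rule r(2)) simp
    moreover have "2 * M * fejer_tail r / x \<le> e / 2" using x e by (simp add: field_simps)
    ultimately show ?thesis by simp
  qed
  then show ?thesis by (intro exI[of _ x0]) (auto simp: x0_def)
qed

lemma mean_fejer_conv:
  assumes g: "uap g" and x: "x > 0"
  shows "mean (\<lambda>t. fejer_conv g x t * cis (y * t)) =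
    of_real (max 0 (1 - \<bar>y\<bar> / x)) * mean (\<lambda>t. g t * cis (y * t))"
proof -
  define m where "m = mean (\<lambda>t. g t * cis (y * t))"
  obtain M where M: "M > 0" "\<And>t. cmod (g t) \<le> M" using uap_bounded[OF g] by blast
  define K where "K = (\<lambda>t s. g (t - s) * complex_of_real (fejer_kernel x s) * cis (y * t))"
  have [measurable]: "g \<in> borel_measurable borel" "(\<lambda>t. cis (y * t)) \<in> borel_measurable borel"
    by (intro borel_measurable_continuous_onI continuous_intros uap_continuous[OF g])+
  have K: "(LINT s|lborel. K t s) = fejer_conv g x t * cis (y * t)" for t
    unfolding K_def fejer_conv_def by simp
  have Kap: "uap (\<lambda>t. K t s)" for s
  proof -
    have "uap (\<lambda>t. complex_of_real (fejer_kernel x s) * (g (t + (- s)) * cis (y * t)))"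
      by (intro uap_cmult uap_mult_cis uap_translate g)
    then show ?thesis by (simp add: K_def mult_ac)
  qed
  have swap: "mean (\<lambda>t. LINT s|lborel. K t s) = (LINT s|lborel. mean (\<lambda>t. K t s))"
  proof (rule mean_integral_swap[where w = "\<lambda>s. M * fejer_kernel x s"])
    show "sigma_finite_measure (lborel :: real measure)" ..
    show "(\<lambda>(s, t). K t s) \<in> borel_measurable (lborel \<Otimes>\<^sub>M lborel)"
      unfolding K_def by measurable
    show "integrable lborel (\<lambda>s. M * fejer_kernel x s)"
      by (intro integrable_mult_right fejer_kernel_integrable)
    show "cmod (K t s) \<le> M * fejer_kernel x s" for t s
      using M(2)[of "t - s"] fejer_kernel_nonneg[OF x, of s] by (auto simp: K_def norm_mult intro!: mult_right_mono)
    show "uap (\<lambda>t. LINT s|lborel. K t s)"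
      unfolding K by (intro uap_mult_cis uap_fejer_conv g x)
  qed (rule Kap)
  have inner: "mean (\<lambda>t. K t s) = m * (complex_of_real (fejer_kernel x s) * cis (y * s))" for s
  proof -
    have "K t s = (complex_of_real (fejer_kernel x s) * cis (y * s)) * (g (t + (- s)) * cis (y * (t + (- s))))" for t
    proof -
      have "cis (y * t) = cis (y * s) * cis (y * (t + (- s)))" by (simp add: cis_mult algebra_simps)
      then show ?thesis unfolding K_def by (simp only: mult_ac) simp
    qed
    then have "mean (\<lambda>t. K t s) = (complex_of_real (fejer_kernel x s) * cis (y * s)) *
        mean (\<lambda>t. g (t + (- s)) * cis (y * (t + (- s))))"
      by (simp only: mean_cmult[OF uap_translate[OF uap_mult_cis[OF g]]])
    also have "mean (\<lambda>t. g (t + (- s)) * cis (y * (t + (- s)))) = m"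
      unfolding m_def by (rule mean_translate[OF uap_mult_cis[OF g, where y = y]])
    finally show ?thesis by (simp only: mult_ac)
  qed
  have "mean (\<lambda>t. LINT s|lborel. K t s) = m * of_real (max 0 (1 - \<bar>y\<bar> / x))"
    by (simp only: swap inner integral_mult_right_zero fejer_kernel_transform[OF x])
  then show ?thesis unfolding K m_def by (simp only: mult.commute)
qed

section \<open>Riesz means as Fejer convolutions\<close>

lemma mean_cis_mult_cis: "mean (\<lambda>t. cis (- (l * t)) * cis (y * t)) = (if y = l then 1 else 0)"
  using mean_cis[of "y - l"] by (simp add: cis_mult left_diff_distrib)

text \<open>
  The restriction of a Dirichlet polynomial to a vertical line.
\<close>

definition trig_sum :: "(nat \<Rightarrow> real) \<Rightarrow> nat set \<Rightarrow> (nat \<Rightarrow> complex) \<Rightarrow> real \<Rightarrow> complex" where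
  "trig_sum lam I c t = (\<Sum>n\<in>I. c n * cis (- (lam n * t)))"

lemma uap_trig_sum: "uap (trig_sum lam I c)"
  using uap_cis[of "- lam n" for n] unfolding trig_sum_def[abs_def]
  by (intro uap_sum uap_cmult) simp

lemma mean_trig_sum:
  "mean (\<lambda>t. trig_sum lam I c t * cis (y * t)) = (\<Sum>n\<in>I. c n * (if y = lam n then 1 else 0))"
proof -
  have ap: "uap (\<lambda>t. cis (- (lam n * t)) * cis (y * t))" for n
    using uap_mult_cis[OF uap_cis[of "- lam n"], of y] by simp
  have "mean (\<lambda>t. trig_sum lam I c t * cis (y * t)) = mean (\<lambda>t. \<Sum>n\<in>I. c n * (cis (- (lam n * t)) * cis (y * t)))"
    by (simp add: trig_sum_def sum_distrib_right mult.assoc)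
  also have "\<dots> = (\<Sum>n\<in>I. mean (\<lambda>t. c n * (cis (- (lam n * t)) * cis (y * t))))"
    by (intro mean_sum uap_cmult ap)
  also have "\<dots> = (\<Sum>n\<in>I. c n * (if y = lam n then 1 else 0))"
    by (simp only: mean_cmult[OF ap] mean_cis_mult_cis)
  finally show ?thesis .
qed

definition riesz_index :: "(nat \<Rightarrow> real) \<Rightarrow> real \<Rightarrow> nat set" where
  "riesz_index lam x = {n. lam n < x}"

lemma frequency_inj: "frequency lam \<Longrightarrow> lam m = lam n \<longleftrightarrow> m = n"
  by (auto simp: frequency_def strict_mono_eq)

lemma finite_riesz_index:
  assumes "frequency lam" shows "finite (riesz_index lam x)"
proof -
  obtain N where "lam N > x"
    using assms by (auto simp: frequency_def bdd_above_def not_le)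
  then have "riesz_index lam x \<subseteq> {..<N}"
    using assms by (auto simp: riesz_index_def frequency_def strict_mono_less[symmetric] intro: less_trans)
  then show ?thesis using finite_subset by blast
qed

text \<open>
  Both sides are almost periodic with the same mean coefficients; those of the convolution vanish
  for \<open>\<bar>y\<bar> \<ge> x\<close> because the hat function does.
\<close>

theorem fejer_conv_eq_riesz_mean:
  assumes g: "uap g" and lam: "frequency lam" and x: "x > 0"
    and spec: "\<And>y. y \<notin> range lam \<Longrightarrow> mean (\<lambda>t. g t * cis (y * t)) = 0"
    and c: "\<And>n. c n = mean (\<lambda>t. g t * cis (lam n * t))"
  shows "fejer_conv g x t = trig_sum lam (riesz_index lam x) (\<lambda>n. of_real (1 - lam n / x) * c n) t"
proof -
  let ?p = "trig_sum lam (riesz_index lam x) (\<lambda>n. of_real (1 - lam n / x) * c n)"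
  have ap: "uap (\<lambda>t. fejer_conv g x t - ?p t)"
    by (intro uap_diff uap_fejer_conv g x uap_trig_sum)
  have "mean (\<lambda>t. (fejer_conv g x t - ?p t) * cis (y * t)) = 0" for y
  proof -
    have "mean (\<lambda>t. (fejer_conv g x t - ?p t) * cis (y * t)) =
        of_real (max 0 (1 - \<bar>y\<bar> / x)) * mean (\<lambda>t. g t * cis (y * t)) -
        (\<Sum>n\<in>riesz_index lam x. of_real (1 - lam n / x) * c n * (if y = lam n then 1 else 0))"
      unfolding left_diff_distrib
      by (subst mean_diff) (auto intro: uap_mult_cis uap_fejer_conv g x uap_trig_sum
          simp: mean_fejer_conv[OF g x] mean_trig_sum)
    also have "\<dots> = 0"
    proof (cases "y \<in> range lam")
      case True
      then obtain m where m: "y = lam m" by blast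
      have l0: "lam m \<ge> 0" using lam by (simp add: frequency_def)
      have "(\<Sum>n\<in>riesz_index lam x. of_real (1 - lam n / x) * c n * (if y = lam n then 1 else 0)) =
         (\<Sum>n\<in>riesz_index lam x. if m = n then of_real (1 - lam n / x) * c n else 0)"
        by (intro sum.cong refl) (simp add: m frequency_inj[OF lam])
      also have "\<dots> = (if m \<in> riesz_index lam x then of_real (1 - lam m / x) * c m else 0)"
        by (rule sum.delta'[OF finite_riesz_index[OF lam]])
      also have "\<dots> = of_real (max 0 (1 - \<bar>y\<bar> / x)) * mean (\<lambda>t. g t * cis (y * t))"
        using l0 x by (auto simp: riesz_index_def m c max_def divide_simps)
      finally show ?thesis by simp
    next
      case False
      then have "(\<Sum>n\<in>riesz_index lam x. of_real (1 - lam n / x) * c n * (if y = lam n then 1 else 0)) = 0"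
        by (intro sum.neutral) auto
      then show ?thesis using spec[OF False] by simp
    qed
    finally show ?thesis .
  qed
  from uap_uniqueness[OF ap this] show ?thesis by simp
qed

lemma fejer_conv_trig_sum:
  assumes x: "x > 0"
  shows "fejer_conv (trig_sum lam I c) x t = trig_sum lam I (\<lambda>n. of_real (max 0 (1 - \<bar>lam n\<bar> / x)) * c n) t"
proof -
  have cisap: "uap (\<lambda>t. cis (- (lam n * t)))" for n using uap_cis[of "- lam n"] by simp
  have int: "integrable lborel (\<lambda>s. cis (- (lam n * (t - s))) * complex_of_real (fejer_kernel x s))" for n
    using fejer_conv_integrable[OF uap_continuous[OF cisap[of n]], where M = 1 and t = t and x = x] by simp
  have "fejer_conv (trig_sum lam I c) x t =
      (LINT s|lborel. (\<Sum>n\<in>I. c n * (cis (- (lam n * (t - s))) * complex_of_real (fejer_kernel x s))))"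
    by (simp add: fejer_conv_def trig_sum_def sum_distrib_right mult.assoc)
  also have "\<dots> = (\<Sum>n\<in>I. c n * (LINT s|lborel. cis (- (lam n * (t - s))) * complex_of_real (fejer_kernel x s)))"
    by (subst Bochner_Integration.integral_sum) (auto intro!: integrable_mult_right int)
  finally have eq: "fejer_conv (trig_sum lam I c) x t =
    (\<Sum>n\<in>I. c n * (LINT s|lborel. cis (- (lam n * (t - s))) * complex_of_real (fejer_kernel x s)))" .
  have "(LINT s|lborel. cis (- (lam n * (t - s))) * complex_of_real (fejer_kernel x s)) =
      cis (- (lam n * t)) * of_real (max 0 (1 - \<bar>lam n\<bar> / x))" for n
  proof -
    have "cis (- (lam n * (t - s))) * complex_of_real (fejer_kernel x s) =
        cis (- (lam n * t)) * (complex_of_real (fejer_kernel x s) * cis (lam n * s))" for s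
    proof -
      have "cis (- (lam n * (t - s))) = cis (- (lam n * t)) * cis (lam n * s)" by (simp add: cis_mult algebra_simps)
      then show ?thesis by (simp only: mult_ac)
    qed
    then show ?thesis by (simp only: integral_mult_right_zero fejer_kernel_transform[OF x])
  qed
  then show ?thesis unfolding eq by (simp add: trig_sum_def mult_ac)
qed

section \<open>Bounded holomorphic functions on a half-plane\<close>

text \<open>
  The Phragmen-Lindelof principle. Dividing \<open>h\<close> by \<open>1 + e * (s - \<sigma>)\<close>, whose modulus is at least one on the half-plane and grows linearly, makes the
  maximum principle applicable on a large half-disc.
\<close>

lemma half_plane_maximum:
  assumes hol: "h holomorphic_on {s. a < Re s}" and a: "a < \<sigma>"
    and bdd: "\<And>s. Re s \<ge> \<sigma> \<Longrightarrow> cmod (h s) \<le> M"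
    and line: "\<And>t. cmod (h (Complex \<sigma> t)) \<le> B"
    and s: "Re s \<ge> \<sigma>"
  shows "cmod (h s) \<le> B"
proof (cases "Re s = \<sigma>")
  case True
  then show ?thesis using line[of "Im s"] by (metis complex_surj)
next
  case False
  then have s: "Re s > \<sigma>" using s by simp
  have B0: "B \<ge> 0" using line[of 0] norm_ge_zero order_trans by blast
  have M0: "M \<ge> 0" using bdd[of s] s norm_ge_zero order_trans by (metis less_imp_le)
  define c where "c = complex_of_real \<sigma>"
  have main: "cmod (h s) \<le> B' * (1 + e * cmod (s - c))" if e: "e > 0" and B': "B' > B" for e B'
  proof -
    define H where "H = (\<lambda>z. h z / (1 + of_real e * (z - c)))"
    \<comment> \<open>On the circle of radius \<open>N\<close> the denominator is so large that the global bound \<open>M\<close> suffices.\<close>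
    define N where "N = max (M / (e * B')) (cmod (s - c)) + 1"
    define U where "U = {z. Re z > \<sigma>} \<inter> ball c N"
    have B'0: "B' > 0" using B0 B' by simp
    have den_ge1: "cmod (1 + of_real e * (z - c)) \<ge> 1" if "Re z \<ge> \<sigma>" for z
    proof -
      have "1 \<le> Re (1 + of_real e * (z - c))" using that e by (simp add: c_def)
      also have "\<dots> \<le> cmod (1 + of_real e * (z - c))" by (rule complex_Re_le_cmod)
      finally show ?thesis .
    qed
    have den_ge: "cmod (1 + of_real e * (z - c)) \<ge> e * cmod (z - c)" if "Re z \<ge> \<sigma>" for z
    proof -
      have "(e * cmod (z - c))\<^sup>2 \<le> (cmod (1 + of_real e * (z - c)))\<^sup>2"
      proof -
        have "e * (Re z - \<sigma>) \<ge> 0" using that e by simp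
        then show ?thesis
          unfolding power_mult_distrib cmod_power2
          by (simp add: c_def power2_eq_square algebra_simps)
      qed
      then show ?thesis by (rule power2_le_imp_le) simp
    qed
    have closU: "closure U \<subseteq> {z. Re z \<ge> \<sigma>} \<inter> cball c N"
      by (rule closure_minimal) (auto simp: U_def closed_halfspace_Re_ge)
    have openU: "open U" unfolding U_def by (intro open_Int open_halfspace_Re_gt open_ball)
    have hol_on: "H holomorphic_on {z. Re z > a} - {z. 1 + of_real e * (z - c) = 0}"
      unfolding H_def by (intro holomorphic_intros holomorphic_on_subset[OF hol]) auto
    have nz: "1 + of_real e * (z - c) \<noteq> 0" if "Re z \<ge> \<sigma>" for z
      using den_ge1[OF that] by auto
    have sub: "{z. Re z \<ge> \<sigma>} \<subseteq> {z. Re z > a} - {z. 1 + of_real e * (z - c) = 0}"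
      using nz a by auto
    have "cmod (H s) \<le> B'"
    proof (rule maximum_modulus_frontier[of H U])
      show "H holomorphic_on interior U"
      proof (rule holomorphic_on_subset[OF hol_on])
        have "U \<subseteq> {z. Re z \<ge> \<sigma>}" by (auto simp: U_def)
        then show "interior U \<subseteq> {z. Re z > a} - {z. 1 + of_real e * (z - c) = 0}"
          unfolding interior_open[OF openU] using sub by (rule subset_trans)
      qed
      show "continuous_on (closure U) H"
        by (rule continuous_on_subset[OF holomorphic_on_imp_continuous_on[OF hol_on]]) (use sub closU in auto)
      show "bounded U" by (simp add: U_def bounded_Int)
      show "s \<in> U" using s by (auto simp: U_def N_def dist_norm norm_minus_commute)
      fix z assume "z \<in> frontier U"
      then have z: "z \<in> closure U" "z \<notin> U" using openU by (auto simp: frontier_def interior_open)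
      then have zr: "Re z \<ge> \<sigma>" "cmod (z - c) \<le> N" using closU by (auto simp: dist_norm norm_minus_commute)
      consider "Re z = \<sigma>" | "cmod (z - c) = N"
        using z(2) zr by (force simp: U_def dist_norm norm_minus_commute)
      then show "cmod (H z) \<le> B'"
      proof cases
        case 1
        have "cmod (H z) \<le> cmod (h z)"
          using den_ge1[OF zr(1)] by (simp add: H_def norm_divide divide_le_eq mult_le_cancel_left1)
        also have "\<dots> \<le> B" using line[of "Im z"] 1 by (metis complex_surj)
        finally show ?thesis using B' by simp
      next
        case 2
        have "M / (e * B') \<le> cmod (z - c)" using 2 by (simp add: N_def)
        then have "M \<le> B' * (e * cmod (z - c))" using e B'0 by (simp add: field_simps)
        also have "\<dots> \<le> B' * cmod (1 + of_real e * (z - c))"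
          using den_ge[OF zr(1)] B'0 by (intro mult_left_mono) auto
        finally have "cmod (h z) \<le> B' * cmod (1 + of_real e * (z - c))" using bdd[OF zr(1)] by linarith
        then show ?thesis
          using nz[OF zr(1)] by (simp add: H_def norm_divide divide_le_eq)
      qed
    qed
    then have "cmod (h s) \<le> B' * cmod (1 + of_real e * (s - c))"
      using den_ge1[of s] s by (simp add: H_def norm_divide divide_le_eq split: if_splits)
    also have "\<dots> \<le> B' * (1 + e * cmod (s - c))"
      using B'0 e norm_triangle_ineq[of 1 "of_real e * (s - c)"] by (intro mult_left_mono) (auto simp: norm_mult)
    finally show ?thesis .
  qed
  show ?thesis
  proof (rule field_le_epsilon)
    fix d :: real assume d: "d > 0"
    define B' where "B' = B + d / 2"
    define e where "e = d / (2 * B' * (cmod (s - c) + 1))"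
    have B': "B' > 0" "B' > B" using B0 d by (auto simp: B'_def)
    have w: "cmod (s - c) + 1 > 0" by (simp add: add_nonneg_pos)
    have e: "e > 0" using d B' w by (simp add: e_def)
    have "B' * (e * cmod (s - c)) \<le> B' * (e * (cmod (s - c) + 1))" using B' e by (intro mult_left_mono) auto
    also have "\<dots> = d / 2" using B' w by (simp add: e_def)
    finally have "B' * (1 + e * cmod (s - c)) \<le> B + d" by (simp add: distrib_left B'_def)
    with main[OF e B'(2)] show "cmod (h s) \<le> B + d" by simp
  qed
qed

text \<open>
  Cauchy's estimate on discs of radius \<open>\<sigma> / 2\<close>.
\<close>

lemma bounded_holomorphic_lipschitz_on_line:
  assumes hol: "h holomorphic_on {s. 0 < Re s}" and \<sigma>: "\<sigma> > 0"
    and B: "\<And>s. Re s \<ge> \<sigma> / 2 \<Longrightarrow> cmod (h s) \<le> B"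
  shows "cmod (h (Complex \<sigma> t) - h (Complex \<sigma> u)) \<le> (2 * B / \<sigma>) * \<bar>t - u\<bar>"
proof -
  define S where "S = {s. Re s \<ge> \<sigma>}"
  have der: "(h has_field_derivative deriv h z) (at z within S)" if "z \<in> S" for z
    by (rule has_field_derivative_at_within, rule holomorphic_derivI[OF hol])
      (use that \<sigma> in \<open>auto simp: S_def open_halfspace_Re_gt\<close>)
  have bd: "cmod (deriv h z) \<le> 2 * B / \<sigma>" if z: "z \<in> S" for z
  proof -
    have sub: "cball z (\<sigma> / 2) \<subseteq> {s. Re s \<ge> \<sigma> / 2}"
    proof
      fix w assume "w \<in> cball z (\<sigma> / 2)"
      then have "\<bar>Re (z - w)\<bar> \<le> \<sigma> / 2"
        using abs_Re_le_cmod[of "z - w"] by (simp add: dist_norm)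
      then have "Re z - Re w \<le> \<sigma> / 2" by (simp only: minus_complex.sel abs_le_iff)
      then show "w \<in> {s. Re s \<ge> \<sigma> / 2}" using z by (simp add: S_def)
    qed
    have sub': "cball z (\<sigma> / 2) \<subseteq> {s. 0 < Re s}" using sub \<sigma> by force
    have "cmod ((deriv ^^ 1) h z) \<le> fact 1 * B / (\<sigma> / 2) ^ 1"
    proof (rule Cauchy_inequality)
      show "h holomorphic_on ball z (\<sigma> / 2)"
        by (rule holomorphic_on_subset[OF hol]) (use sub' ball_subset_cball in blast)
      show "continuous_on (cball z (\<sigma> / 2)) h"
        by (rule continuous_on_subset[OF holomorphic_on_imp_continuous_on[OF hol] sub'])
      show "\<sigma> / 2 > 0" using \<sigma> by simp
      show "cmod (h w) \<le> B" if "cmod (z - w) = \<sigma> / 2" for w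
        by (rule B) (use sub that in \<open>force simp: dist_norm\<close>)
    qed
    then show ?thesis by (simp add: mult.commute)
  qed
  have "convex S" unfolding S_def by (rule convex_halfspace_Re_ge)
  from field_differentiable_bound[OF this der bd, of "Complex \<sigma> t" "Complex \<sigma> u"]
  have "cmod (h (Complex \<sigma> t) - h (Complex \<sigma> u)) \<le> 2 * B / \<sigma> * cmod (Complex \<sigma> t - Complex \<sigma> u)"
    by (simp add: S_def)
  also have "cmod (Complex \<sigma> t - Complex \<sigma> u) = \<bar>t - u\<bar>" by (simp add: cmod_def)
  finally show ?thesis .
qed

section \<open>Bohr coefficients on the half-plane\<close>

text \<open>
  Membership in \<open>H_inf_plus\<close> without the condition on the coefficients, and hence
  independent of the values in \<open>Re s \<le> 0\<close>.
\<close>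

definition ap_half_plane :: "(complex \<Rightarrow> complex) \<Rightarrow> bool" where
  "ap_half_plane f \<longleftrightarrow>
     f holomorphic_on {s. 0 < Re s} \<and>
     (\<forall>e>0. bounded (f ` {s. e < Re s})) \<and>
     (\<forall>\<sigma>>0. uap (\<lambda>t. f (Complex \<sigma> t)))"

lemma H_inf_plus_alt:
  "f \<in> H_inf_plus lam \<longleftrightarrow> (\<forall>s. Re s \<le> 0 \<longrightarrow> f s = 0) \<and> ap_half_plane f \<and>
     (\<forall>x. x \<notin> range lam \<longrightarrow> bohr_coeff f x = 0)"
  by (auto simp: H_inf_plus_def ap_half_plane_def)

lemma ap_half_plane_bound:
  assumes "ap_half_plane f" "\<sigma> > 0"
  obtains M where "M > 0" "\<And>s. Re s \<ge> \<sigma> \<Longrightarrow> cmod (f s) \<le> M"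
proof -
  have "bounded (f ` {s. \<sigma> / 2 < Re s})" using assms(1) half_gt_zero[OF assms(2)] unfolding ap_half_plane_def by blast
  then obtain M where M: "M > 0" "\<forall>z\<in>f ` {s. \<sigma> / 2 < Re s}. cmod z \<le> M"
    unfolding bounded_pos by blast
  show ?thesis by (rule that[OF M(1)]) (use M(2) assms(2) in auto)
qed

text \<open>
  With a primitive \<open>G\<close> of \<open>F s = f s * exp (s * x)\<close> on the half-plane,
  the difference of the integrals of \<open>F\<close> over two vertical segments is, up to the
  factor \<open>\<i>\<close>, a difference of two horizontal increments of \<open>G\<close>. These
  are bounded independently of the height \<open>T\<close>, so the means agree in the limit.
\<close>

lemma mean_line_independent:
  assumes f: "ap_half_plane f" and \<sigma>: "\<sigma> > 0" "\<sigma>' > 0"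
  shows "of_real (exp (\<sigma> * x)) * mean (\<lambda>t. f (Complex \<sigma> t) * cis (x * t)) =
         of_real (exp (\<sigma>' * x)) * mean (\<lambda>t. f (Complex \<sigma>' t) * cis (x * t))"
proof -
  define F where "F = (\<lambda>s. f s * exp (s * of_real x))"
  define P where "P = {s. 0 < Re s}"
  have P: "convex P" "open P" unfolding P_def by (simp_all add: convex_halfspace_Re_gt open_halfspace_Re_gt)
  have "F holomorphic_on P"
    unfolding F_def P_def by (intro holomorphic_intros) (use f in \<open>simp add: ap_half_plane_def\<close>)
  then obtain G where G: "\<And>s. s \<in> P \<Longrightarrow> (G has_field_derivative F s) (at s within P)"
    using holomorphic_convex_primitive'[OF P] by blast
  have Gat: "(G has_field_derivative F s) (at s)" if "s \<in> P" for s
    using G[OF that] unfolding at_within_open[OF that P(2)] .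
  define I where "I = (\<lambda>r T. integral {-T..T} (\<lambda>t. F (Complex r t)))"
  have Fline: "F (Complex r t) = of_real (exp (r * x)) * (f (Complex r t) * cis (x * t))" for r t
    by (simp add: F_def exp_eq_polar mult.commute exp_of_real)
  have fline: "uap (\<lambda>t. f (Complex r t))" if "r > 0" for r using f that by (simp add: ap_half_plane_def)
  have Fap: "uap (\<lambda>t. F (Complex r t))" if "r > 0" for r
    unfolding Fline by (intro uap_cmult uap_mult_cis fline that)
  have FTC: "\<i> * I r T = G (Complex r T) - G (Complex r (-T))" if r: "r > 0" and T: "T \<ge> 0" for r T
  proof -
    have "((\<lambda>t. \<i> * F (Complex r t)) has_integral G (Complex r T) - G (Complex r (-T))) {-T..T}"
    proof (rule fundamental_theorem_of_calculus)
      show "-T \<le> T" using T by simp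
      fix t
      have "((\<lambda>t. Complex r t) has_vector_derivative \<i>) (at t within {-T..T})"
        unfolding Complex_eq by (auto intro!: derivative_eq_intros)
      moreover have "(G has_field_derivative F (Complex r t)) (at (Complex r t) within (\<lambda>t. Complex r t) ` {-T..T})"
        by (rule has_field_derivative_at_within, rule Gat) (use r in \<open>simp add: P_def\<close>)
      ultimately show "((\<lambda>t. G (Complex r t)) has_vector_derivative \<i> * F (Complex r t)) (at t within {-T..T})"
        using field_vector_diff_chain_within[of "\<lambda>t. Complex r t" \<i> t "{-T..T}" G] by (simp add: o_def)
    qed
    then have "integral {-T..T} (\<lambda>t. \<i> * F (Complex r t)) = G (Complex r T) - G (Complex r (-T))"
      by (rule integral_unique)
    then show ?thesis by (simp add: I_def)
  qed
  define m where "m = min \<sigma> \<sigma>'"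
  define R where "R = max \<sigma> \<sigma>'"
  have m: "m > 0" using \<sigma> by (simp add: m_def)
  obtain M where M: "M > 0" "\<And>s. Re s \<ge> m \<Longrightarrow> cmod (f s) \<le> M" using ap_half_plane_bound[OF f m] by blast
  define C where "C = M * exp (R * \<bar>x\<bar>)"
  define S where "S = {s. m \<le> Re s} \<inter> {s. Re s \<le> R}"
  have S: "convex S" unfolding S_def by (intro convex_Int convex_halfspace_Re_ge convex_halfspace_Re_le)
  have FC: "cmod (F s) \<le> C" if "s \<in> S" for s
  proof -
    have "Re s * x \<le> R * \<bar>x\<bar>"
    proof -
      have "Re s * x \<le> Re s * \<bar>x\<bar>" using that m by (intro mult_left_mono) (auto simp: S_def)
      also have "\<dots> \<le> R * \<bar>x\<bar>" using that by (intro mult_right_mono) (auto simp: S_def)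
      finally show ?thesis .
    qed
    then show ?thesis unfolding F_def C_def norm_mult using M that
      by (intro mult_mono) (auto simp: S_def)
  qed
  have incr: "cmod (G (Complex \<sigma> t) - G (Complex \<sigma>' t)) \<le> C * \<bar>\<sigma> - \<sigma>'\<bar>" for t
  proof -
    have "cmod (G (Complex \<sigma> t) - G (Complex \<sigma>' t)) \<le> C * cmod (Complex \<sigma> t - Complex \<sigma>' t)"
      by (rule field_differentiable_bound[OF S has_field_derivative_at_within[OF Gat] FC])
        (use m in \<open>auto simp: S_def P_def m_def R_def\<close>)
    also have "cmod (Complex \<sigma> t - Complex \<sigma>' t) = \<bar>\<sigma> - \<sigma>'\<bar>" by (simp add: cmod_def)
    finally show ?thesis .
  qed
  have diff: "cmod (I \<sigma> T - I \<sigma>' T) \<le> 2 * C * \<bar>\<sigma> - \<sigma>'\<bar>" if "T \<ge> 0" for T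
  proof -
    have "cmod (I \<sigma> T - I \<sigma>' T) = cmod (\<i> * I \<sigma> T - \<i> * I \<sigma>' T)"
      by (simp add: norm_mult flip: right_diff_distrib)
    also have "\<i> * I \<sigma> T - \<i> * I \<sigma>' T =
        (G (Complex \<sigma> T) - G (Complex \<sigma>' T)) - (G (Complex \<sigma> (-T)) - G (Complex \<sigma>' (-T)))"
      using FTC[OF \<sigma>(1) that] FTC[OF \<sigma>(2) that] by simp
    also have "cmod \<dots> \<le> C * \<bar>\<sigma> - \<sigma>'\<bar> + C * \<bar>\<sigma> - \<sigma>'\<bar>"
      by (intro norm_triangle_le_diff add_mono incr)
    finally show ?thesis by simp
  qed
  have lim: "((\<lambda>T. (1 / (2 * complex_of_real T)) * I r T) \<longlongrightarrow> mean (\<lambda>t. F (Complex r t))) at_top" if "r > 0" for r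
    using uap_has_mean_mean[OF Fap[OF that]] by (simp add: has_mean_def I_def)
  have "((\<lambda>T. (1 / (2 * complex_of_real T)) * I \<sigma> T - (1 / (2 * complex_of_real T)) * I \<sigma>' T) \<longlongrightarrow> 0) at_top"
  proof (rule Lim_null_comparison)
    show "\<forall>\<^sub>F T in at_top. cmod ((1 / (2 * complex_of_real T)) * I \<sigma> T - (1 / (2 * complex_of_real T)) * I \<sigma>' T)
        \<le> C * \<bar>\<sigma> - \<sigma>'\<bar> / T"
      using eventually_gt_at_top[of 0]
    proof eventually_elim
      case (elim T)
      have "cmod ((1 / (2 * complex_of_real T)) * I \<sigma> T - (1 / (2 * complex_of_real T)) * I \<sigma>' T) =
          (1 / (2 * T)) * cmod (I \<sigma> T - I \<sigma>' T)"
        unfolding right_diff_distrib[symmetric] norm_mult using elim by (simp add: norm_divide)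
      also have "\<dots> \<le> (1 / (2 * T)) * (2 * C * \<bar>\<sigma> - \<sigma>'\<bar>)"
        using elim diff[of T] by (intro mult_left_mono) auto
      finally show ?case using elim by simp
    qed
    show "((\<lambda>T. C * \<bar>\<sigma> - \<sigma>'\<bar> / T) \<longlongrightarrow> 0) at_top"
      by (intro tendsto_divide_0[OF tendsto_const] filterlim_at_top_imp_at_infinity filterlim_ident)
  qed
  moreover have "((\<lambda>T. (1 / (2 * complex_of_real T)) * I \<sigma> T - (1 / (2 * complex_of_real T)) * I \<sigma>' T)
      \<longlongrightarrow> mean (\<lambda>t. F (Complex \<sigma> t)) - mean (\<lambda>t. F (Complex \<sigma>' t))) at_top"
    by (intro tendsto_diff lim \<sigma>)
  ultimately have "mean (\<lambda>t. F (Complex \<sigma> t)) - mean (\<lambda>t. F (Complex \<sigma>' t)) = 0"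
    using tendsto_unique[OF trivial_limit_at_top_linorder] by blast
  then show ?thesis
    unfolding Fline by (simp add: mean_cmult uap_mult_cis fline \<sigma>)
qed

text \<open>
  All means of almost periodic functions exist, and they agree for all \<open>\<sigma>\<close>; so
  the definite description is proper.
\<close>

theorem bohr_coeff_eq_mean:
  assumes f: "ap_half_plane f" and \<sigma>: "\<sigma> > 0"
  shows "bohr_coeff f x = of_real (exp (\<sigma> * x)) * mean (\<lambda>t. f (Complex \<sigma> t) * cis (x * t))"
proof -
  define a where "a = of_real (exp (\<sigma> * x)) * mean (\<lambda>t. f (Complex \<sigma> t) * cis (x * t))"
  have fline: "uap (\<lambda>t. f (Complex r t) * cis (x * t))" if "r > 0" for r
    using f that by (intro uap_mult_cis) (simp add: ap_half_plane_def)
  have "((\<lambda>T. (1 / (2 * complex_of_real T)) *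
      integral {-T..T} (\<lambda>t. f (Complex r t) * exp (Complex r t * complex_of_real x))) \<longlongrightarrow> a) at_top" if r: "r > 0" for r
  proof -
    have eq: "(\<lambda>t. f (Complex r t) * exp (Complex r t * complex_of_real x)) =
        (\<lambda>t. of_real (exp (r * x)) * (f (Complex r t) * cis (x * t)))"
      by (simp add: exp_eq_polar mult.commute exp_of_real fun_eq_iff)
    have "has_mean (\<lambda>t. f (Complex r t) * exp (Complex r t * complex_of_real x)) a"
      unfolding eq a_def mean_line_independent[OF f \<sigma> r]
      by (rule has_mean_cmult[OF uap_has_mean_mean[OF fline[OF r]]])
    then show ?thesis unfolding has_mean_def .
  qed
  then have "bohr_coeff f x = a"
    unfolding bohr_coeff_def
    by (intro the_equality) (auto dest!: spec[of _ 1] intro: tendsto_unique[OF trivial_limit_at_top_linorder])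
  then show ?thesis by (simp add: a_def)
qed

lemma bohr_coeff_bound:
  assumes f: "ap_half_plane f" and \<sigma>: "\<sigma> > 0" and B: "\<And>t. cmod (f (Complex \<sigma> t)) \<le> B"
  shows "cmod (bohr_coeff f x) \<le> exp (\<sigma> * x) * B"
proof -
  have "cmod (mean (\<lambda>t. f (Complex \<sigma> t) * cis (x * t))) \<le> B"
    using f \<sigma> B by (intro mean_bound uap_mult_cis) (auto simp: ap_half_plane_def norm_mult)
  then show ?thesis by (simp add: bohr_coeff_eq_mean[OF f \<sigma>] norm_mult)
qed

lemma ap_half_plane_add:
  assumes "ap_half_plane f" "ap_half_plane g" shows "ap_half_plane (\<lambda>s. f s + g s)"
  using assms unfolding ap_half_plane_def
  by (auto intro!: holomorphic_intros uap_add bounded_plus_comp)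

lemma ap_half_plane_cmult:
  assumes "ap_half_plane f" shows "ap_half_plane (\<lambda>s. c * f s)"
proof -
  have "bounded ((\<lambda>s. c * f s) ` S)" if "bounded (f ` S)" for S
    using bounded_linear_image[OF that bounded_linear_mult_right[of c]] by (simp add: image_image)
  then show ?thesis
    using assms unfolding ap_half_plane_def by (auto intro!: holomorphic_intros uap_cmult)
qed

lemma bohr_coeff_add:
  assumes "ap_half_plane f" "ap_half_plane g"
  shows "bohr_coeff (\<lambda>s. f s + g s) x = bohr_coeff f x + bohr_coeff g x"
proof -
  have "uap (\<lambda>t. f (Complex 1 t) * cis (x * t))" "uap (\<lambda>t. g (Complex 1 t) * cis (x * t))"
    using assms by (auto simp: ap_half_plane_def intro: uap_mult_cis)
  then show ?thesis
    using assms by (simp add: bohr_coeff_eq_mean[of _ 1] ap_half_plane_add distrib_right mean_add distrib_left)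
qed

lemma bohr_coeff_cmult:
  assumes "ap_half_plane f"
  shows "bohr_coeff (\<lambda>s. c * f s) x = c * bohr_coeff f x"
proof -
  have "uap (\<lambda>t. f (Complex 1 t) * cis (x * t))"
    using assms by (auto simp: ap_half_plane_def intro: uap_mult_cis)
  then show ?thesis
    using assms by (simp add: bohr_coeff_eq_mean[of _ 1] ap_half_plane_cmult mult.assoc mean_cmult)
qed

lemma ap_half_plane_uminus_diff:
  assumes "ap_half_plane f" "ap_half_plane g"
  shows "ap_half_plane (\<lambda>s. f s - g s)" "bohr_coeff (\<lambda>s. f s - g s) x = bohr_coeff f x - bohr_coeff g x"
  using ap_half_plane_add[OF assms(1) ap_half_plane_cmult[OF assms(2), of "-1"]]
    bohr_coeff_add[OF assms(1) ap_half_plane_cmult[OF assms(2), of "-1"]]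
    bohr_coeff_cmult[OF assms(2), of "-1"] by simp_all

text \<open>
  Uniform limits preserve holomorphy, boundedness and almost periodicity, and the coefficients
  depend continuously on the function through their values on the line \<open>Re s = 1\<close>.
\<close>

theorem ap_half_plane_complete:
  assumes u: "\<And>n. ap_half_plane (u n)"
    and Cauchy: "\<And>\<sigma> e. \<sigma> > 0 \<Longrightarrow> e > 0 \<Longrightarrow>
      \<exists>N. \<forall>m\<ge>N. \<forall>n\<ge>N. \<forall>s. Re s \<ge> \<sigma> \<longrightarrow> cmod (u m s - u n s) \<le> e"
  shows "\<exists>v. ap_half_plane v \<and> (\<forall>s. Re s \<le> 0 \<longrightarrow> v s = 0) \<and>
    (\<forall>\<sigma>>0. \<forall>e>0. \<exists>N. \<forall>n\<ge>N. \<forall>s. Re s \<ge> \<sigma> \<longrightarrow> cmod (u n s - v s) \<le> e) \<and>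
    (\<forall>x. (\<lambda>n. bohr_coeff (u n) x) \<longlonglongrightarrow> bohr_coeff v x)"
proof -
  have "convergent (\<lambda>n. u n s)" if s: "Re s > 0" for s
  proof -
    have "Cauchy (\<lambda>n. u n s)"
    proof (rule metric_CauchyI)
      fix e :: real assume e: "e > 0"
      obtain N where "\<forall>m\<ge>N. \<forall>n\<ge>N. \<forall>z. Re z \<ge> Re s \<longrightarrow> cmod (u m z - u n z) \<le> e / 2"
        using Cauchy[OF s half_gt_zero[OF e]] by blast
      then have "\<forall>m\<ge>N. \<forall>n\<ge>N. cmod (u m s - u n s) \<le> e / 2" by blast
      then have "\<forall>m\<ge>N. \<forall>n\<ge>N. dist (u m s) (u n s) < e" using e by (force simp: dist_norm)
      then show "\<exists>N. \<forall>m\<ge>N. \<forall>n\<ge>N. dist (u m s) (u n s) < e" by blast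
    qed
    then show ?thesis by (rule Cauchy_convergent)
  qed
  then have pw: "(\<lambda>n. u n s) \<longlonglongrightarrow> lim (\<lambda>n. u n s)" if "Re s > 0" for s
    using that convergent_LIMSEQ_iff by blast
  define v where "v = (\<lambda>s. if Re s > 0 then lim (\<lambda>n. u n s) else 0)"
  have v0: "v s = 0" if "Re s \<le> 0" for s using that by (simp add: v_def)
  have unif: "\<exists>N. \<forall>n\<ge>N. \<forall>s. Re s \<ge> \<sigma> \<longrightarrow> cmod (u n s - v s) \<le> e" if \<sigma>: "\<sigma> > 0" and e: "e > 0" for \<sigma> e
  proof -
    obtain N where N: "\<forall>m\<ge>N. \<forall>n\<ge>N. \<forall>z. Re z \<ge> \<sigma> \<longrightarrow> cmod (u m z - u n z) \<le> e"
      using Cauchy[OF \<sigma> e] by blast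
    have "cmod (u n s - v s) \<le> e" if n: "n \<ge> N" and s: "Re s \<ge> \<sigma>" for n s
    proof (rule tendsto_upperbound)
      have s0: "Re s > 0" using s \<sigma> by simp
      show "(\<lambda>m. cmod (u n s - u m s)) \<longlonglongrightarrow> cmod (u n s - v s)"
        using pw[OF s0] s0 by (intro tendsto_intros) (simp add: v_def)
      show "\<forall>\<^sub>F m in sequentially. cmod (u n s - u m s) \<le> e"
        using eventually_ge_at_top[of N] by eventually_elim (use N n s in blast)
    qed simp
    then show ?thesis by blast
  qed
  have hol: "v holomorphic_on {s. 0 < Re s}"
  proof (rule holomorphic_uniform_sequence)
    show "open {s. 0 < Re s}" by (rule open_halfspace_Re_gt)
    show "u n holomorphic_on {s. 0 < Re s}" for n using u[of n] by (simp add: ap_half_plane_def)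
    fix z :: complex assume "z \<in> {s. 0 < Re s}"
    then have z: "Re z > 0" by simp
    have sub: "cball z (Re z / 2) \<subseteq> {s. Re z / 2 \<le> Re s}"
    proof
      fix w assume "w \<in> cball z (Re z / 2)"
      then have "\<bar>Re (z - w)\<bar> \<le> Re z / 2"
        using abs_Re_le_cmod[of "z - w"] by (simp add: dist_norm)
      then have "Re z - Re w \<le> Re z / 2" by (simp only: minus_complex.sel abs_le_iff)
      then show "w \<in> {s. Re z / 2 \<le> Re s}" by simp
    qed
    have "uniform_limit (cball z (Re z / 2)) u v sequentially"
    proof (rule uniform_limitI)
      fix e :: real assume e: "e > 0"
      obtain N where N: "\<forall>n\<ge>N. \<forall>s. Re s \<ge> Re z / 2 \<longrightarrow> cmod (u n s - v s) \<le> e / 2"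
        using unif[OF half_gt_zero[OF z] half_gt_zero[OF e]] by blast
      show "\<forall>\<^sub>F n in sequentially. \<forall>x\<in>cball z (Re z / 2). dist (u n x) (v x) < e"
        using eventually_ge_at_top[of N]
      proof eventually_elim
        case (elim n)
        show ?case
        proof
          fix w assume "w \<in> cball z (Re z / 2)"
          then have "cmod (u n w - v w) \<le> e / 2" using N elim sub by blast
          then show "dist (u n w) (v w) < e" using e by (simp add: dist_norm)
        qed
      qed
    qed
    moreover have "cball z (Re z / 2) \<subseteq> {s. 0 < Re s}" using sub z by force
    ultimately show "\<exists>d>0. cball z d \<subseteq> {s. 0 < Re s} \<and> uniform_limit (cball z d) u v sequentially"
      using z by (intro exI[of _ "Re z / 2"]) simp
  qed
  have bdd: "bounded (v ` {s. \<sigma> < Re s})" if \<sigma>: "\<sigma> > 0" for \<sigma>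
  proof -
    obtain N where N: "\<forall>n\<ge>N. \<forall>s. Re s \<ge> \<sigma> \<longrightarrow> cmod (u n s - v s) \<le> 1"
      using unif[OF \<sigma> zero_less_one] by blast
    obtain M where M: "\<And>s. Re s \<ge> \<sigma> \<Longrightarrow> cmod (u N s) \<le> M" using ap_half_plane_bound[OF u \<sigma>] by blast
    have "cmod (v s) \<le> M + 1" if "Re s > \<sigma>" for s
    proof -
      have "cmod (u N s - v s) \<le> 1" "cmod (u N s) \<le> M" using N M that by auto
      moreover have "cmod (v s) \<le> cmod (u N s) + cmod (u N s - v s)" by norm
      ultimately show ?thesis by linarith
    qed
    then show ?thesis unfolding bounded_iff by (intro exI[of _ "M + 1"]) auto
  qed
  have ap: "uap (\<lambda>t. v (Complex \<sigma> t))" if \<sigma>: "\<sigma> > 0" for \<sigma>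
  proof (rule uap_uniform_limit)
    fix e :: real assume e: "e > 0"
    obtain N where N: "\<forall>n\<ge>N. \<forall>s. Re s \<ge> \<sigma> \<longrightarrow> cmod (u n s - v s) \<le> e"
      using unif[OF \<sigma> e] by blast
    have "uap (\<lambda>t. u N (Complex \<sigma> t))" using u \<sigma> by (simp add: ap_half_plane_def)
    moreover have "cmod (v (Complex \<sigma> t) - u N (Complex \<sigma> t)) \<le> e" for t
      using N by (simp add: norm_minus_commute)
    ultimately show "\<exists>h. uap h \<and> (\<forall>t. cmod (v (Complex \<sigma> t) - h t) \<le> e)"
      by (intro exI[of _ "\<lambda>t. u N (Complex \<sigma> t)"]) simp
  qed
  have v: "ap_half_plane v" unfolding ap_half_plane_def using hol bdd ap by blast
  have coeff: "(\<lambda>n. bohr_coeff (u n) x) \<longlonglongrightarrow> bohr_coeff v x" for x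
    unfolding LIMSEQ_def
  proof (intro allI impI)
    fix e :: real assume e: "e > 0"
    define d where "d = e / (2 * exp x)"
    have d: "d > 0" using e by (simp add: d_def)
    obtain N where N: "\<forall>n\<ge>N. \<forall>s. Re s \<ge> 1 \<longrightarrow> cmod (u n s - v s) \<le> d"
      using unif[OF zero_less_one d] by blast
    have "dist (bohr_coeff (u n) x) (bohr_coeff v x) < e" if n: "n \<ge> N" for n
    proof -
      have "cmod (bohr_coeff (\<lambda>s. u n s - v s) x) \<le> exp (1 * x) * d"
        by (rule bohr_coeff_bound[OF ap_half_plane_uminus_diff(1)[OF u v] zero_less_one]) (use N n in simp)
      also have "\<dots> < e" using e by (simp add: d_def)
      finally show ?thesis by (simp add: ap_half_plane_uminus_diff(2)[OF u v] dist_norm)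
    qed
    then show "\<exists>N. \<forall>n\<ge>N. dist (bohr_coeff (u n) x) (bohr_coeff v x) < e" by blast
  qed
  show ?thesis by (intro exI[of _ v] conjI allI impI v v0 unif coeff)
qed

section \<open>Riesz means of Dirichlet series\<close>

lemma cmod_diff_le_via:
  assumes "cmod (c - a) \<le> p" "cmod (c - b) \<le> q" shows "cmod (a - b) \<le> p + q"
  using assms norm_triangle_ineq4[of "c - b" "c - a"] by simp

definition dirichlet_poly :: "(nat \<Rightarrow> real) \<Rightarrow> nat set \<Rightarrow> (nat \<Rightarrow> complex) \<Rightarrow> complex \<Rightarrow> complex" where
  "dirichlet_poly lam I c s = (\<Sum>n\<in>I. c n * exp (- (of_real (lam n) * s)))"

lemma exp_line: "exp (- (of_real l * Complex \<sigma> t)) = of_real (exp (- l * \<sigma>)) * cis (- (l * t))"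
  by (simp add: exp_eq_polar exp_of_real)

lemma dirichlet_poly_line:
  "dirichlet_poly lam I c (Complex \<sigma> t) = trig_sum lam I (\<lambda>n. of_real (exp (- lam n * \<sigma>)) * c n) t"
  unfolding dirichlet_poly_def trig_sum_def exp_line by (simp add: mult_ac)

lemma ap_half_plane_dirichlet_poly:
  assumes "\<And>n. lam n \<ge> 0" shows "ap_half_plane (dirichlet_poly lam I c)"
  unfolding ap_half_plane_def
proof (intro conjI allI impI)
  show "dirichlet_poly lam I c holomorphic_on {s. 0 < Re s}"
    unfolding dirichlet_poly_def by (intro holomorphic_intros)
  show "uap (\<lambda>t. dirichlet_poly lam I c (Complex \<sigma> t))" for \<sigma>
    unfolding dirichlet_poly_line by (rule uap_trig_sum)
  fix e :: real assume e: "e > 0"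
  have "cmod (dirichlet_poly lam I c s) \<le> (\<Sum>n\<in>I. cmod (c n))" if "e < Re s" for s
    unfolding dirichlet_poly_def
  proof (rule sum_norm_le)
    fix n
    have "cmod (exp (- (of_real (lam n) * s))) \<le> 1"
      using assms[of n] that e by simp
    then show "cmod (c n * exp (- (of_real (lam n) * s))) \<le> cmod (c n)"
      unfolding norm_mult by (rule mult_left_le) simp
  qed
  then show "bounded (dirichlet_poly lam I c ` {s. e < Re s})"
    unfolding bounded_iff by blast
qed

lemma bohr_coeff_dirichlet_poly:
  assumes "\<And>n. lam n \<ge> 0"
  shows "bohr_coeff (dirichlet_poly lam I c) x = (\<Sum>n\<in>I. c n * (if x = lam n then 1 else 0))"
proof -
  have "bohr_coeff (dirichlet_poly lam I c) x =
      of_real (exp (1 * x)) * (\<Sum>n\<in>I. of_real (exp (- lam n * 1)) * c n * (if x = lam n then 1 else 0))"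
    unfolding bohr_coeff_eq_mean[OF ap_half_plane_dirichlet_poly[OF assms] zero_less_one]
      dirichlet_poly_line mean_trig_sum ..
  also have "\<dots> = (\<Sum>n\<in>I. c n * (if x = lam n then 1 else 0))"
    unfolding sum_distrib_left
    by (intro sum.cong refl) (simp add: exp_minus flip: of_real_mult mult.assoc)
  finally show ?thesis .
qed

definition riesz_poly :: "(nat \<Rightarrow> real) \<Rightarrow> (nat \<Rightarrow> complex) \<Rightarrow> real \<Rightarrow> complex \<Rightarrow> complex" where
  "riesz_poly lam a x = dirichlet_poly lam (riesz_index lam x) (\<lambda>n. of_real (1 - lam n / x) * a n)"

lemma riesz_poly_line:
  "riesz_poly lam a x (Complex \<sigma> t) =
    trig_sum lam (riesz_index lam x) (\<lambda>n. of_real (1 - lam n / x) * (of_real (exp (- lam n * \<sigma>)) * a n)) t"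
  unfolding riesz_poly_def dirichlet_poly_line by (simp only: mult.left_commute)

lemma frequency_nonneg: "frequency lam \<Longrightarrow> lam n \<ge> 0"
  by (simp add: frequency_def)

text \<open>
  Smoothing multiplies the coefficients of \<open>R\<^sub>x\<close> by \<open>1 - \<lambda>\<^sub>n / y\<close>, so the result differs from \<open>R\<^sub>y\<close> only by the
  factors \<open>1 - \<lambda>\<^sub>n / x\<close>, which tend to one.
\<close>

lemma fejer_conv_riesz_poly:
  assumes lam: "frequency lam" and y: "y > 0" and xy: "x \<ge> y"
  shows "cmod (fejer_conv (\<lambda>t. riesz_poly lam a x (Complex \<sigma> t)) y t - riesz_poly lam a y (Complex \<sigma> t))
     \<le> (\<Sum>n\<in>riesz_index lam y. cmod (of_real (exp (- lam n * \<sigma>)) * a n) * lam n) / x"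
proof -
  define b where "b = (\<lambda>n. of_real (exp (- lam n * \<sigma>)) * a n :: complex)"
  have sub: "riesz_index lam y \<subseteq> riesz_index lam x" using xy by (auto simp: riesz_index_def)
  have x: "x > 0" using xy y by simp
  have "fejer_conv (\<lambda>t. riesz_poly lam a x (Complex \<sigma> t)) y t =
      (\<Sum>n\<in>riesz_index lam x. of_real (max 0 (1 - \<bar>lam n\<bar> / y)) * (of_real (1 - lam n / x) * b n) * cis (- (lam n * t)))"
    unfolding riesz_poly_line fejer_conv_trig_sum[OF y] b_def by (simp add: trig_sum_def)
  also have "\<dots> = (\<Sum>n\<in>riesz_index lam y. of_real (max 0 (1 - \<bar>lam n\<bar> / y)) * (of_real (1 - lam n / x) * b n) * cis (- (lam n * t)))"
    by (rule sum.mono_neutral_right[OF finite_riesz_index[OF lam] sub])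
      (use y in \<open>auto simp: riesz_index_def max_def divide_simps\<close>)
  also have "\<dots> = (\<Sum>n\<in>riesz_index lam y. of_real (1 - lam n / y) * (of_real (1 - lam n / x) * b n) * cis (- (lam n * t)))"
    by (intro sum.cong refl) (use y frequency_nonneg[OF lam] in \<open>auto simp: riesz_index_def max_def divide_simps\<close>)
  finally have eq: "fejer_conv (\<lambda>t. riesz_poly lam a x (Complex \<sigma> t)) y t - riesz_poly lam a y (Complex \<sigma> t) =
      (\<Sum>n\<in>riesz_index lam y. of_real (1 - lam n / y) * (of_real (1 - lam n / x) * b n) * cis (- (lam n * t))
          - of_real (1 - lam n / y) * b n * cis (- (lam n * t)))"
    by (simp add: riesz_poly_line trig_sum_def b_def sum_subtractf)
  have b: "of_real (exp (- lam n * \<sigma>)) * a n = b n" for n by (simp add: b_def)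
  show ?thesis
    unfolding eq b sum_divide_distrib
  proof (rule sum_norm_le)
    fix n assume n: "n \<in> riesz_index lam y"
    have "of_real (1 - lam n / y) * (of_real (1 - lam n / x) * b n) * cis (- (lam n * t))
          - of_real (1 - lam n / y) * b n * cis (- (lam n * t)) =
        - (of_real (1 - lam n / y) * of_real (lam n / x) * b n * cis (- (lam n * t)))"
    proof -
      have "A * (B * w) * c - A * w * c = - (A * (1 - B) * w * c)" for A B w c :: complex
        by (simp add: algebra_simps)
      moreover have "1 - complex_of_real (1 - lam n / x) = of_real (lam n / x)" by simp
      ultimately show ?thesis by simp
    qed
    then have "cmod (of_real (1 - lam n / y) * (of_real (1 - lam n / x) * b n) * cis (- (lam n * t))
          - of_real (1 - lam n / y) * b n * cis (- (lam n * t))) = \<bar>1 - lam n / y\<bar> * (\<bar>lam n / x\<bar> * cmod (b n))"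
      by (simp only: norm_minus_cancel norm_mult norm_of_real norm_cis mult_1_right mult.assoc)
    also have "\<dots> \<le> 1 * (\<bar>lam n / x\<bar> * cmod (b n))"
      using n y frequency_nonneg[OF lam, of n]
      by (intro mult_right_mono) (auto simp: riesz_index_def abs_le_iff divide_simps)
    also have "\<dots> = cmod (b n) * lam n / x" using frequency_nonneg[OF lam, of n] x by simp
    finally show "cmod (of_real (1 - lam n / y) * (of_real (1 - lam n / x) * b n) * cis (- (lam n * t))
          - of_real (1 - lam n / y) * b n * cis (- (lam n * t))) \<le> cmod (b n) * lam n / x" .
  qed
qed

text \<open>
  By the common Lipschitz constant, smoothing with the kernel of any parameter \<open>y \<ge> y0\<close> moves every \<open>R\<^sub>x\<close> by at most \<open>e / 4\<close>. The smoothed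
  \<open>R\<^sub>x\<close> is close to \<open>R\<^sub>y\<close> for large \<open>x\<close>. Hence
  \<open>R\<^sub>y\<close> is within \<open>e / 2\<close> of \<open>R\<^sub>x\<close> for all
  large \<open>x\<close>, and two such \<open>R\<^sub>y\<close> are compared through one common
  \<open>x\<close>.
\<close>

lemma riesz_poly_Cauchy_on_line:
  assumes lam: "frequency lam" and \<sigma>: "\<sigma> > 0" and e: "e > 0"
    and bound: "\<And>x t. x > 0 \<Longrightarrow> cmod (riesz_poly lam a x (Complex (\<sigma> / 2) t)) \<le> B"
  shows "\<exists>y0>0. \<forall>y\<ge>y0. \<forall>y'\<ge>y0. \<forall>t. cmod (riesz_poly lam a y (Complex \<sigma> t) - riesz_poly lam a y' (Complex \<sigma> t)) \<le> e"
proof -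
  define R where "R = riesz_poly lam a"
  have hp: "ap_half_plane (R x)" for x
    unfolding R_def riesz_poly_def by (rule ap_half_plane_dirichlet_poly[OF frequency_nonneg[OF lam]])
  then have hol: "R x holomorphic_on {s. 0 < Re s}" for x by (simp add: ap_half_plane_def)
  have Rline: "uap (\<lambda>t. R x (Complex \<sigma> t))" for x using hp[of x] \<sigma> by (simp add: ap_half_plane_def)
  have s2: "\<sigma> / 2 > 0" using \<sigma> by simp
  have B: "cmod (R x s) \<le> B" if x: "x > 0" and s: "Re s \<ge> \<sigma> / 2" for x s
  proof -
    obtain M where M: "\<And>s. Re s \<ge> \<sigma> / 2 \<Longrightarrow> cmod (R x s) \<le> M" using ap_half_plane_bound[OF hp s2] by blast
    show ?thesis
      by (rule half_plane_maximum[OF hol s2 M _ s]) (use bound[OF x] in \<open>simp_all add: R_def\<close>)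
  qed
  have B0: "B \<ge> 0" using bound[of 1 0] norm_ge_zero order_trans zero_less_one by blast
  have lip: "cmod (R x (Complex \<sigma> t) - R x (Complex \<sigma> u)) \<le> (2 * B / \<sigma>) * \<bar>t - u\<bar>" if "x > 0" for x t u
    by (rule bounded_holomorphic_lipschitz_on_line[OF hol \<sigma> B[OF that]])
  \<comment> \<open>Within distance \<open>r\<close> the Lipschitz bound is \<open>e / 8\<close>; \<open>B + 1\<close> avoids division by zero.\<close>
  define r where "r = e * \<sigma> / (16 * (B + 1))"
  have r: "r > 0" using e \<sigma> B0 by (simp add: r_def)
  have mod: "cmod (R x (Complex \<sigma> (t - u)) - R x (Complex \<sigma> t)) \<le> e / 8" if "x > 0" "\<bar>u\<bar> < r" for x t u
  proof -
    have "cmod (R x (Complex \<sigma> (t - u)) - R x (Complex \<sigma> t)) \<le> (2 * B / \<sigma>) * \<bar>u\<bar>"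
      using lip[OF that(1), of "t - u" t] by simp
    also have "\<dots> \<le> (2 * (B + 1) / \<sigma>) * r"
      using that(2) B0 \<sigma> by (intro mult_mono divide_right_mono) auto
    also have "\<dots> = e / 8" using B0 \<sigma> by (simp add: r_def divide_simps)
    finally show ?thesis .
  qed
  define y0 where "y0 = max 1 (16 * B * fejer_tail r / e)"
  have y0: "y0 > 0" by (simp add: y0_def)
  have conv: "cmod (fejer_conv (\<lambda>t. R x (Complex \<sigma> t)) y t - R x (Complex \<sigma> t)) \<le> e / 4" if x: "x > 0" and y: "y \<ge> y0" for x y t
  proof -
    have y': "y > 0" "y \<ge> 16 * B * fejer_tail r / e" using y by (auto simp: y0_def)
    have "cmod (fejer_conv (\<lambda>t. R x (Complex \<sigma> t)) y t - R x (Complex \<sigma> t)) \<le> e / 8 + 2 * B * fejer_tail r / y"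
    proof (rule fejer_conv_close[OF uap_continuous[OF Rline] _ y'(1) r])
      show "cmod (R x (Complex \<sigma> t)) \<le> B" for t using B[OF x] \<sigma> by simp
      show "cmod (R x (Complex \<sigma> (t - u)) - R x (Complex \<sigma> t)) \<le> e / 8" if "\<bar>u\<bar> < r" for u
        by (rule mod[OF x that])
    qed
    moreover have "2 * B * fejer_tail r / y \<le> e / 8" using y' e by (simp add: field_simps)
    ultimately show ?thesis by simp
  qed
  have near: "\<exists>X. \<forall>x\<ge>X. \<forall>t. cmod (R y (Complex \<sigma> t) - R x (Complex \<sigma> t)) \<le> e / 2" if y: "y \<ge> y0" for y
  proof -
    define C where "C = (\<Sum>n\<in>riesz_index lam y. cmod (of_real (exp (- lam n * \<sigma>)) * a n) * lam n)"
    have ypos: "y > 0" using y y0 by simp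
    have "cmod (R y (Complex \<sigma> t) - R x (Complex \<sigma> t)) \<le> e / 2" if x: "x \<ge> max y (4 * C / e)" for x t
    proof -
      have x': "x \<ge> y" "x > 0" "x \<ge> 4 * C / e" using x ypos by auto
      have "cmod (fejer_conv (\<lambda>t. R x (Complex \<sigma> t)) y t - R y (Complex \<sigma> t)) \<le> C / x"
        unfolding R_def C_def by (rule fejer_conv_riesz_poly[OF lam ypos x'(1)])
      also have "C / x \<le> e / 4" using x' e by (simp add: field_simps)
      finally have "cmod (R y (Complex \<sigma> t) - R x (Complex \<sigma> t)) \<le> e / 4 + e / 4"
        using conv[OF x'(2) y] by (rule cmod_diff_le_via)
      then show ?thesis by simp
    qed
    then show ?thesis by blast
  qed
  have "cmod (R y (Complex \<sigma> t) - R y' (Complex \<sigma> t)) \<le> e" if yy: "y \<ge> y0" "y' \<ge> y0" for y y' t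
  proof -
    obtain X where X: "\<forall>x\<ge>X. \<forall>t. cmod (R y (Complex \<sigma> t) - R x (Complex \<sigma> t)) \<le> e / 2"
      using near[OF yy(1)] by blast
    obtain X' where X': "\<forall>x\<ge>X'. \<forall>t. cmod (R y' (Complex \<sigma> t) - R x (Complex \<sigma> t)) \<le> e / 2"
      using near[OF yy(2)] by blast
    have "cmod (R (max X X') (Complex \<sigma> t) - R y (Complex \<sigma> t)) \<le> e / 2"
      "cmod (R (max X X') (Complex \<sigma> t) - R y' (Complex \<sigma> t)) \<le> e / 2"
      using X[rule_format, of "max X X'" t] X'[rule_format, of "max X X'" t]
      by (simp_all only: norm_minus_commute[of "R (max X X') (Complex \<sigma> t)"] max.cobounded1 max.cobounded2)
    then have "cmod (R y (Complex \<sigma> t) - R y' (Complex \<sigma> t)) \<le> e / 2 + e / 2"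
      by (rule cmod_diff_le_via)
    then show ?thesis by simp
  qed
  with y0 show ?thesis unfolding R_def by blast
qed

text \<open>
  The Riesz means with integral parameters are uniformly Cauchy on every half-plane. Their limit
  has the coefficients \<open>a\<close>, because each factor \<open>1 - \<lambda>\<^sub>n / x\<close> tends to one.
\<close>

theorem H_inf_plus_of_bounded_riesz_means:
  assumes lam: "frequency lam"
    and bound: "\<And>\<sigma>. \<sigma> > 0 \<Longrightarrow> \<exists>B. \<forall>x>0. \<forall>t. cmod (riesz_poly lam a x (Complex \<sigma> t)) \<le> B"
  shows "\<exists>f\<in>H_inf_plus lam. \<forall>n. bohr_coeff f (lam n) = a n"
proof -
  define u where "u = (\<lambda>n. riesz_poly lam a (real (Suc n)))"
  have hp: "ap_half_plane (u n)" for n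
    unfolding u_def riesz_poly_def by (rule ap_half_plane_dirichlet_poly[OF frequency_nonneg[OF lam]])
  have Cauchy: "\<exists>N. \<forall>m\<ge>N. \<forall>n\<ge>N. \<forall>s. Re s \<ge> \<sigma> \<longrightarrow> cmod (u m s - u n s) \<le> e" if \<sigma>: "\<sigma> > 0" and e: "e > 0" for \<sigma> e
  proof -
    obtain B where "\<And>x t. x > 0 \<Longrightarrow> cmod (riesz_poly lam a x (Complex (\<sigma> / 2) t)) \<le> B"
      using bound[OF half_gt_zero[OF \<sigma>]] by blast
    from riesz_poly_Cauchy_on_line[OF lam \<sigma> e this] obtain y0 where
      y0: "\<forall>y\<ge>y0. \<forall>y'\<ge>y0. \<forall>t. cmod (riesz_poly lam a y (Complex \<sigma> t) - riesz_poly lam a y' (Complex \<sigma> t)) \<le> e"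
      by blast
    obtain N :: nat where N: "y0 \<le> real N" using real_arch_simple by blast
    have "cmod (u m s - u n s) \<le> e" if mn: "m \<ge> N" "n \<ge> N" and s: "Re s \<ge> \<sigma>" for m n s
    proof -
      have d: "ap_half_plane (\<lambda>s. u m s - u n s)" by (rule ap_half_plane_uminus_diff(1)[OF hp hp])
      obtain M where M: "\<And>s. Re s \<ge> \<sigma> \<Longrightarrow> cmod (u m s - u n s) \<le> M" using ap_half_plane_bound[OF d \<sigma>] by blast
      show ?thesis
      proof (rule half_plane_maximum[OF _ \<sigma> M _ s])
        show "(\<lambda>s. u m s - u n s) holomorphic_on {s. 0 < Re s}" using d by (simp add: ap_half_plane_def)
        have "real (Suc m) \<ge> y0" "real (Suc n) \<ge> y0" using N mn by auto
        then show "cmod (u m (Complex \<sigma> t) - u n (Complex \<sigma> t)) \<le> e" for t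
          unfolding u_def using y0 by blast
      qed
    qed
    then show ?thesis by blast
  qed
  from ap_half_plane_complete[of u, OF hp Cauchy] obtain f where f: "ap_half_plane f" "\<forall>s. Re s \<le> 0 \<longrightarrow> f s = 0"
    and lim': "\<forall>x. (\<lambda>n. bohr_coeff (u n) x) \<longlonglongrightarrow> bohr_coeff f x" by auto
  note lim = lim'[rule_format]
  have co: "bohr_coeff (u n) x = (\<Sum>k\<in>riesz_index lam (real (Suc n)).
      of_real (1 - lam k / real (Suc n)) * a k * (if x = lam k then 1 else 0))" for n x
    unfolding u_def riesz_poly_def by (rule bohr_coeff_dirichlet_poly[OF frequency_nonneg[OF lam]])
  have zero: "bohr_coeff f x = 0" if "x \<notin> range lam" for x
  proof -
    have "bohr_coeff (u n) x = 0" for n unfolding co using that by (intro sum.neutral) auto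
    then have "(\<lambda>n. bohr_coeff (u n) x) \<longlonglongrightarrow> 0" by simp
    from LIMSEQ_unique[OF lim this] show ?thesis .
  qed
  have val: "bohr_coeff f (lam m) = a m" for m
  proof (rule LIMSEQ_unique[OF lim])
    have cm: "bohr_coeff (u n) (lam m) = (if m \<in> riesz_index lam (real (Suc n)) then of_real (1 - lam m / real (Suc n)) * a m else 0)" for n
    proof -
      have "bohr_coeff (u n) (lam m) = (\<Sum>k\<in>riesz_index lam (real (Suc n)).
          if m = k then of_real (1 - lam k / real (Suc n)) * a k else 0)"
        unfolding co by (intro sum.cong refl) (simp add: frequency_inj[OF lam])
      then show ?thesis by (simp only: sum.delta'[OF finite_riesz_index[OF lam]])
    qed
    obtain N :: nat where N: "lam m \<le> real N" using real_arch_simple by blast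
    have "(\<lambda>n. lam m / real (Suc n)) \<longlonglongrightarrow> 0"
      using LIMSEQ_Suc[OF lim_const_over_n[of "lam m"]] by simp
    then have "(\<lambda>n. complex_of_real (1 - lam m / real (Suc n)) * a m) \<longlonglongrightarrow> complex_of_real (1 - 0) * a m"
      by (intro tendsto_intros)
    moreover have "\<forall>\<^sub>F n in sequentially. of_real (1 - lam m / real (Suc n)) * a m = bohr_coeff (u n) (lam m)"
      using eventually_ge_at_top[of N]
      by eventually_elim (use N in \<open>auto simp: cm riesz_index_def\<close>)
    ultimately show "(\<lambda>n. bohr_coeff (u n) (lam m)) \<longlonglongrightarrow> a m"
      using Lim_transform_eventually by fastforce
  qed
  have "f \<in> H_inf_plus lam" unfolding H_inf_plus_alt using f zero by blast
  with val show ?thesis by blast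
qed

text \<open>
  Fejer smoothing approximates a uniformly continuous function uniformly, and here it produces the
  Riesz means.
\<close>

theorem H_inf_plus_riesz_approximation:
  assumes lam: "frequency lam" and f: "f \<in> H_inf_plus lam" and \<sigma>: "\<sigma> > 0" and e: "e > 0"
  shows "\<exists>x0>0. \<forall>x\<ge>x0. \<forall>t. cmod (riesz_poly lam (\<lambda>n. bohr_coeff f (lam n)) x (Complex \<sigma> t) - f (Complex \<sigma> t)) \<le> e"
proof -
  define g where "g = (\<lambda>t. f (Complex \<sigma> t))"
  have hp: "ap_half_plane f" using f by (simp add: H_inf_plus_alt)
  have g: "uap g" using hp \<sigma> by (simp add: ap_half_plane_def g_def)
  have co: "mean (\<lambda>t. g t * cis (y * t)) = of_real (exp (- y * \<sigma>)) * bohr_coeff f y" for y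
    unfolding g_def bohr_coeff_eq_mean[OF hp \<sigma>]
    by (simp add: exp_minus mult.commute flip: of_real_mult mult.assoc)
  have spec: "mean (\<lambda>t. g t * cis (y * t)) = 0" if "y \<notin> range lam" for y
    using f that by (simp add: co H_inf_plus_alt)
  obtain x0 where x0: "x0 > 0" "\<And>x t. x \<ge> x0 \<Longrightarrow> cmod (fejer_conv g x t - g t) \<le> e"
    using fejer_conv_approx[OF g e] by blast
  have "fejer_conv g x t = riesz_poly lam (\<lambda>n. bohr_coeff f (lam n)) x (Complex \<sigma> t)" if "x > 0" for x t
    unfolding riesz_poly_line
    by (rule fejer_conv_eq_riesz_mean[OF g lam that spec]) (simp_all add: co)
  then have "cmod (riesz_poly lam (\<lambda>n. bohr_coeff f (lam n)) x (Complex \<sigma> t) - f (Complex \<sigma> t)) \<le> e" if "x \<ge> x0" for x t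
    using x0(2)[OF that, of t] that x0(1) by (simp add: g_def)
  with x0(1) show ?thesis by blast
qed

section \<open>The Frechet space of functions on the half-plane\<close>

text \<open>
  The supremum over the open half-plane is the one over its boundary line: the maximum principle
  gives one inequality and continuity the other.
\<close>

lemma H_inf_plus_norm_le_iff:
  assumes f: "ap_half_plane f"
  shows "H_inf_plus_norm k f \<le> B \<longleftrightarrow> (\<forall>t. cmod (f (Complex (1 / real (Suc k)) t)) \<le> B)"
proof -
  define \<sigma> where "\<sigma> = 1 / real (Suc k)"
  have \<sigma>: "\<sigma> > 0" by (simp add: \<sigma>_def)
  obtain M where M: "\<And>s. Re s \<ge> \<sigma> \<Longrightarrow> cmod (f s) \<le> M" using ap_half_plane_bound[OF f \<sigma>] by blast
  have hol: "f holomorphic_on {s. 0 < Re s}" using f by (simp add: ap_half_plane_def)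
  have ne: "{s. \<sigma> < Re s} \<noteq> {}" by (auto intro: exI[of _ "Complex (\<sigma> + 1) 0"])
  have bdd: "bdd_above ((\<lambda>s. cmod (f s)) ` {s. \<sigma> < Re s})"
    unfolding bdd_above_def by (intro exI[of _ M]) (auto intro: M)
  have "H_inf_plus_norm k f \<le> B \<longleftrightarrow> (\<forall>s\<in>{s. \<sigma> < Re s}. cmod (f s) \<le> B)"
    unfolding H_inf_plus_norm_def \<sigma>_def[symmetric] by (rule cSUP_le_iff[OF ne bdd])
  also have "\<dots> \<longleftrightarrow> (\<forall>t. cmod (f (Complex \<sigma> t)) \<le> B)"
  proof
    assume le: "\<forall>s\<in>{s. \<sigma> < Re s}. cmod (f s) \<le> B"
    show "\<forall>t. cmod (f (Complex \<sigma> t)) \<le> B"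
    proof
      fix t
      have "continuous_on {s. 0 < Re s} f" by (rule holomorphic_on_imp_continuous_on[OF hol])
      then have "isCont f (Complex \<sigma> t)"
        using \<sigma> by (subst (asm) continuous_on_eq_continuous_at) (auto simp: open_halfspace_Re_gt)
      moreover have "(\<lambda>n. Complex \<sigma> t + of_real (inverse (real (Suc n)))) \<longlonglongrightarrow> Complex \<sigma> t + of_real 0"
        by (intro tendsto_intros LIMSEQ_inverse_real_of_nat)
      then have "(\<lambda>n. Complex \<sigma> t + of_real (inverse (real (Suc n)))) \<longlonglongrightarrow> Complex \<sigma> t" by simp
      ultimately have "(\<lambda>n. f (Complex \<sigma> t + of_real (inverse (real (Suc n))))) \<longlonglongrightarrow> f (Complex \<sigma> t)"
        by (rule isCont_tendsto_compose)
      then have "(\<lambda>n. cmod (f (Complex \<sigma> t + of_real (inverse (real (Suc n)))))) \<longlonglongrightarrow> cmod (f (Complex \<sigma> t))"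
        by (rule tendsto_norm)
      then show "cmod (f (Complex \<sigma> t)) \<le> B"
        by (rule tendsto_upperbound) (use le in \<open>auto intro!: always_eventually\<close>)
    qed
  next
    assume "\<forall>t. cmod (f (Complex \<sigma> t)) \<le> B"
    then show "\<forall>s\<in>{s. \<sigma> < Re s}. cmod (f s) \<le> B"
      using half_plane_maximum[OF hol \<sigma> M, of B] by auto
  qed
  finally show ?thesis unfolding \<sigma>_def .
qed

lemma H_inf_plus_norm_nonneg: "ap_half_plane f \<Longrightarrow> H_inf_plus_norm k f \<ge> 0"
  using H_inf_plus_norm_le_iff[of f k "H_inf_plus_norm k f"] norm_ge_zero order_trans by blast

theorem frechet_space_H_inf_plus:
  "frechet_space (H_inf_plus lam) H_inf_plus_norm"
proof -
  have hp: "ap_half_plane f" if "f \<in> H_inf_plus lam" for f using that by (simp add: H_inf_plus_alt)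
  have add: "(\<lambda>s. f s + g s) \<in> H_inf_plus lam" if "f \<in> H_inf_plus lam" "g \<in> H_inf_plus lam" for f g
    using that by (simp add: H_inf_plus_alt ap_half_plane_add bohr_coeff_add)
  have cmult: "(\<lambda>s. c * f s) \<in> H_inf_plus lam" if "f \<in> H_inf_plus lam" for f c
    using that by (simp add: H_inf_plus_alt ap_half_plane_cmult bohr_coeff_cmult)
  have line: "cmod (f (Complex (1 / real (Suc k)) t)) \<le> H_inf_plus_norm k f" if "f \<in> H_inf_plus lam" for f k t
    using H_inf_plus_norm_le_iff[OF hp[OF that], of k] by blast
  have zero_hp: "ap_half_plane (\<lambda>s. 0)"
    by (auto simp: ap_half_plane_def uap_const bounded_iff intro: exI[of _ 0])
  have zero: "(\<lambda>s. 0) \<in> H_inf_plus lam"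
    using bohr_coeff_cmult[OF zero_hp, of 0] by (simp add: H_inf_plus_alt zero_hp)
  have sub: "function_subspace (H_inf_plus lam)"
    unfolding function_subspace_def using zero add cmult by blast
  have semi: "seminorm_on (H_inf_plus lam) (H_inf_plus_norm k)" for k
    unfolding seminorm_on_def
  proof (intro conjI ballI allI)
    fix f assume f: "f \<in> H_inf_plus lam"
    show "0 \<le> H_inf_plus_norm k f" by (rule H_inf_plus_norm_nonneg[OF hp[OF f]])
    fix g assume g: "g \<in> H_inf_plus lam"
    show "H_inf_plus_norm k (\<lambda>s. f s + g s) \<le> H_inf_plus_norm k f + H_inf_plus_norm k g"
      unfolding H_inf_plus_norm_le_iff[OF hp[OF add[OF f g]]]
      by (intro allI norm_triangle_mono line f g)
  next
    fix c f assume f: "f \<in> H_inf_plus lam"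
    have le: "H_inf_plus_norm k (\<lambda>s. c * h s) \<le> cmod c * H_inf_plus_norm k h" if h: "h \<in> H_inf_plus lam" for c h
      unfolding H_inf_plus_norm_le_iff[OF hp[OF cmult[OF h]]]
      unfolding norm_mult by (intro allI mult_left_mono line h norm_ge_zero)
    show "H_inf_plus_norm k (\<lambda>s. c * f s) = cmod c * H_inf_plus_norm k f"
    proof (cases "c = 0")
      case True
      then have "H_inf_plus_norm k (\<lambda>s. c * f s) \<le> 0" using le[OF f, of c] by simp
      then show ?thesis using H_inf_plus_norm_nonneg[OF hp[OF cmult[OF f]], of k c] True by simp
    next
      case False
      have "H_inf_plus_norm k (\<lambda>s. inverse c * (c * f s)) \<le> cmod (inverse c) * H_inf_plus_norm k (\<lambda>s. c * f s)"
        by (rule le[OF cmult[OF f]])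
      also have "(\<lambda>s. inverse c * (c * f s)) = f" using False by (simp add: fun_eq_iff flip: mult.assoc)
      finally have "cmod c * H_inf_plus_norm k f \<le> cmod c * (cmod (inverse c) * H_inf_plus_norm k (\<lambda>s. c * f s))"
        by (rule mult_left_mono) simp
      also have "\<dots> = H_inf_plus_norm k (\<lambda>s. c * f s)" using False by (simp add: norm_inverse)
      finally have "cmod c * H_inf_plus_norm k f \<le> H_inf_plus_norm k (\<lambda>s. c * f s)" .
      with le[OF f, of c] show ?thesis by simp
    qed
  qed
  have pointwise: "cmod (f s) \<le> H_inf_plus_norm k f" if f: "f \<in> H_inf_plus lam" and s: "Re s \<ge> 1 / real (Suc k)" for f k s
  proof -
    obtain M where M: "\<And>s. Re s \<ge> 1 / real (Suc k) \<Longrightarrow> cmod (f s) \<le> M"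
      using ap_half_plane_bound[OF hp[OF f], of "1 / real (Suc k)"] by auto
    show ?thesis
    proof (rule half_plane_maximum[where h = f and a = 0 and \<sigma> = "1 / real (Suc k)" and M = M])
      show "f holomorphic_on {s. 0 < Re s}" using hp[OF f] by (simp add: ap_half_plane_def)
      show "cmod (f (Complex (1 / real (Suc k)) t)) \<le> H_inf_plus_norm k f" for t by (rule line[OF f])
    qed (use M s in simp_all)
  qed
  have deep: "\<exists>k. 1 / real (Suc k) \<le> \<sigma>" if "\<sigma> > 0" for \<sigma> :: real
    using reals_Archimedean[OF that] by (auto simp: inverse_eq_divide intro: less_imp_le)
  have sep: "f = (\<lambda>_. 0)" if f: "f \<in> H_inf_plus lam" and n: "\<forall>k. H_inf_plus_norm k f = 0" for f
  proof
    fix s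
    show "f s = 0"
    proof (cases "Re s > 0")
      case True
      then obtain k where "1 / real (Suc k) \<le> Re s" using deep by blast
      then have "cmod (f s) \<le> 0" using pointwise[OF f, of k s] n by simp
      then show ?thesis by simp
    next
      case False
      then show ?thesis using f by (simp add: H_inf_plus_alt)
    qed
  qed
  have compl: "\<exists>v\<in>H_inf_plus lam. \<forall>k. (\<lambda>n. H_inf_plus_norm k (\<lambda>i. u n i - v i)) \<longlonglongrightarrow> 0"
    if u: "\<forall>n. u n \<in> H_inf_plus lam"
      and C: "\<forall>k. \<forall>e>0. \<exists>N. \<forall>m\<ge>N. \<forall>n\<ge>N. H_inf_plus_norm k (\<lambda>i. u m i - u n i) < e" for u
  proof -
    have hpu: "ap_half_plane (u n)" for n using u hp by blast
    have diff: "(\<lambda>s. u m s - u n s) \<in> H_inf_plus lam" for m n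
      using add[OF _ cmult[of "u n" "-1"], of "u m"] u by simp
    have Cauchy: "\<exists>N. \<forall>m\<ge>N. \<forall>n\<ge>N. \<forall>s. Re s \<ge> \<sigma> \<longrightarrow> cmod (u m s - u n s) \<le> e" if \<sigma>: "\<sigma> > 0" and e: "e > 0" for \<sigma> e
    proof -
      obtain k where k: "1 / real (Suc k) \<le> \<sigma>" using deep[OF \<sigma>] by blast
      obtain N where N: "\<forall>m\<ge>N. \<forall>n\<ge>N. H_inf_plus_norm k (\<lambda>i. u m i - u n i) < e" using C e by blast
      have "cmod (u m s - u n s) \<le> e" if mn: "m \<ge> N" "n \<ge> N" and s: "Re s \<ge> \<sigma>" for m n s
      proof -
        have "cmod (u m s - u n s) \<le> H_inf_plus_norm k (\<lambda>i. u m i - u n i)"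
          by (rule pointwise[OF diff]) (use k s in simp)
        also have "\<dots> \<le> e" using N mn by (meson less_imp_le)
        finally show ?thesis .
      qed
      then show ?thesis by blast
    qed
    from ap_half_plane_complete[of u, OF hpu Cauchy] obtain v where v: "ap_half_plane v" "\<forall>s. Re s \<le> 0 \<longrightarrow> v s = 0"
      and unif': "\<forall>\<sigma>>0. \<forall>e>0. \<exists>N. \<forall>n\<ge>N. \<forall>s. Re s \<ge> \<sigma> \<longrightarrow> cmod (u n s - v s) \<le> e"
      and lim': "\<forall>x. (\<lambda>n. bohr_coeff (u n) x) \<longlonglongrightarrow> bohr_coeff v x"
      by blast
    note lim = lim'[rule_format]
    have "bohr_coeff v x = 0" if x: "x \<notin> range lam" for x
    proof -
      have "bohr_coeff (u n) x = 0" for n using u x by (simp add: H_inf_plus_alt)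
      then have "(\<lambda>n. bohr_coeff (u n) x) \<longlonglongrightarrow> 0" by simp
      from LIMSEQ_unique[OF lim this] show ?thesis .
    qed
    then have vX: "v \<in> H_inf_plus lam" unfolding H_inf_plus_alt using v by blast
    have "(\<lambda>n. H_inf_plus_norm k (\<lambda>i. u n i - v i)) \<longlonglongrightarrow> 0" for k
      unfolding LIMSEQ_def
    proof (intro allI impI)
      fix e :: real assume e: "e > 0"
      have k0: "1 / real (Suc k) > 0" by simp
      obtain N where N: "\<forall>n\<ge>N. \<forall>s. Re s \<ge> 1 / real (Suc k) \<longrightarrow> cmod (u n s - v s) \<le> e / 2"
        using unif'[rule_format, OF k0 half_gt_zero[OF e]] by blast
      have "dist (H_inf_plus_norm k (\<lambda>i. u n i - v i)) 0 < e" if n: "n \<ge> N" for n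
      proof -
        have d: "ap_half_plane (\<lambda>s. u n s - v s)" by (rule ap_half_plane_uminus_diff(1)[OF hpu v(1)])
        have "H_inf_plus_norm k (\<lambda>i. u n i - v i) \<le> e / 2"
          unfolding H_inf_plus_norm_le_iff[OF d] using N n by simp
        then show ?thesis using H_inf_plus_norm_nonneg[OF d, of k] e by (simp add: dist_real_def)
      qed
      then show "\<exists>N. \<forall>n\<ge>N. dist (H_inf_plus_norm k (\<lambda>i. u n i - v i)) 0 < e" by blast
    qed
    with vX show ?thesis by blast
  qed
  show ?thesis
    unfolding frechet_space_def using sub semi sep compl by blast
qed

section \<open>Compact groups with a dense one-parameter subgroup\<close>

text \<open>
  Joint measurability of a function that is continuous in the real variable, by sampling that
  variable at the points \<open>\<lfloor>t * n\<rfloor> / n\<close>. On a group without a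
  countable base the Borel sets of a product may exceed the product of the Borel algebras, so
  joint continuity would not be enough.
\<close>

lemma caratheodory_measurable:
  fixes k :: "real \<Rightarrow> 'z \<Rightarrow> complex"
  assumes meas: "\<And>t. k t \<in> borel_measurable M" and cont: "\<And>z. continuous_on UNIV (\<lambda>t. k t z)"
  shows "(\<lambda>(z, t). k t z) \<in> borel_measurable (M \<Otimes>\<^sub>M lborel)"
proof (rule borel_measurable_LIMSEQ_metric)
  fix n :: nat
  define N where "N = real (Suc n)"
  have "(\<lambda>p. k (real_of_int \<lfloor>snd p * N\<rfloor> / N) (fst p)) \<in> borel_measurable (M \<Otimes>\<^sub>M lborel)"
  proof (rule measurable_compose_countable[where f = "\<lambda>(i::int) p. k (real_of_int i / N) (fst p)" and g = "\<lambda>p. \<lfloor>snd p * N\<rfloor>"])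
    show "(\<lambda>p. k (real_of_int i / N) (fst p)) \<in> borel_measurable (M \<Otimes>\<^sub>M lborel)" for i
      by (rule measurable_compose[OF measurable_fst meas])
    show "(\<lambda>p. \<lfloor>snd p * N\<rfloor>) \<in> M \<Otimes>\<^sub>M lborel \<rightarrow>\<^sub>M count_space UNIV"
      by measurable
  qed
  then show "(\<lambda>p. k (real_of_int \<lfloor>snd p * real (Suc n)\<rfloor> / real (Suc n)) (fst p)) \<in> borel_measurable (M \<Otimes>\<^sub>M lborel)"
    by (simp only: N_def)
next
  fix p :: "'z \<times> real"
  obtain z t where p: "p = (z, t)" by (cases p)
  have "(\<lambda>n. real_of_int \<lfloor>t * real (Suc n)\<rfloor> / real (Suc n)) \<longlonglongrightarrow> t"
  proof (rule tendsto_sandwich)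
    show "\<forall>\<^sub>F n in sequentially. t - inverse (real (Suc n)) \<le> real_of_int \<lfloor>t * real (Suc n)\<rfloor> / real (Suc n)"
    proof (rule always_eventually, rule allI)
      fix n
      have "t * real (Suc n) - 1 \<le> real_of_int \<lfloor>t * real (Suc n)\<rfloor>" by linarith
      then have "(t * real (Suc n) - 1) / real (Suc n) \<le> real_of_int \<lfloor>t * real (Suc n)\<rfloor> / real (Suc n)"
        by (rule divide_right_mono) simp
      then show "t - inverse (real (Suc n)) \<le> real_of_int \<lfloor>t * real (Suc n)\<rfloor> / real (Suc n)"
        by (simp add: diff_divide_distrib inverse_eq_divide del: of_nat_Suc)
    qed
    show "\<forall>\<^sub>F n in sequentially. real_of_int \<lfloor>t * real (Suc n)\<rfloor> / real (Suc n) \<le> t"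
    proof (rule always_eventually, rule allI)
      fix n
      have "real_of_int \<lfloor>t * real (Suc n)\<rfloor> \<le> t * real (Suc n)" by linarith
      then show "real_of_int \<lfloor>t * real (Suc n)\<rfloor> / real (Suc n) \<le> t"
        by (simp add: divide_le_eq del: of_nat_Suc)
    qed
    show "(\<lambda>n. t - inverse (real (Suc n))) \<longlonglongrightarrow> t"
      using tendsto_diff[OF tendsto_const[of t] LIMSEQ_inverse_real_of_nat] by simp
  qed (rule tendsto_const)
  moreover have "isCont (\<lambda>t. k t z) t" using cont[of z] by (simp add: continuous_on_eq_continuous_at)
  ultimately have "(\<lambda>n. k (real_of_int \<lfloor>t * real (Suc n)\<rfloor> / real (Suc n)) z) \<longlonglongrightarrow> k t z"
    by (rule isCont_tendsto_compose[rotated])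
  then show "(\<lambda>n. k (real_of_int \<lfloor>snd p * real (Suc n)\<rfloor> / real (Suc n)) (fst p)) \<longlonglongrightarrow> (case p of (z, t) \<Rightarrow> k t z)"
    by (simp add: p)
qed

lemma norm_integral_le:
  fixes f :: "'z \<Rightarrow> complex"
  assumes "integrable M f" "integrable M g" "\<And>x. cmod (f x) \<le> g x"
  shows "cmod (LINT x|M. f x) \<le> (LINT x|M. g x)"
  using integral_norm_bound[of M f] integral_mono[OF integrable_norm[OF assms(1)] assms(2)] assms(3)
  by (meson order_trans)

lemma mean_norm_le:
  assumes f: "uap f" and g: "uap g" and le: "\<And>t. cmod (f t) \<le> Re (g t)"
  shows "cmod (mean f) \<le> Re (mean g)"
proof (rule tendsto_le[OF trivial_limit_at_top_linorder])
  show "((\<lambda>T. cmod ((1 / (2 * complex_of_real T)) * integral {-T..T} f)) \<longlongrightarrow> cmod (mean f)) at_top"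
    by (rule tendsto_norm[OF uap_has_mean_mean[OF f, unfolded has_mean_def]])
  show "((\<lambda>T. Re ((1 / (2 * complex_of_real T)) * integral {-T..T} g)) \<longlongrightarrow> Re (mean g)) at_top"
    by (rule tendsto_Re[OF uap_has_mean_mean[OF g, unfolded has_mean_def]])
  show "\<forall>\<^sub>F T in at_top. cmod ((1 / (2 * complex_of_real T)) * integral {-T..T} f)
      \<le> Re ((1 / (2 * complex_of_real T)) * integral {-T..T} g)"
    using eventually_gt_at_top[of 0]
  proof eventually_elim
    case (elim T)
    have ig: "g integrable_on {-T..T}" and cf: "continuous_on {-T..T} f" and cg: "continuous_on {-T..T} g"
      by (auto intro!: integrable_continuous_interval continuous_on_subset[OF uap_continuous[OF f]]
          continuous_on_subset[OF uap_continuous[OF g]])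
    have "cmod (integral {-T..T} f) \<le> integral {-T..T} (\<lambda>t. Re (g t))"
      by (rule Henstock_Kurzweil_Integration.integral_norm_bound_integral)
        (auto intro!: integrable_continuous_interval cf continuous_intros cg le)
    also have "\<dots> = Re (integral {-T..T} g)"
      using integral_linear[OF ig bounded_linear_Re] by (simp add: o_def)
    finally have le': "cmod (integral {-T..T} f) \<le> Re (integral {-T..T} g)" .
    have eq: "(1 / (2 * complex_of_real T)) * w = of_real (1 / (2 * T)) * w" for w by simp
    have re: "Re (complex_of_real r * w) = r * Re w" for r w by simp
    show ?case unfolding eq norm_mult norm_of_real re
      using elim le' by (simp add: divide_right_mono)
  qed
qed

locale dirichlet_haar =
  fixes lam :: "nat \<Rightarrow> real"
    and \<beta> :: "real \<Rightarrow> 'g::{topological_ab_group_add,t2_space}"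
    and \<mu> :: "'g measure"
  assumes freq: "frequency lam" and dgroup: "dirichlet_group lam \<beta>" and haar: "haar_measure \<mu>"
begin

lemma compact_group: "compact (UNIV :: 'g set)"
  and beta_continuous: "continuous_on UNIV \<beta>"
  and beta_add: "\<beta> (s + t) = \<beta> s + \<beta> t"
  and beta_dense: "closure (range \<beta>) = UNIV"
  and beta_character: "\<exists>h. group_character h \<and> (\<forall>t. h (\<beta> t) = exp (- \<i> * complex_of_real (lam n * t)))"
  using dgroup by (auto simp: dirichlet_group_def)

lemma beta_zero: "\<beta> 0 = 0"
  using beta_add[of 0 0] by simp

lemma sets_mu[measurable_cong, simp]: "sets \<mu> = sets borel"
  and emeasure_UNIV: "emeasure \<mu> UNIV = 1"
  and distr_translate: "distr \<mu> borel (\<lambda>x. a + x) = \<mu>"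
  and outer_regular: "A \<in> sets borel \<Longrightarrow> emeasure \<mu> A = (INF U\<in>{U. open U \<and> A \<subseteq> U}. emeasure \<mu> U)"
  and inner_regular: "open U \<Longrightarrow> emeasure \<mu> U = (SUP K\<in>{K. compact K \<and> K \<subseteq> U}. emeasure \<mu> K)"
  using haar by (auto simp: haar_measure_def)

lemma space_mu[simp]: "space \<mu> = UNIV"
  using sets_eq_imp_space_eq[OF sets_mu] by simp

sublocale prob_space \<mu>
  by (rule prob_spaceI) (simp add: emeasure_UNIV)

lemma borel_mu: "borel_measurable \<mu> = borel_measurable borel"
  by (rule measurable_cong_sets) simp_all

lemma continuous_measurable: "continuous_on UNIV F \<Longrightarrow> F \<in> borel_measurable \<mu>"
  for F :: "'g \<Rightarrow> 'b::topological_space"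
  unfolding borel_mu by (rule borel_measurable_continuous_onI)

lemma dense_le:
  fixes F :: "'g \<Rightarrow> real"
  assumes "continuous_on UNIV F" "\<And>t. F (\<beta> t) \<le> B"
  shows "F x \<le> B"
proof -
  have "closed {x. F x \<le> B}"
    using continuous_closed_preimage[OF assms(1) closed_UNIV closed_atMost, of B] by (simp add: vimage_def)
  then have "closure (range \<beta>) \<subseteq> {x. F x \<le> B}"
    using assms(2) by (intro closure_minimal) auto
  then show ?thesis using beta_dense by auto
qed

lemma dense_eq:
  fixes F H :: "'g \<Rightarrow> complex"
  assumes "continuous_on UNIV F" "continuous_on UNIV H" "\<And>t. F (\<beta> t) = H (\<beta> t)"
  shows "F x = H x"
proof -
  have "cmod (F x - H x) \<le> 0"
    by (rule dense_le[where F = "\<lambda>x. cmod (F x - H x)"]) (auto intro!: continuous_intros assms)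
  then show ?thesis by simp
qed

lemma continuous_translate:
  assumes "continuous_on UNIV F" shows "continuous_on UNIV (\<lambda>x::'g. F (x + w))"
  by (rule continuous_on_compose2[OF assms]) (auto intro!: continuous_intros)

lemma continuous_reflect:
  assumes "continuous_on UNIV F" shows "continuous_on UNIV (\<lambda>x::'g. F (w - x))"
  by (rule continuous_on_compose2[OF assms]) (auto intro!: continuous_intros)

text \<open>
  Uniform continuity, in terms of neighbourhoods of zero, from compactness by the tube lemma.
\<close>

lemma group_modulus:
  fixes F :: "'g \<Rightarrow> complex"
  assumes "continuous_on UNIV F" "e > 0"
  shows "\<exists>U. open U \<and> 0 \<in> U \<and> (\<forall>u\<in>U. \<forall>x. cmod (F (u + x) - F x) \<le> e)"
proof -
  have "continuous_on (UNIV \<times> UNIV) (\<lambda>(u, x). F (u + x))"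
    unfolding case_prod_unfold
    by (rule continuous_on_compose2[OF assms(1)]) (auto intro!: continuous_intros)
  then obtain U where "0 \<in> U" "open U"
    "\<forall>u\<in>U \<inter> UNIV. \<forall>x\<in>UNIV. dist ((\<lambda>(u, x). F (u + x)) (u, x)) ((\<lambda>(u, x). F (u + x)) (0, x)) \<le> e"
    by (rule continuous_on_prod_compactE[OF _ compact_group UNIV_I assms(2)])
  then show ?thesis by (intro exI[of _ U]) (simp add: dist_norm)
qed

lemma open_translate:
  assumes "open (U :: 'g set)" shows "open {x. x - c \<in> U}"
  using continuous_open_preimage[OF _ open_UNIV assms, of "\<lambda>x. x - c"]
  by (simp add: vimage_def continuous_intros)

lemma continuous_of_modulus:
  fixes F :: "'g \<Rightarrow> complex"
  assumes "\<And>e. e > 0 \<Longrightarrow> \<exists>U. open U \<and> 0 \<in> U \<and> (\<forall>u\<in>U. \<forall>x. cmod (F (u + x) - F x) \<le> e)"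
  shows "continuous_on UNIV F"
proof -
  have "(F \<longlongrightarrow> F x) (at x)" for x
  proof (rule tendstoI)
    fix e :: real assume "e > 0"
    then obtain U where U: "open U" "0 \<in> U" "\<forall>u\<in>U. \<forall>x. cmod (F (u + x) - F x) \<le> e / 2"
      using assms[of "e / 2"] by auto
    have "dist (F y) (F x) < e" if "y \<in> {y. y - x \<in> U}" for y
      using U(3)[rule_format, of "y - x" x] that \<open>e > 0\<close> by (simp add: dist_norm)
    then show "\<forall>\<^sub>F y in at x. dist (F y) (F x) < e"
      unfolding eventually_at_topological
      using open_translate[OF U(1), of x] U(2) by (intro exI[of _ "{y. y - x \<in> U}"]) simp
  qed
  then show ?thesis by (simp add: continuous_on_eq_continuous_at isCont_def)
qed

text \<open>
  Finitely many translates of a neighbourhood of zero cover the group; those that meet the orbit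
  provide a finite net of translates.
\<close>

lemma uap_restrict:
  fixes F :: "'g \<Rightarrow> complex"
  assumes F: "continuous_on UNIV F" shows "uap (\<lambda>t. F (\<beta> t))"
proof (rule precompact_imp_uap)
  show "continuous_on UNIV (\<lambda>t. F (\<beta> t))"
    by (rule continuous_on_compose2[OF F beta_continuous]) auto
  show "precompact_translates (\<lambda>t. F (\<beta> t))"
    unfolding precompact_translates_def
  proof (intro allI impI)
    fix e :: real assume "e > 0"
    then obtain U where U: "open U" "0 \<in> U" "\<And>u x. u \<in> U \<Longrightarrow> cmod (F (u + x) - F x) \<le> e / 2"
      using group_modulus[OF F, of "e / 2"] by auto
    have "UNIV \<subseteq> (\<Union>c. {x. x - c \<in> U})"
    proof
      fix x :: 'g
      have "x - x \<in> U" using U(2) by simp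
      then show "x \<in> (\<Union>c. {x. x - c \<in> U})" by blast
    qed
    then obtain I where I: "finite I" "UNIV \<subseteq> (\<Union>c\<in>I. {x. x - c \<in> U})"
      using compactE_image[OF compact_group, of UNIV "\<lambda>c. {x. x - c \<in> U}"] open_translate[OF U(1)] by metis
    then have "\<forall>a. \<exists>c. c \<in> I \<and> \<beta> a - c \<in> U" by auto
    then obtain p where p: "\<And>a. p a \<in> I" "\<And>a. \<beta> a - p a \<in> U" unfolding choice_iff by blast
    define r where "r = (\<lambda>c. SOME a. p a = c)"
    have r: "p (r (p a)) = p a" for a unfolding r_def by (rule someI[of "\<lambda>b. p b = p a"]) simp
    have near: "cmod (F (\<beta> (x + a)) - F (\<beta> x + p a)) \<le> e / 2" for x a
    proof -
      have eq: "\<beta> (x + a) = (\<beta> a - p a) + (\<beta> x + p a)" by (simp add: beta_add)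
      show ?thesis unfolding eq by (rule U(3)[OF p(2)])
    qed
    have "\<exists>b\<in>r ` I. \<forall>x. cmod (F (\<beta> (x + a)) - F (\<beta> (x + b))) \<le> e" for a
    proof (rule bexI[of _ "r (p a)"], rule allI)
      fix x
      have "cmod (F (\<beta> x + p a) - F (\<beta> (x + a))) \<le> e / 2"
        "cmod (F (\<beta> x + p a) - F (\<beta> (x + r (p a)))) \<le> e / 2"
        using near[of x a] near[of x "r (p a)"] r[of a] by (simp_all add: norm_minus_commute)
      from cmod_diff_le_via[OF this] show "cmod (F (\<beta> (x + a)) - F (\<beta> (x + r (p a)))) \<le> e" by simp
    qed (use p(1) in simp)
    then show "\<exists>A. finite A \<and> (\<forall>a. \<exists>b\<in>A. \<forall>x. cmod (F (\<beta> (x + a)) - F (\<beta> (x + b))) \<le> e)"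
      using I(1) by (intro exI[of _ "r ` I"]) simp
  qed
qed

lemma uap_orbit:
  fixes F :: "'g \<Rightarrow> complex"
  assumes "continuous_on UNIV F" shows "uap (\<lambda>t. F (\<beta> t + w))"
  using uap_restrict[OF continuous_translate[OF assms]] .

text \<open>
  The character of the group extending \<open>t \<mapsto> exp (- \<i> y t)\<close>, for an
  arbitrary real \<open>y\<close>.
\<close>

definition line_character :: "real \<Rightarrow> ('g \<Rightarrow> complex) \<Rightarrow> bool" where
  "line_character y \<psi> \<longleftrightarrow> group_character \<psi> \<and> (\<forall>t. \<psi> (\<beta> t) = cis (- (y * t)))"

lemma exp_minus_i: "exp (- \<i> * complex_of_real x) = cis (- x)"
  by (simp add: cis_conv_exp)

lemma line_character_unique: "line_character y \<psi> \<Longrightarrow> line_character y \<psi>' \<Longrightarrow> \<psi> = \<psi>'"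
proof
  fix x
  assume a: "line_character y \<psi>" "line_character y \<psi>'"
  show "\<psi> x = \<psi>' x"
    by (rule dense_eq[of \<psi> \<psi>']) (use a in \<open>simp_all add: line_character_def group_character_def\<close>)
qed

lemma freq_character_line: "line_character (lam n) (freq_character \<beta> (lam n))"
proof -
  obtain h where h: "line_character (lam n) h"
    using beta_character[of n] unfolding line_character_def exp_minus_i by blast
  have "freq_character \<beta> (lam n) = h"
    unfolding freq_character_def exp_minus_i line_character_def[symmetric]
  proof (rule the_equality)
    show "line_character (lam n) h" by (rule h)
    show "h' = h" if "line_character (lam n) h'" for h' by (rule line_character_unique[OF that h])
  qed
  with h show ?thesis by simp
qed

lemma line_character_inj: "line_character y \<psi> \<Longrightarrow> line_character y' \<psi> \<Longrightarrow> y = y'"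
proof (rule ccontr)
  assume a: "line_character y \<psi>" "line_character y' \<psi>" and "y \<noteq> y'"
  have "cis (- (y * t)) = cis (- (y' * t))" for t using a by (simp add: line_character_def)
  then have "mean (\<lambda>t. cis (- (y' * t)) * cis (y * t)) = mean (\<lambda>t. cis (- (y * t)) * cis (y * t))" by simp
  then show False using \<open>y \<noteq> y'\<close> by (simp only: mean_cis_mult_cis) simp
qed

lemma line_character_not_freq:
  "line_character y \<psi> \<Longrightarrow> y \<notin> range lam \<Longrightarrow> \<psi> \<notin> range (\<lambda>n. freq_character \<beta> (lam n))"
  using line_character_inj freq_character_line by blast

lemma character_zero: "group_character h \<Longrightarrow> h 0 = 1"
proof -
  assume h: "group_character h"
  then have "h 0 * h 0 = h 0 * 1" "h 0 \<noteq> 0" unfolding group_character_def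
    by (metis add_0 mult.right_neutral, metis norm_zero zero_neq_one)
  then show "h 0 = 1" by simp
qed

lemma character_minus: "group_character h \<Longrightarrow> h (- x) = cnj (h x)"
proof -
  assume h: "group_character h"
  have "h (- x) * h x = 1"
    using h character_zero[OF h] unfolding group_character_def by (metis left_minus)
  moreover have "h x * cnj (h x) = 1"
    using h by (simp add: group_character_def flip: complex_norm_square)
  ultimately show "h (- x) = cnj (h x)"
    by (metis mult.assoc mult.commute mult.right_neutral)
qed

text \<open>
  The function \<open>H\<close> is continuous and satisfies \<open>H (\<beta> s + w) = exp (- \<i> y s) * H w\<close>. By density of the subgroup it either vanishes identically or, divided by
  \<open>H 0\<close>, is multiplicative of modulus one. So characters arise from mean values
  exactly where they are needed.
\<close>

lemma twisted_mean:
  fixes \<phi> :: "'g \<Rightarrow> complex" and y :: real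
  assumes \<phi>: "continuous_on UNIV \<phi>"
  defines "H \<equiv> \<lambda>w. mean (\<lambda>t. \<phi> (\<beta> t + w) * cis (y * t))"
  shows "(\<forall>w. H w = 0) \<or> (\<exists>\<psi>. line_character y \<psi> \<and> (\<forall>w. H w = H 0 * \<psi> w))"
proof -
  have ap: "uap (\<lambda>t. \<phi> (\<beta> t + w) * cis (y * t))" for w
    by (intro uap_mult_cis uap_orbit \<phi>)
  have shift: "H (\<beta> s + w) = cis (- (y * s)) * H w" for s w
  proof -
    have "\<phi> (\<beta> t + (\<beta> s + w)) * cis (y * t) = cis (- (y * s)) * (\<phi> (\<beta> (t + s) + w) * cis (y * (t + s)))" for t
    proof -
      have "cis (y * t) = cis (- (y * s)) * cis (y * (t + s))" by (simp add: cis_mult algebra_simps)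
      then show ?thesis by (simp only: beta_add add.assoc mult.left_commute)
    qed
    then have "H (\<beta> s + w) = cis (- (y * s)) * mean (\<lambda>t. \<phi> (\<beta> (t + s) + w) * cis (y * (t + s)))"
      unfolding H_def using mean_cmult[OF uap_translate[OF ap[of w], of s]] by simp
    also have "mean (\<lambda>t. \<phi> (\<beta> (t + s) + w) * cis (y * (t + s))) = H w"
      unfolding H_def by (rule mean_translate[OF ap])
    finally show ?thesis .
  qed
  have contH: "continuous_on UNIV H"
  proof (rule continuous_of_modulus)
    fix e :: real assume "e > 0"
    then obtain U where U: "open U" "0 \<in> U" "\<forall>u\<in>U. \<forall>x. cmod (\<phi> (u + x) - \<phi> x) \<le> e"
      using group_modulus[OF \<phi>] by blast
    have "cmod (H (u + w) - H w) \<le> e" if u: "u \<in> U" for u w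
      unfolding H_def
    proof (rule mean_close[OF ap ap])
      fix t
      have "cmod (\<phi> (u + (\<beta> t + w)) - \<phi> (\<beta> t + w)) \<le> e" using U(3) u by blast
      then show "cmod (\<phi> (\<beta> t + (u + w)) * cis (y * t) - \<phi> (\<beta> t + w) * cis (y * t)) \<le> e"
        by (simp add: norm_mult add.left_commute flip: left_diff_distrib)
    qed
    with U show "\<exists>U. open U \<and> 0 \<in> U \<and> (\<forall>u\<in>U. \<forall>x. cmod (H (u + x) - H x) \<le> e)" by blast
  qed
  have line: "H (\<beta> s) = cis (- (y * s)) * H 0" for s using shift[of s 0] by simp
  show ?thesis
  proof (cases "H 0 = 0")
    case True
    have "H w = 0" for w
      using dense_eq[OF contH continuous_on_const, of 0 w] line True by simp
    then show ?thesis by blast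
  next
    case False
    define \<psi> where "\<psi> = (\<lambda>w. H w / H 0)"
    have cont: "continuous_on UNIV \<psi>" unfolding \<psi>_def by (intro continuous_intros contH) (use False in auto)
    have chi_line: "\<psi> (\<beta> s) = cis (- (y * s))" for s using line[of s] False by (simp add: \<psi>_def)
    have mult1: "\<psi> (\<beta> s + w) = \<psi> (\<beta> s) * \<psi> w" for s w
      unfolding chi_line using shift[of s w] by (simp add: \<psi>_def)
    have mult: "\<psi> (v + w) = \<psi> v * \<psi> w" for v w
      by (rule dense_eq[OF continuous_translate[OF cont]]) (auto intro!: continuous_intros cont mult1)
    have norm1: "cmod (\<psi> w) = 1" for w
    proof -
      have "complex_of_real (cmod (\<psi> w)) = 1"
        by (rule dense_eq[where F = "\<lambda>w. complex_of_real (cmod (\<psi> w))" and H = "\<lambda>_. 1"])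
          (auto intro!: continuous_intros cont simp: chi_line)
      then show ?thesis by (simp only: of_real_eq_1_iff)
    qed
    have "line_character y \<psi>"
      unfolding line_character_def group_character_def using cont mult norm1 chi_line by blast
    moreover have "H w = H 0 * \<psi> w" for w using False by (simp add: \<psi>_def)
    ultimately show ?thesis by blast
  qed
qed

lemma integral_translate:
  fixes F :: "'g \<Rightarrow> complex"
  assumes "F \<in> borel_measurable \<mu>"
  shows "(LINT z|\<mu>. F (a + z)) = (LINT z|\<mu>. F z)"
proof -
  have m: "(\<lambda>x::'g. a + x) \<in> measurable \<mu> borel"
    by (intro continuous_measurable continuous_intros)
  have "(LINT z|\<mu>. F z) = (LINT z|distr \<mu> borel (\<lambda>x. a + x). F z)" by (simp add: distr_translate)
  also have "\<dots> = (LINT z|\<mu>. F (a + z))"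
    by (rule integral_distr[OF m]) (use assms borel_mu in simp)
  finally show ?thesis by simp
qed

lemma integrable_continuous:
  fixes F :: "'g \<Rightarrow> complex"
  assumes "continuous_on UNIV F" shows "integrable \<mu> F"
proof -
  have "compact (F ` UNIV)" by (rule compact_continuous_image[OF assms compact_group])
  then obtain B where "\<forall>z\<in>F ` UNIV. cmod z \<le> B" using compact_imp_bounded bounded_iff by metis
  then show ?thesis by (intro integrable_const_bound[of _ B] continuous_measurable assms) auto
qed

lemma continuous_bounded:
  fixes F :: "'g \<Rightarrow> complex"
  assumes "continuous_on UNIV F" obtains B where "B > 0" "\<And>x. cmod (F x) \<le> B"
proof -
  have "compact (F ` UNIV)" by (rule compact_continuous_image[OF assms compact_group])
  then obtain B where "\<forall>z\<in>F ` UNIV. cmod z \<le> B" using compact_imp_bounded bounded_iff by metis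
  then show ?thesis by (intro that[of "max B 1"]) (auto simp: le_max_iff_disj)
qed

section \<open>Convolution with continuous functions on the group\<close>

definition group_conv :: "('g \<Rightarrow> complex) \<Rightarrow> ('g \<Rightarrow> complex) \<Rightarrow> 'g \<Rightarrow> complex" where
  "group_conv F \<phi> g = (LINT z|\<mu>. F z * \<phi> (g - z))"

lemma group_conv_integrable:
  fixes F \<phi> :: "'g \<Rightarrow> complex"
  assumes F: "integrable \<mu> F" and \<phi>: "continuous_on UNIV \<phi>"
  shows "integrable \<mu> (\<lambda>z. F z * \<phi> (g - z))"
proof -
  obtain B where B: "B > 0" "\<And>x. cmod (\<phi> x) \<le> B" using continuous_bounded[OF \<phi>] by blast
  have [measurable]: "(\<lambda>z. \<phi> (g - z)) \<in> borel_measurable \<mu>"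
    by (intro continuous_measurable continuous_reflect \<phi>)
  have [measurable]: "F \<in> borel_measurable \<mu>" using F by simp
  show ?thesis
  proof (rule Bochner_Integration.integrable_bound)
    show "integrable \<mu> (\<lambda>z. cmod (F z) * B)" using F by (intro integrable_mult_left integrable_norm)
    show "AE z in \<mu>. norm (F z * \<phi> (g - z)) \<le> norm (cmod (F z) * B)"
      using B by (auto simp: norm_mult abs_mult intro!: mult_left_mono)
  qed measurable
qed

lemma group_conv_continuous:
  assumes F: "integrable \<mu> F" and \<phi>: "continuous_on UNIV \<phi>"
  shows "continuous_on UNIV (group_conv F \<phi>)"
proof (rule continuous_of_modulus)
  fix e :: real assume e: "e > 0"
  define I where "I = (LINT z|\<mu>. cmod (F z))"
  have I: "I \<ge> 0" by (simp add: I_def)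
  have "e / (I + 1) > 0" using e I by simp
  then obtain U where U: "open U" "0 \<in> U" "\<forall>u\<in>U. \<forall>x. cmod (\<phi> (u + x) - \<phi> x) \<le> e / (I + 1)"
    using group_modulus[OF \<phi>] by blast
  have "cmod (group_conv F \<phi> (u + x) - group_conv F \<phi> x) \<le> e" if u: "u \<in> U" for u x
  proof -
    note int = group_conv_integrable[OF F \<phi>]
    have "group_conv F \<phi> (u + x) - group_conv F \<phi> x = (LINT z|\<mu>. F z * \<phi> (u + x - z) - F z * \<phi> (x - z))"
      unfolding group_conv_def by (rule Bochner_Integration.integral_diff[OF int int, symmetric])
    also have "cmod \<dots> \<le> (LINT z|\<mu>. cmod (F z) * (e / (I + 1)))"
    proof (rule norm_integral_le)
      show "integrable \<mu> (\<lambda>z. F z * \<phi> (u + x - z) - F z * \<phi> (x - z))"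
        by (rule Bochner_Integration.integrable_diff[OF int int])
      show "integrable \<mu> (\<lambda>z. cmod (F z) * (e / (I + 1)))" using F by (intro integrable_mult_left integrable_norm)
      fix z
      have "cmod (\<phi> (u + (x - z)) - \<phi> (x - z)) \<le> e / (I + 1)" using U(3) u by blast
      then show "cmod (F z * \<phi> (u + x - z) - F z * \<phi> (x - z)) \<le> cmod (F z) * (e / (I + 1))"
        unfolding right_diff_distrib[symmetric] norm_mult by (intro mult_left_mono) (simp_all add: add_diff_eq)
    qed
    also have "\<dots> = I * (e / (I + 1))" by (simp add: I_def)
    also have "\<dots> \<le> e" using e I by (simp add: divide_le_eq)
    finally show ?thesis .
  qed
  with U show "\<exists>U. open U \<and> 0 \<in> U \<and> (\<forall>u\<in>U. \<forall>x. cmod (group_conv F \<phi> (u + x) - group_conv F \<phi> x) \<le> e)"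
    by blast
qed

lemma mean_group_conv:
  assumes F: "integrable \<mu> F" and \<phi>: "continuous_on UNIV \<phi>"
  shows "mean (\<lambda>t. group_conv F \<phi> (\<beta> t) * cis (y * t)) =
    (LINT z|\<mu>. F z * mean (\<lambda>t. \<phi> (\<beta> t + (- z)) * cis (y * t)))"
proof -
  obtain B where B: "B > 0" "\<And>x. cmod (\<phi> x) \<le> B" using continuous_bounded[OF \<phi>] by blast
  define k where "k = (\<lambda>t z. \<phi> (\<beta> t + (- z)) * cis (y * t))"
  have kap: "uap (\<lambda>t. k t z)" for z unfolding k_def by (intro uap_mult_cis uap_orbit \<phi>)
  have [measurable]: "F \<in> borel_measurable \<mu>" using F by simp
  have k[measurable]: "(\<lambda>(z, t). k t z) \<in> borel_measurable (\<mu> \<Otimes>\<^sub>M lborel)"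
  proof (rule caratheodory_measurable)
    show "k t \<in> borel_measurable \<mu>" for t
      unfolding k_def using continuous_reflect[OF \<phi>, of "\<beta> t"]
      by (intro continuous_measurable continuous_intros) simp
    show "continuous_on UNIV (\<lambda>t. k t z)" for z by (rule uap_continuous[OF kap])
  qed
  have eq: "(LINT z|\<mu>. F z * k t z) = group_conv F \<phi> (\<beta> t) * cis (y * t)" for t
    unfolding k_def group_conv_def by (simp add: mult.assoc[symmetric])
  have "mean (\<lambda>t. LINT z|\<mu>. F z * k t z) = (LINT z|\<mu>. mean (\<lambda>t. F z * k t z))"
  proof (rule mean_integral_swap[where w = "\<lambda>z. cmod (F z) * B"])
    show "sigma_finite_measure \<mu>" ..
    have "(\<lambda>p. F (fst p) * (case p of (z, t) \<Rightarrow> k t z)) \<in> borel_measurable (\<mu> \<Otimes>\<^sub>M lborel)" by measurable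
    then show "(\<lambda>(z, t). F z * k t z) \<in> borel_measurable (\<mu> \<Otimes>\<^sub>M lborel)" by (simp add: case_prod_unfold)
    show "integrable \<mu> (\<lambda>z. cmod (F z) * B)" using F by (intro integrable_mult_left integrable_norm)
    show "cmod (F z * k t z) \<le> cmod (F z) * B" for t z
      unfolding k_def norm_mult norm_cis using B(2) by (intro mult_left_mono) auto
    show "uap (\<lambda>t. F z * k t z)" for z by (intro uap_cmult kap)
    show "uap (\<lambda>t. LINT z|\<mu>. F z * k t z)"
      unfolding eq by (intro uap_mult_cis uap_restrict group_conv_continuous F \<phi>)
  qed
  then show ?thesis unfolding eq mean_cmult[OF kap] by (simp only: k_def)
qed

lemma mean_group_conv_eq_fourier_coeff:
  assumes F: "integrable \<mu> F" and \<phi>: "continuous_on UNIV \<phi>" and \<psi>: "line_character y \<psi>"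
    and H: "\<And>w. mean (\<lambda>t. \<phi> (\<beta> t + w) * cis (y * t)) = mean (\<lambda>t. \<phi> (\<beta> t + 0) * cis (y * t)) * \<psi> w"
  shows "mean (\<lambda>t. group_conv F \<phi> (\<beta> t) * cis (y * t)) =
       mean (\<lambda>t. \<phi> (\<beta> t) * cis (y * t)) * fourier_coeff \<mu> F \<psi>"
proof -
  have m: "\<psi> (- z) = cnj (\<psi> z)" for z by (rule character_minus) (use \<psi> in \<open>simp add: line_character_def\<close>)
  have "mean (\<lambda>t. group_conv F \<phi> (\<beta> t) * cis (y * t)) =
      (LINT z|\<mu>. mean (\<lambda>t. \<phi> (\<beta> t) * cis (y * t)) * (F z * cnj (\<psi> z)))"
    unfolding mean_group_conv[OF F \<phi>] H[of "- _"] m by (simp add: mult_ac)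
  then show ?thesis by (simp add: fourier_coeff_def)
qed

lemma mean_group_conv_vanish:
  assumes F: "integrable \<mu> F" and \<phi>: "continuous_on UNIV \<phi>"
    and H: "\<forall>w. mean (\<lambda>t. \<phi> (\<beta> t + w) * cis (y * t)) = 0"
  shows "mean (\<lambda>t. group_conv F \<phi> (\<beta> t) * cis (y * t)) = 0"
  unfolding mean_group_conv[OF F \<phi>] H[rule_format] by simp

lemma mean_group_conv_character:
  assumes F: "integrable \<mu> F" and \<phi>: "continuous_on UNIV \<phi>"
  shows "mean (\<lambda>t. group_conv F \<phi> (\<beta> t) * cis (y * t)) = 0 \<or>
    (\<exists>\<psi>. line_character y \<psi> \<and> mean (\<lambda>t. group_conv F \<phi> (\<beta> t) * cis (y * t)) =
       mean (\<lambda>t. \<phi> (\<beta> t) * cis (y * t)) * fourier_coeff \<mu> F \<psi>)"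
  using twisted_mean[OF \<phi>, of y] mean_group_conv_vanish[OF F \<phi>, of y]
    mean_group_conv_eq_fourier_coeff[OF F \<phi>, of y] by blast

lemma mean_group_conv_line_character:
  assumes F: "integrable \<mu> F" and \<phi>: "continuous_on UNIV \<phi>" and \<psi>: "line_character y \<psi>"
  shows "mean (\<lambda>t. group_conv F \<phi> (\<beta> t) * cis (y * t)) =
       mean (\<lambda>t. \<phi> (\<beta> t) * cis (y * t)) * fourier_coeff \<mu> F \<psi>"
  using twisted_mean[OF \<phi>, of y]
proof
  assume H: "\<forall>w. mean (\<lambda>t. \<phi> (\<beta> t + w) * cis (y * t)) = 0"
  have "mean (\<lambda>t. \<phi> (\<beta> t) * cis (y * t)) = 0" using H[rule_format, of 0] by simp
  then show ?thesis using mean_group_conv_vanish[OF F \<phi> H] by simp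
next
  assume "\<exists>\<psi>. line_character y \<psi> \<and> (\<forall>w. mean (\<lambda>t. \<phi> (\<beta> t + w) * cis (y * t)) = mean (\<lambda>t. \<phi> (\<beta> t + 0) * cis (y * t)) * \<psi> w)"
  then obtain \<psi>' where \<psi>': "line_character y \<psi>'"
    "\<forall>w. mean (\<lambda>t. \<phi> (\<beta> t + w) * cis (y * t)) = mean (\<lambda>t. \<phi> (\<beta> t + 0) * cis (y * t)) * \<psi>' w" by blast
  show ?thesis
    using mean_group_conv_eq_fourier_coeff[OF F \<phi> \<psi>'(1) \<psi>'(2)[rule_format]]
      line_character_unique[OF \<psi> \<psi>'(1)] by simp
qed

text \<open>
  Convolution with the constant one is constant by invariance of the measure, and its mean along
  \<open>\<beta>\<close> is that of \<open>\<phi>\<close>.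
\<close>

lemma group_conv_one:
  assumes \<phi>: "continuous_on UNIV \<phi>"
  shows "group_conv (\<lambda>_. 1) \<phi> g = mean (\<lambda>t. \<phi> (\<beta> t))"
proof -
  have const: "group_conv (\<lambda>_. 1) \<phi> g = (LINT z|\<mu>. \<phi> (0 - z))" for g
  proof -
    have "(\<lambda>z. \<phi> (0 - z)) \<in> borel_measurable \<mu>" by (intro continuous_measurable continuous_reflect \<phi>)
    from integral_translate[OF this, of "- g"] show ?thesis by (simp add: group_conv_def)
  qed
  have one: "line_character 0 (\<lambda>_. 1)" by (simp add: line_character_def group_character_def)
  have "mean (\<lambda>t. group_conv (\<lambda>_. 1) \<phi> (\<beta> t) * cis (0 * t)) = mean (\<lambda>t. \<phi> (\<beta> t) * cis (0 * t)) * fourier_coeff \<mu> (\<lambda>_. 1) (\<lambda>_. 1)"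
    by (rule mean_group_conv_line_character[OF _ \<phi> one]) simp
  then have "mean (\<lambda>t. group_conv (\<lambda>_. 1) \<phi> (\<beta> t)) = mean (\<lambda>t. \<phi> (\<beta> t))"
    using prob_space by (simp add: fourier_coeff_def)
  then show ?thesis unfolding const[of "\<beta> _"] const[of g] mean_const .
qed

section \<open>Uniqueness of Fourier coefficients on the group\<close>

text \<open>
  Finitely many translates of a non-empty open set cover the group.
\<close>

lemma open_positive_measure:
  assumes U: "open (U :: 'g set)" "u \<in> U" shows "emeasure \<mu> U > 0"
proof (rule ccontr)
  assume "\<not> emeasure \<mu> U > 0"
  then have zero: "emeasure \<mu> U = 0" by simp
  have trans: "emeasure \<mu> {x. x - c \<in> U} = 0" for c
  proof -
    have m: "(\<lambda>x::'g. - c + x) \<in> measurable \<mu> borel" by (intro continuous_measurable continuous_intros)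
    have "emeasure \<mu> U = emeasure (distr \<mu> borel (\<lambda>x. - c + x)) U" by (simp only: distr_translate)
    also have "\<dots> = emeasure \<mu> ((\<lambda>x. - c + x) -` U \<inter> space \<mu>)"
      by (rule emeasure_distr[OF m]) (use U in auto)
    also have "(\<lambda>x. - c + x) -` U \<inter> space \<mu> = {x. x - c \<in> U}" by auto
    finally show ?thesis using zero by simp
  qed
  have "UNIV \<subseteq> (\<Union>c. {x. x - c \<in> U})"
  proof
    fix x :: 'g
    have "x - (x - u) \<in> U" using U(2) by simp
    then show "x \<in> (\<Union>c. {x. x - c \<in> U})" by blast
  qed
  then obtain I where I: "finite I" "UNIV \<subseteq> (\<Union>c\<in>I. {x. x - c \<in> U})"
    using compactE_image[OF compact_group, of UNIV "\<lambda>c. {x. x - c \<in> U}"] open_translate[OF U(1)] by metis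
  have "emeasure \<mu> (\<Union>c\<in>I. {x. x - c \<in> U}) \<le> (\<Sum>c\<in>I. emeasure \<mu> {x. x - c \<in> U})"
    by (rule emeasure_subadditive_finite[OF I(1)]) (use open_translate[OF U(1)] in auto)
  also have "\<dots> = 0" by (simp add: trans)
  also have "(\<Union>c\<in>I. {x. x - c \<in> U}) = UNIV" using I(2) by blast
  finally show False using emeasure_UNIV by simp
qed

lemma AE_continuous_le:
  fixes F :: "'g \<Rightarrow> complex"
  assumes F: "continuous_on UNIV F" and AE: "AE x in \<mu>. cmod (F x) \<le> B"
  shows "cmod (F x) \<le> B"
proof (rule ccontr)
  assume "\<not> cmod (F x) \<le> B"
  define U where "U = {x. B < cmod (F x)}"
  have "open U"
    using continuous_open_preimage[OF continuous_on_norm[OF F] open_UNIV open_greaterThan, of B]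
    by (simp add: U_def vimage_def)
  moreover have "x \<in> U" using \<open>\<not> cmod (F x) \<le> B\<close> by (simp add: U_def)
  ultimately have "emeasure \<mu> U > 0" by (rule open_positive_measure)
  moreover have "emeasure \<mu> U = 0"
  proof -
    have "AE x in \<mu>. x \<notin> U" using AE by eventually_elim (simp add: U_def)
    then show ?thesis using \<open>open U\<close> by (subst (asm) AE_iff_measurable[of U]) auto
  qed
  ultimately show False by simp
qed

lemma urysohn_group:
  assumes "closed (S :: 'g set)" "closed T" "S \<inter> T = {}"
  obtains f :: "'g \<Rightarrow> real" where "continuous_on UNIV f" "\<And>x. 0 \<le> f x" "\<And>x. f x \<le> 1"
    "\<And>x. x \<in> S \<Longrightarrow> f x = 0" "\<And>x. x \<in> T \<Longrightarrow> f x = 1"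
proof -
  have "compact_space (euclidean :: 'g topology)"
    using compact_group by (simp add: compact_space_def)
  then have "normal_space (euclidean :: 'g topology)"
    by (rule compact_Hausdorff_or_regular_imp_normal_space)
      (auto simp: Hausdorff_space_def disjnt_def separation_t2)
  then obtain f where f: "continuous_map (euclidean :: 'g topology) (top_of_set {0..1::real}) f" "f ` S \<subseteq> {0}" "f ` T \<subseteq> {1}"
    using Urysohn_lemma[of "euclidean :: 'g topology" S T 0 1] assms
    by (auto simp: disjnt_def)
  then have c: "continuous_on UNIV f" and r: "f ` UNIV \<subseteq> {0..1}"
    by (auto simp: continuous_map_in_subtopology)
  have "f x \<in> {0..1}" for x using r by blast
  then have b: "0 \<le> f x" "f x \<le> 1" for x by (simp_all only: atLeastAtMost_iff)
  show ?thesis by (rule that[OF c b]) (use f(2,3) in auto)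
qed

text \<open>
  The product \<open>g * cnj h\<close> is a character different from one, and translating it
  multiplies its integral by a value different from one.
\<close>

lemma character_orthogonal:
  assumes g: "group_character g" and h: "group_character h" and ne: "g \<noteq> h"
  shows "(LINT x|\<mu>. g x * cnj (h x)) = 0"
proof -
  define k where "k = (\<lambda>x. g x * cnj (h x))"
  have cont: "continuous_on UNIV k"
    using g h unfolding k_def group_character_def by (intro continuous_intros) auto
  have hn: "h x * cnj (h x) = 1" for x
    using h by (simp add: group_character_def flip: complex_norm_square)
  obtain a where "g a \<noteq> h a" using ne by blast
  have "k a \<noteq> 1"
  proof
    assume "k a = 1"
    then have "h a = g a * (cnj (h a) * h a)" by (simp add: k_def mult_ac)
    then show False using hn[of a] \<open>g a \<noteq> h a\<close> by (simp add: mult.commute)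
  qed
  have "k (a + x) = k a * k x" for x
    using g h unfolding k_def group_character_def by (simp add: mult_ac)
  then have "(LINT x|\<mu>. k x) = k a * (LINT x|\<mu>. k x)"
    using integral_translate[OF continuous_measurable[OF cont], of a] by simp
  then have "(1 - k a) * (LINT x|\<mu>. k x) = 0" by (simp add: left_diff_distrib)
  then show ?thesis using \<open>k a \<noteq> 1\<close> by (simp add: k_def)
qed

lemma L_inf_AE: "F \<in> L_inf \<mu> \<Longrightarrow> AE x in \<mu>. cmod (F x) \<le> L_inf_norm \<mu> F"
  and L_inf_norm_nonneg: "F \<in> L_inf \<mu> \<Longrightarrow> L_inf_norm \<mu> F \<ge> 0"
proof -
  assume F: "F \<in> L_inf \<mu>"
  define E where "E = esssup \<mu> (\<lambda>x. ereal (cmod (F x)))"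
  have AE: "AE x in \<mu>. ereal (cmod (F x)) \<le> E" unfolding E_def by (rule esssup_AE)
  have "E < \<infinity>" using F by (simp add: L_inf_def E_def)
  moreover have E0: "E \<ge> 0"
  proof (rule ccontr)
    assume "\<not> E \<ge> 0"
    have "AE x in \<mu>. False"
      using AE by eventually_elim (use \<open>\<not> E \<ge> 0\<close> in \<open>meson ereal_less_eq(5) norm_ge_zero order_trans\<close>)
    then show False by simp
  qed
  ultimately have E: "E = ereal (L_inf_norm \<mu> F)"
    unfolding L_inf_norm_def E_def[symmetric] by (cases E) auto
  show "AE x in \<mu>. cmod (F x) \<le> L_inf_norm \<mu> F" using AE unfolding E by simp
  show "L_inf_norm \<mu> F \<ge> 0" using E0 unfolding E by simp
qed

lemma L_inf_measurable: "F \<in> L_inf \<mu> \<Longrightarrow> F \<in> borel_measurable \<mu>"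
  by (simp add: L_inf_def)

lemma L_inf_integrable: "F \<in> L_inf \<mu> \<Longrightarrow> integrable \<mu> F"
  by (rule integrable_const_bound[OF L_inf_AE L_inf_measurable])

lemma L_inf_normI:
  assumes "F \<in> borel_measurable \<mu>" "AE x in \<mu>. cmod (F x) \<le> B"
  shows "F \<in> L_inf \<mu>" "L_inf_norm \<mu> F \<le> B"
proof -
  have "(\<lambda>x. ereal (cmod (F x))) \<in> borel_measurable \<mu>" using assms(1) by measurable
  then have le: "esssup \<mu> (\<lambda>x. ereal (cmod (F x))) \<le> ereal B"
    by (rule esssup_I) (use assms(2) in simp)
  then show F: "F \<in> L_inf \<mu>" using assms(1) by (auto simp: L_inf_def intro: le_less_trans)
  have "AE x in \<mu>. False \<or> 0 \<le> B" using assms(2) by eventually_elim (meson norm_ge_zero order_trans)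
  then have "B \<ge> 0" by simp
  then show "L_inf_norm \<mu> F \<le> B"
    unfolding L_inf_norm_def using le by (cases "esssup \<mu> (\<lambda>x. ereal (cmod (F x)))") auto
qed

lemma L_inf_norm_AE_cong:
  assumes F: "F \<in> L_inf \<mu>" and G: "G \<in> L_inf \<mu>" and eq: "AE x in \<mu>. F x = G x"
  shows "L_inf_norm \<mu> F = L_inf_norm \<mu> G"
proof (rule antisym)
  show "L_inf_norm \<mu> F \<le> L_inf_norm \<mu> G"
    by (rule L_inf_normI(2)[OF L_inf_measurable[OF F]]) (use eq L_inf_AE[OF G] in \<open>eventually_elim, simp\<close>)
  show "L_inf_norm \<mu> G \<le> L_inf_norm \<mu> F"
    by (rule L_inf_normI(2)[OF L_inf_measurable[OF G]]) (use eq L_inf_AE[OF F] in \<open>eventually_elim, simp\<close>)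
qed

lemma L_inf_norm_continuous_le_iff:
  assumes F: "continuous_on UNIV F"
  shows "F \<in> L_inf \<mu>" "L_inf_norm \<mu> F \<le> B \<longleftrightarrow> (\<forall>t. cmod (F (\<beta> t)) \<le> B)"
proof -
  obtain C where "\<And>x. cmod (F x) \<le> C" using continuous_bounded[OF F] by blast
  then show L: "F \<in> L_inf \<mu>" by (intro L_inf_normI(1)[of _ C] continuous_measurable F) simp
  show "L_inf_norm \<mu> F \<le> B \<longleftrightarrow> (\<forall>t. cmod (F (\<beta> t)) \<le> B)"
  proof
    assume "L_inf_norm \<mu> F \<le> B"
    moreover have "cmod (F x) \<le> L_inf_norm \<mu> F" for x by (rule AE_continuous_le[OF F L_inf_AE[OF L]])
    ultimately show "\<forall>t. cmod (F (\<beta> t)) \<le> B" using order_trans by blast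
  next
    assume B: "\<forall>t. cmod (F (\<beta> t)) \<le> B"
    have "cmod (F x) \<le> B" for x
      by (rule dense_le[where F = "\<lambda>x. cmod (F x)", OF continuous_on_norm[OF F]]) (use B in simp)
    then show "L_inf_norm \<mu> F \<le> B" by (intro L_inf_normI(2) continuous_measurable F) simp
  qed
qed

text \<open>
  For continuous \<open>\<phi>\<close> the convolution of \<open>F\<close> with
  \<open>\<phi>\<close> has vanishing mean coefficients along \<open>\<beta>\<close>, so it is
  zero at \<open>0\<close> by Bohr's theorem. Hence \<open>F\<close> is orthogonal to all
  continuous functions. By regularity and Urysohn's lemma these approximate indicator functions,
  so all integrals of \<open>F\<close> over measurable sets vanish.
\<close>

theorem fourier_uniqueness:
  assumes F: "F \<in> L_inf \<mu>" and zero: "\<And>h. group_character h \<Longrightarrow> fourier_coeff \<mu> F h = 0"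
  shows "AE x in \<mu>. F x = 0"
proof -
  note int = L_inf_integrable[OF F]
  define C where "C = L_inf_norm \<mu> F"
  have C: "C \<ge> 0" "AE x in \<mu>. cmod (F x) \<le> C" using L_inf_norm_nonneg[OF F] L_inf_AE[OF F] by (auto simp: C_def)
  have [measurable]: "F \<in> borel_measurable \<mu>" by (rule L_inf_measurable[OF F])
  have test: "(LINT z|\<mu>. F z * \<eta> z) = 0" if \<eta>: "continuous_on UNIV \<eta>" for \<eta>
  proof -
    \<comment> \<open>The reflection makes the value of the convolution at \<open>0\<close> the integral of \<open>F * \<eta>\<close>.\<close>
    define \<phi> where "\<phi> = (\<lambda>z. \<eta> (0 - z))"
    have \<phi>: "continuous_on UNIV \<phi>" unfolding \<phi>_def by (rule continuous_reflect[OF \<eta>])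
    have "mean (\<lambda>t. group_conv F \<phi> (\<beta> t) * cis (y * t)) = 0" for y
      using mean_group_conv_character[OF int \<phi>, of y] zero by (auto simp: line_character_def)
    then have "group_conv F \<phi> (\<beta> 0) = 0"
      by (rule uap_uniqueness[OF uap_restrict[OF group_conv_continuous[OF int \<phi>]]])
    then show ?thesis by (simp add: beta_zero group_conv_def \<phi>_def)
  qed
  show ?thesis
  proof (rule density_zero[OF int])
    fix A assume "A \<in> sets \<mu>"
    then have A: "A \<in> sets borel" by simp
    have "cmod (set_lebesgue_integral \<mu> A F) \<le> 0 + e" if e: "e > 0" for e
    proof -
      define d where "d = e / (2 * (C + 1))"
      have d: "d > 0" using e C by (simp add: d_def)
      have fin: "emeasure \<mu> X \<noteq> \<infinity>" for X by simp
      have "(INF U\<in>{U. open U \<and> A \<subseteq> U}. emeasure \<mu> U) < emeasure \<mu> A + ennreal d"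
        unfolding outer_regular[OF A, symmetric] using d fin[of A]
        by (simp add: ennreal_add_left_cancel_less top.not_eq_extremum)
      then obtain U where U: "open U" "A \<subseteq> U" "emeasure \<mu> U < emeasure \<mu> A + ennreal d"
        unfolding INF_less_iff by blast
      have "\<exists>K. compact K \<and> K \<subseteq> U \<and> measure \<mu> U < measure \<mu> K + d"
      proof (rule ccontr)
        assume "\<not> ?thesis"
        then have le: "measure \<mu> K + d \<le> measure \<mu> U" if "compact K" "K \<subseteq> U" for K
          using that not_le by blast
        have d0: "d \<le> measure \<mu> U" using le[of "{}"] by simp
        have "emeasure \<mu> U \<le> ennreal (measure \<mu> U - d)"
          unfolding inner_regular[OF U(1)]
        proof (rule SUP_least)
          fix K assume "K \<in> {K. compact K \<and> K \<subseteq> U}"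
          then have "measure \<mu> K \<le> measure \<mu> U - d" using le[of K] by simp
          then show "emeasure \<mu> K \<le> ennreal (measure \<mu> U - d)"
            unfolding emeasure_eq_measure by (rule ennreal_leI)
        qed
        then show False using d d0 by (simp add: emeasure_eq_measure)
      qed
      then obtain K where K: "compact K" "K \<subseteq> U" "measure \<mu> U < measure \<mu> K + d" by blast
      have closedK: "closed K" by (rule compact_imp_closed[OF K(1)])
      obtain f :: "'g \<Rightarrow> real" where f: "continuous_on UNIV f" "\<And>x. 0 \<le> f x" "\<And>x. f x \<le> 1"
        "\<And>x. x \<in> - U \<Longrightarrow> f x = 0" "\<And>x. x \<in> K \<Longrightarrow> f x = 1"
        using urysohn_group[of "- U" K] U(1) closedK K(2) by (auto simp: closed_Compl)
      have mU: "U \<in> sets \<mu>" and mK: "K \<in> sets \<mu>" using U(1) closedK by auto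
      have [measurable]: "A \<in> sets \<mu>" "U \<in> sets \<mu>" "K \<in> sets \<mu>" using A mU mK by auto
      have diff: "U - A \<in> sets borel" "U - K \<in> sets borel" using A mU mK by (auto intro: sets.Diff)
      have m1: "measure \<mu> (U - A) \<le> d"
      proof -
        have "ennreal (measure \<mu> U) < ennreal (measure \<mu> A + d)"
          using U(3) d by (simp add: emeasure_eq_measure ennreal_plus)
        then have "measure \<mu> U < measure \<mu> A + d" by (simp add: ennreal_less_iff)
        then show ?thesis using finite_measure_Diff[of U A] U(2) A mU by simp
      qed
      have m2: "measure \<mu> (U - K) \<le> d"
        using K(3) finite_measure_Diff[of U K] K(2) mK mU by simp
      have fc: "continuous_on UNIV (\<lambda>x. complex_of_real (f x))" by (intro continuous_intros f(1))
      have intf: "integrable \<mu> (\<lambda>x. F x * complex_of_real (f x))"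
      proof (rule Bochner_Integration.integrable_bound[OF int])
        show "(\<lambda>x. F x * complex_of_real (f x)) \<in> borel_measurable \<mu>"
          using continuous_measurable[OF fc] by measurable
        show "AE x in \<mu>. norm (F x * complex_of_real (f x)) \<le> norm (F x)"
          using f(2,3) by (auto simp: norm_mult intro!: mult_left_le)
      qed
      have intA: "integrable \<mu> (\<lambda>x. indicator A x *\<^sub>R F x)"
        by (rule integrable_mult_indicator[OF _ int]) (use A in simp)
      have "set_lebesgue_integral \<mu> A F = (LINT x|\<mu>. indicator A x *\<^sub>R F x) - (LINT x|\<mu>. F x * complex_of_real (f x))"
        by (simp add: set_lebesgue_integral_def test[OF fc])
      also have "\<dots> = (LINT x|\<mu>. indicator A x *\<^sub>R F x - F x * complex_of_real (f x))"
        by (rule Bochner_Integration.integral_diff[OF intA intf, symmetric])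
      finally have eq: "set_lebesgue_integral \<mu> A F = (LINT x|\<mu>. indicator A x *\<^sub>R F x - F x * complex_of_real (f x))" .
      have "cmod (set_lebesgue_integral \<mu> A F) \<le> (LINT x|\<mu>. cmod (indicator A x *\<^sub>R F x - F x * complex_of_real (f x)))"
        unfolding eq by (rule integral_norm_bound)
      also have "\<dots> \<le> (LINT x|\<mu>. C * indicator (U - A) x + C * indicator (U - K) x)"
      proof (rule integral_mono_AE)
        show "integrable \<mu> (\<lambda>x. cmod (indicator A x *\<^sub>R F x - F x * complex_of_real (f x)))"
          by (intro integrable_norm Bochner_Integration.integrable_diff intA intf)
        show "integrable \<mu> (\<lambda>x. C * indicator (U - A) x + C * indicator (U - K) x)"
          by (intro Bochner_Integration.integrable_add integrable_mult_right integrable_real_indicator) (auto simp: emeasure_eq_measure diff)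
        show "AE x in \<mu>. cmod (indicator A x *\<^sub>R F x - F x * complex_of_real (f x)) \<le> C * indicator (U - A) x + C * indicator (U - K) x"
          using C(2)
        proof eventually_elim
          case (elim x)
          have "indicator A x *\<^sub>R F x - F x * complex_of_real (f x) = F x * complex_of_real (indicator A x - f x)"
            by (simp add: scaleR_conv_of_real right_diff_distrib mult.commute)
          then have "cmod (indicator A x *\<^sub>R F x - F x * complex_of_real (f x)) = cmod (F x) * \<bar>indicator A x - f x\<bar>"
            by (simp only: norm_mult norm_of_real)
          also have "\<dots> \<le> C * (indicator (U - A) x + indicator (U - K) x)"
          proof (rule mult_mono[OF elim])
            show "\<bar>indicator A x - f x\<bar> \<le> (indicator (U - A) x + indicator (U - K) x :: real)"
              using f(2)[of x] f(3)[of x] f(4)[of x] f(5)[of x] U(2) by (auto simp: indicator_def)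
          qed (use C in auto)
          finally show ?case by (simp add: distrib_left)
        qed
      qed
      also have "\<dots> = C * measure \<mu> (U - A) + C * measure \<mu> (U - K)"
        by (subst Bochner_Integration.integral_add) (auto intro!: integrable_mult_right integrable_real_indicator simp: emeasure_eq_measure diff)
      also have "\<dots> \<le> C * d + C * d" using m1 m2 C by (intro add_mono mult_left_mono) auto
      also have "\<dots> \<le> 2 * (C + 1) * d" using d by (simp add: algebra_simps)
      also have "\<dots> = e" using C(1) by (simp add: d_def)
      finally show ?thesis by simp
    qed
    then have "cmod (set_lebesgue_integral \<mu> A F) \<le> 0" by (rule field_le_epsilon)
    then show "set_lebesgue_integral \<mu> A F = 0" by simp
  qed
qed

lemma fourier_coeff_diff:
  assumes "F \<in> L_inf \<mu>" "G \<in> L_inf \<mu>" "group_character h"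
  shows "fourier_coeff \<mu> (\<lambda>x. F x - G x) h = fourier_coeff \<mu> F h - fourier_coeff \<mu> G h"
proof -
  have "integrable \<mu> (\<lambda>x. F x * cnj (h x))" if F: "F \<in> L_inf \<mu>" for F
  proof (rule Bochner_Integration.integrable_bound[OF L_inf_integrable[OF F]])
    have "(\<lambda>x. cnj (h x)) \<in> borel_measurable \<mu>"
      using assms(3) by (intro continuous_measurable continuous_intros) (simp add: group_character_def)
    then show "(\<lambda>x. F x * cnj (h x)) \<in> borel_measurable \<mu>" using L_inf_measurable[OF F] by measurable
    show "AE x in \<mu>. norm (F x * cnj (h x)) \<le> norm (F x)"
      using assms(3) by (simp add: norm_mult group_character_def)
  qed
  then show ?thesis
    using assms by (simp add: fourier_coeff_def left_diff_distrib)
qed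

text \<open>
  Makes the norm of a series independent of the chosen representing function.
\<close>

lemma represents_unique:
  assumes F: "represents lam \<beta> \<mu> F a" and G: "represents lam \<beta> \<mu> G a"
  shows "L_inf_norm \<mu> F = L_inf_norm \<mu> G"
proof -
  have L: "F \<in> L_inf \<mu>" "G \<in> L_inf \<mu>" using F G by (auto simp: represents_def H_inf_group_def)
  have D: "(\<lambda>x. F x - G x) \<in> L_inf \<mu>"
  proof (rule L_inf_normI(1)[of _ "L_inf_norm \<mu> F + L_inf_norm \<mu> G"])
    show "(\<lambda>x. F x - G x) \<in> borel_measurable \<mu>" using L[THEN L_inf_measurable] by measurable
    show "AE x in \<mu>. cmod (F x - G x) \<le> L_inf_norm \<mu> F + L_inf_norm \<mu> G"
      using L_inf_AE[OF L(1)] L_inf_AE[OF L(2)]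
      by eventually_elim (meson add_mono norm_triangle_ineq4 order_trans)
  qed
  have "fourier_coeff \<mu> (\<lambda>x. F x - G x) h = 0" if h: "group_character h" for h
  proof (cases "h \<in> range (\<lambda>n. freq_character \<beta> (lam n))")
    case True
    then obtain n where n: "h = freq_character \<beta> (lam n)" by blast
    have "fourier_coeff \<mu> F h = a n" "fourier_coeff \<mu> G h = a n"
      using F G unfolding represents_def n by simp_all
    then show ?thesis by (simp add: fourier_coeff_diff[OF L h])
  next
    case False
    then show ?thesis using F G h by (simp add: fourier_coeff_diff[OF L h] represents_def H_inf_group_def)
  qed
  from fourier_uniqueness[OF D this] have "AE x in \<mu>. F x = G x" by simp
  then show ?thesis by (rule L_inf_norm_AE_cong[OF L])
qed

lemma DH_inf_norm_eq:
  assumes "represents lam \<beta> \<mu> F a" shows "DH_inf_norm lam \<beta> \<mu> a = L_inf_norm \<mu> F"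
  unfolding DH_inf_norm_def by (rule represents_unique[OF someI[of "\<lambda>F. represents lam \<beta> \<mu> F a", OF assms] assms])

section \<open>From the group to the half-plane\<close>

lemma trig_sum_cong_bound:
  assumes "finite I" "\<And>n. n \<in> I \<Longrightarrow> cmod (c n - d n) \<le> e n"
  shows "cmod (trig_sum lam I c t - trig_sum lam I d t) \<le> (\<Sum>n\<in>I. e n)"
  unfolding trig_sum_def sum_subtractf[symmetric] left_diff_distrib[symmetric]
  by (rule sum_norm_le) (use assms(2) in \<open>simp add: norm_mult\<close>)

text \<open>
  On the neighbourhood \<open>V\<close> of zero the finitely many characters are within
  \<open>e\<close> of one, so a non-negative function of mean one supported in \<open>V\<close>
  has these mean coefficients close to one.
\<close>

lemma bump_function:
  assumes I: "finite I" and e: "e > 0"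
  obtains f :: "'g \<Rightarrow> real" where "continuous_on UNIV f" "\<And>x. f x \<ge> 0"
    "mean (\<lambda>t. complex_of_real (f (\<beta> t))) = 1"
    "\<And>n. n \<in> I \<Longrightarrow> cmod (mean (\<lambda>t. complex_of_real (f (\<beta> t)) * cis (lam n * t)) - 1) \<le> e"
proof -
  define h where "h = (\<lambda>n. freq_character \<beta> (lam n))"
  have h: "line_character (lam n) (h n)" for n unfolding h_def by (rule freq_character_line)
  have hc: "continuous_on UNIV (h n)" for n using h by (simp add: line_character_def group_character_def)
  define V where "V = (\<Inter>n\<in>I. {x. cmod (h n x - 1) < e})"
  have "open {x. cmod (h n x - 1) < e}" for n
  proof -
    have "continuous_on UNIV (\<lambda>x. cmod (h n x - 1))" by (intro continuous_intros hc)
    from continuous_open_preimage[OF this open_UNIV open_lessThan, of e] show ?thesis by (simp add: vimage_def)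
  qed
  then have "open V" unfolding V_def using I by (intro open_INT) auto
  moreover have "h n 0 = 1" for n
    by (rule character_zero) (use h in \<open>simp add: line_character_def\<close>)
  then have "0 \<in> V" using e by (simp add: V_def)
  ultimately obtain f0 :: "'g \<Rightarrow> real" where f0: "continuous_on UNIV f0" "\<And>x. 0 \<le> f0 x" "\<And>x. f0 x \<le> 1"
    "\<And>x. x \<in> - V \<Longrightarrow> f0 x = 0" "\<And>x. x \<in> {0} \<Longrightarrow> f0 x = 1"
    using urysohn_group[of "- V" "{0}"] by (auto simp: closed_Compl)
  define F where "F = (\<lambda>x. complex_of_real (f0 x))"
  have F: "continuous_on UNIV F" unfolding F_def by (intro continuous_intros f0(1))
  define r where "r = (LINT z|\<mu>. f0 (0 - z))"
  have FR: "continuous_on UNIV (\<lambda>z. F (0 - z))" by (rule continuous_reflect[OF F])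
  have mr: "mean (\<lambda>t. F (\<beta> t)) = complex_of_real r"
    using group_conv_one[OF F, of 0] by (simp add: group_conv_def F_def r_def)
  have intr: "integrable \<mu> (\<lambda>z. f0 (0 - z))"
    using integrable_Re[OF integrable_continuous[OF FR]] by (simp add: F_def)
  have r: "r > 0"
  proof (rule ccontr)
    assume "\<not> r > 0"
    moreover have "r \<ge> 0" unfolding r_def using f0(2) by (intro Bochner_Integration.integral_nonneg) simp
    ultimately have "(LINT z|\<mu>. f0 (0 - z)) = 0" by (simp add: r_def)
    then have "AE z in \<mu>. f0 (0 - z) = 0"
      using f0(2) by (subst (asm) integral_nonneg_eq_0_iff_AE[OF intr]) auto
    then have "AE z in \<mu>. cmod (F (0 - z)) \<le> 0" by eventually_elim (simp add: F_def)
    from AE_continuous_le[OF FR this, of 0] show False using f0(5)[of 0] by (simp add: F_def)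
  qed
  define f where "f = (\<lambda>x. f0 x / r)"
  have f: "continuous_on UNIV f" unfolding f_def using r by (intro continuous_intros f0(1)) auto
  have fF: "complex_of_real (f x) = of_real (1 / r) * F x" for x by (simp add: f_def F_def)
  have fapp: "uap (\<lambda>t. complex_of_real (f (\<beta> t)))"
    by (rule uap_restrict) (intro continuous_intros f)
  have one: "mean (\<lambda>t. complex_of_real (f (\<beta> t))) = 1"
    unfolding fF mean_cmult[OF uap_restrict[OF F]] mr using r by simp
  have near: "cmod (mean (\<lambda>t. complex_of_real (f (\<beta> t)) * cis (lam n * t)) - 1) \<le> e" if n: "n \<in> I" for n
  proof -
    have "cmod (mean (\<lambda>t. complex_of_real (f (\<beta> t)) * cis (lam n * t) - complex_of_real (f (\<beta> t)))) \<le>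
        Re (mean (\<lambda>t. of_real e * complex_of_real (f (\<beta> t))))"
    proof (rule mean_norm_le)
      show "uap (\<lambda>t. complex_of_real (f (\<beta> t)) * cis (lam n * t) - complex_of_real (f (\<beta> t)))"
        by (intro uap_diff uap_mult_cis fapp)
      show "uap (\<lambda>t. of_real e * complex_of_real (f (\<beta> t)))" by (intro uap_cmult fapp)
      fix t
      have hb: "h n (\<beta> t) = cis (- (lam n * t))" using h[of n] by (simp add: line_character_def)
      have "f (\<beta> t) * cmod (cis (lam n * t) - 1) \<le> f (\<beta> t) * e"
      proof (cases "\<beta> t \<in> V")
        case True
        then have "cmod (h n (\<beta> t) - 1) < e" using n by (simp add: V_def)
        moreover have "cnj (h n (\<beta> t) - 1) = cis (lam n * t) - 1" by (simp add: hb cis_cnj)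
        ultimately have "cmod (cis (lam n * t) - 1) < e" by (metis complex_mod_cnj)
        then show ?thesis using f0(2) r by (intro mult_left_mono) (auto simp: f_def)
      qed (use f0(4) in \<open>simp add: f_def\<close>)
      moreover have "complex_of_real (f (\<beta> t)) * cis (lam n * t) - complex_of_real (f (\<beta> t)) =
          complex_of_real (f (\<beta> t)) * (cis (lam n * t) - 1)" by (simp add: right_diff_distrib)
      moreover have "\<bar>f (\<beta> t)\<bar> = f (\<beta> t)" using f0(2) r by (simp add: f_def)
      ultimately show "cmod (complex_of_real (f (\<beta> t)) * cis (lam n * t) - complex_of_real (f (\<beta> t))) \<le>
          Re (of_real e * complex_of_real (f (\<beta> t)))"
        by (simp add: norm_mult mult.commute)
    qed
    then show ?thesis
      unfolding mean_diff[OF uap_mult_cis[OF fapp] fapp] mean_cmult[OF fapp] one by simp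
  qed
  show ?thesis by (rule that[OF f _ one near]) (use f0(2) r in \<open>simp_all add: f_def\<close>)
qed

text \<open>
  The convolution \<open>G\<close> of \<open>F\<close> with a bump is continuous, bounded by the
  norm of \<open>F\<close>, and its mean coefficients are \<open>m n * a n\<close> with \<open>m n\<close> close to one. Its Riesz mean is a Fejer convolution, hence bounded by the same norm.
  Only finitely many coefficients occur, so letting the bump shrink replaces \<open>m n\<close> by
  one.
\<close>

theorem riesz_mean_bound:
  assumes F: "F \<in> H_inf_group lam \<beta> \<mu>"
    and a: "\<And>n. a n = fourier_coeff \<mu> F (freq_character \<beta> (lam n))" and x: "x > 0"
  shows "cmod (trig_sum lam (riesz_index lam x) (\<lambda>n. of_real (1 - lam n / x) * a n) t) \<le> L_inf_norm \<mu> F"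
proof -
  define I where "I = riesz_index lam x"
  have I: "finite I" unfolding I_def by (rule finite_riesz_index[OF freq])
  define C where "C = L_inf_norm \<mu> F"
  have L: "F \<in> L_inf \<mu>" using F by (simp add: H_inf_group_def)
  note int = L_inf_integrable[OF L]
  define A where "A = (\<Sum>n\<in>I. cmod (of_real (1 - lam n / x) * a n))"
  have A: "A \<ge> 0" unfolding A_def by (intro sum_nonneg) simp
  have "cmod (trig_sum lam I (\<lambda>n. of_real (1 - lam n / x) * a n) t) \<le> C + d" if d: "d > 0" for d
  proof -
    \<comment> \<open>The error made by replacing \<open>m n\<close> by one is at most \<open>A * e\<close>, where \<open>A\<close> is the sum of the moduli of the coefficients.\<close>
    define e where "e = d / (A + 1)"
    have e: "e > 0" using d A by (simp add: e_def)
    obtain f :: "'g \<Rightarrow> real" where f: "continuous_on UNIV f" "\<And>x. f x \<ge> 0"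
      "mean (\<lambda>t. complex_of_real (f (\<beta> t))) = 1"
      "\<And>n. n \<in> I \<Longrightarrow> cmod (mean (\<lambda>t. complex_of_real (f (\<beta> t)) * cis (lam n * t)) - 1) \<le> e"
      using bump_function[OF I e] by blast
    define \<phi> where "\<phi> = (\<lambda>x. complex_of_real (f x))"
    have \<phi>: "continuous_on UNIV \<phi>" unfolding \<phi>_def by (intro continuous_intros f(1))
    define m where "m = (\<lambda>n. mean (\<lambda>t. \<phi> (\<beta> t) * cis (lam n * t)))"
    define G where "G = group_conv F \<phi>"
    have Gc: "continuous_on UNIV G" unfolding G_def by (rule group_conv_continuous[OF int \<phi>])
    have Gb: "cmod (G g) \<le> C" for g
    proof -
      have one: "(LINT z|\<mu>. \<phi> (g - z)) = 1"
        using group_conv_one[OF \<phi>, of g] f(3) by (simp add: group_conv_def \<phi>_def)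
      have intp: "integrable \<mu> (\<lambda>z. \<phi> (g - z))" by (intro integrable_continuous continuous_reflect \<phi>)
      have intf: "integrable \<mu> (\<lambda>z. f (g - z))"
        using integrable_Re[OF intp] by (simp add: \<phi>_def)
      have "complex_of_real (LINT z|\<mu>. f (g - z)) = 1" using one by (simp add: \<phi>_def)
      then have onef: "(LINT z|\<mu>. f (g - z)) = 1" by (simp only: of_real_eq_1_iff)
      have "cmod (G g) \<le> (LINT z|\<mu>. cmod (F z * \<phi> (g - z)))"
        unfolding G_def group_conv_def by (rule integral_norm_bound)
      also have "\<dots> \<le> (LINT z|\<mu>. C * f (g - z))"
      proof (rule integral_mono_AE)
        show "integrable \<mu> (\<lambda>z. cmod (F z * \<phi> (g - z)))"
          by (intro integrable_norm group_conv_integrable[OF int \<phi>])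
        show "integrable \<mu> (\<lambda>z. C * f (g - z))" by (intro integrable_mult_right intf)
        show "AE z in \<mu>. cmod (F z * \<phi> (g - z)) \<le> C * f (g - z)"
          using L_inf_AE[OF L]
          by eventually_elim (use f(2) in \<open>auto simp: norm_mult \<phi>_def C_def intro!: mult_right_mono\<close>)
      qed
      also have "\<dots> = C" by (simp add: onef)
      finally show ?thesis .
    qed
    have ap: "uap (\<lambda>t. G (\<beta> t))" by (rule uap_restrict[OF Gc])
    have co: "mean (\<lambda>t. G (\<beta> t) * cis (lam n * t)) = m n * a n" for n
      unfolding G_def m_def a by (rule mean_group_conv_line_character[OF int \<phi> freq_character_line])
    have spec: "mean (\<lambda>t. G (\<beta> t) * cis (y * t)) = 0" if y: "y \<notin> range lam" for y
    proof -
      have "fourier_coeff \<mu> F \<psi> = 0" if "line_character y \<psi>" for \<psi>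
        using F line_character_not_freq[OF that y] that by (simp add: H_inf_group_def line_character_def)
      then show ?thesis
        unfolding G_def using mean_group_conv_character[OF int \<phi>, of y] by auto
    qed
    have "fejer_conv (\<lambda>t. G (\<beta> t)) x t = trig_sum lam I (\<lambda>n. of_real (1 - lam n / x) * (m n * a n)) t"
      unfolding I_def by (rule fejer_conv_eq_riesz_mean[OF ap freq x spec co[symmetric]])
    then have 1: "cmod (trig_sum lam I (\<lambda>n. of_real (1 - lam n / x) * (m n * a n)) t) \<le> C"
      using fejer_conv_bound[OF uap_continuous[OF ap] Gb x, of t] by simp
    have "cmod (trig_sum lam I (\<lambda>n. of_real (1 - lam n / x) * a n) t - trig_sum lam I (\<lambda>n. of_real (1 - lam n / x) * (m n * a n)) t)
        \<le> (\<Sum>n\<in>I. cmod (of_real (1 - lam n / x) * a n) * e)"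
    proof (rule trig_sum_cong_bound[OF I])
      fix n assume n: "n \<in> I"
      have "of_real (1 - lam n / x) * a n - of_real (1 - lam n / x) * (m n * a n) = of_real (1 - lam n / x) * a n * (1 - m n)"
      proof -
        have "r * v - r * (s * v) = r * v * (1 - s)" for r s v :: complex by (simp add: algebra_simps)
        then show ?thesis .
      qed
      then have "cmod (of_real (1 - lam n / x) * a n - of_real (1 - lam n / x) * (m n * a n)) =
          cmod (of_real (1 - lam n / x) * a n) * cmod (1 - m n)" by (simp only: norm_mult)
      also have "\<dots> \<le> cmod (of_real (1 - lam n / x) * a n) * e"
        using f(4)[OF n] by (intro mult_left_mono) (simp_all add: m_def \<phi>_def norm_minus_commute)
      finally show "cmod (of_real (1 - lam n / x) * a n - of_real (1 - lam n / x) * (m n * a n)) \<le>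
          cmod (of_real (1 - lam n / x) * a n) * e" .
    qed
    also have "\<dots> = A * e" by (simp add: A_def sum_distrib_right)
    also have "\<dots> \<le> d" using A d by (simp add: e_def divide_le_eq)
    finally have 2: "cmod (trig_sum lam I (\<lambda>n. of_real (1 - lam n / x) * a n) t - trig_sum lam I (\<lambda>n. of_real (1 - lam n / x) * (m n * a n)) t) \<le> d" .
    show ?thesis using 1 2 by norm
  qed
  then show ?thesis unfolding I_def C_def by (rule field_le_epsilon)
qed

theorem DH_inf_plus_subset_image:
  assumes a: "a \<in> DH_inf_plus lam \<beta> \<mu>"
  shows "\<exists>f\<in>H_inf_plus lam. \<forall>n. bohr_coeff f (lam n) = a n"
proof (rule H_inf_plus_of_bounded_riesz_means[OF freq])
  fix \<sigma> :: real assume "\<sigma> > 0"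
  then have "translate_series lam \<sigma> a \<in> DH_inf lam \<beta> \<mu>" using a by (simp add: DH_inf_plus_def)
  then obtain F where F: "F \<in> H_inf_group lam \<beta> \<mu>"
    and co: "\<And>n. translate_series lam \<sigma> a n = fourier_coeff \<mu> F (freq_character \<beta> (lam n))"
    by (auto simp: DH_inf_def represents_def)
  have "cmod (riesz_poly lam a x (Complex \<sigma> t)) \<le> L_inf_norm \<mu> F" if "x > 0" for x t
    using riesz_mean_bound[OF F co that, of t]
    unfolding riesz_poly_line translate_series_def by (simp only: mult.commute[of "a _"])
  then show "\<exists>B. \<forall>x>0. \<forall>t. cmod (riesz_poly lam a x (Complex \<sigma> t)) \<le> B" by blast
qed

section \<open>From the half-plane to the group\<close>

definition character_sum :: "nat set \<Rightarrow> (nat \<Rightarrow> complex) \<Rightarrow> 'g \<Rightarrow> complex" where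
  "character_sum I c g = (\<Sum>n\<in>I. c n * freq_character \<beta> (lam n) g)"

lemma freq_character_group: "group_character (freq_character \<beta> (lam n))"
  using freq_character_line[of n] by (simp add: line_character_def)

lemma continuous_character: "group_character h \<Longrightarrow> continuous_on UNIV h"
  by (simp add: group_character_def)

lemma character_sum_continuous: "continuous_on UNIV (character_sum I c)"
  unfolding character_sum_def[abs_def]
  by (intro continuous_intros continuous_character freq_character_group)

lemma character_sum_line: "character_sum I c (\<beta> t) = trig_sum lam I c t"
  using freq_character_line by (simp add: character_sum_def trig_sum_def line_character_def)

lemma fourier_coeff_character_sum:
  assumes h: "group_character h"
  shows "fourier_coeff \<mu> (character_sum I c) h = (\<Sum>n\<in>I. c n * (if h = freq_character \<beta> (lam n) then 1 else 0))"
proof -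
  have int: "integrable \<mu> (\<lambda>x. freq_character \<beta> (lam n) x * cnj (h x))" for n
    by (intro integrable_continuous continuous_intros continuous_character freq_character_group h)
  have one: "(LINT x|\<mu>. freq_character \<beta> (lam n) x * cnj (h x)) = (if h = freq_character \<beta> (lam n) then 1 else 0)" for n
  proof (cases "h = freq_character \<beta> (lam n)")
    case True
    have "h x * cnj (h x) = 1" for x
      using h by (simp add: group_character_def flip: complex_norm_square)
    then show ?thesis using True prob_space by simp
  next
    case False
    then show ?thesis using character_orthogonal[OF freq_character_group h] by auto
  qed
  have "fourier_coeff \<mu> (character_sum I c) h = (LINT x|\<mu>. (\<Sum>n\<in>I. c n * (freq_character \<beta> (lam n) x * cnj (h x))))"
    by (simp add: fourier_coeff_def character_sum_def sum_distrib_right mult.assoc)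
  also have "\<dots> = (\<Sum>n\<in>I. c n * (LINT x|\<mu>. freq_character \<beta> (lam n) x * cnj (h x)))"
    by (subst Bochner_Integration.integral_sum) (auto intro!: integrable_mult_right int)
  finally show ?thesis by (simp only: one)
qed

lemma fourier_coeff_bound:
  assumes "\<And>x. cmod (F x) \<le> B" "group_character h" "F \<in> borel_measurable \<mu>"
  shows "cmod (fourier_coeff \<mu> F h) \<le> B"
proof -
  have m: "(\<lambda>x. cnj (h x)) \<in> borel_measurable \<mu>"
    using assms(2) by (intro continuous_measurable continuous_intros continuous_character)
  have bd: "cmod (F x * cnj (h x)) \<le> B" for x
    using assms(1,2) by (simp add: norm_mult group_character_def)
  have "cmod (fourier_coeff \<mu> F h) \<le> (LINT x|\<mu>. B)"
    unfolding fourier_coeff_def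
  proof (rule norm_integral_le)
    show "integrable \<mu> (\<lambda>x. F x * cnj (h x))"
      by (rule integrable_const_bound[of _ B]) (use bd m assms(3) in auto)
  qed (use bd in simp_all)
  then show ?thesis using prob_space by simp
qed

lemma freq_character_inj: "freq_character \<beta> (lam m) = freq_character \<beta> (lam n) \<longleftrightarrow> m = n"
  using line_character_inj[OF freq_character_line[of m]] freq_character_line[of n] frequency_inj[OF freq] by metis

text \<open>
  The Riesz means of \<open>f\<close> converge uniformly on the line. By density the corresponding
  sums of characters converge uniformly on the group, and Fourier coefficients are continuous
  under uniform limits.
\<close>

theorem H_inf_plus_line_on_group:
  assumes f: "f \<in> H_inf_plus lam" and \<sigma>: "\<sigma> > 0"
  obtains F where "continuous_on UNIV F" "\<And>t. F (\<beta> t) = f (Complex \<sigma> t)"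
    "represents lam \<beta> \<mu> F (translate_series lam \<sigma> (\<lambda>n. bohr_coeff f (lam n)))"
proof -
  define a where "a = (\<lambda>n. bohr_coeff f (lam n))"
  define c where "c = (\<lambda>x n. of_real (1 - lam n / x) * (of_real (exp (- lam n * \<sigma>)) * a n) :: complex)"
  define P where "P = (\<lambda>k::nat. character_sum (riesz_index lam (real (Suc k))) (c (real (Suc k))))"
  have Pc: "continuous_on UNIV (P k)" for k unfolding P_def by (rule character_sum_continuous)
  have Pline: "P k (\<beta> t) = riesz_poly lam a (real (Suc k)) (Complex \<sigma> t)" for k t
    by (simp only: P_def character_sum_line riesz_poly_line c_def)
  have approx: "\<exists>N. \<forall>k\<ge>N. \<forall>t. cmod (P k (\<beta> t) - f (Complex \<sigma> t)) \<le> e" if e: "e > 0" for e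
  proof -
    obtain x0 where x0: "\<forall>x\<ge>x0. \<forall>t. cmod (riesz_poly lam a x (Complex \<sigma> t) - f (Complex \<sigma> t)) \<le> e"
      using H_inf_plus_riesz_approximation[OF freq f \<sigma> e] unfolding a_def by blast
    obtain N :: nat where N: "x0 \<le> real N" using real_arch_simple by blast
    have "cmod (P k (\<beta> t) - f (Complex \<sigma> t)) \<le> e" if "k \<ge> N" for k t
    proof -
      have "real (Suc k) \<ge> x0" using N that by simp
      then show ?thesis unfolding Pline using x0 by blast
    qed
    then show ?thesis by blast
  qed
  have "uniformly_Cauchy_on UNIV P"
    unfolding uniformly_Cauchy_on_def
  proof (intro allI impI)
    fix e :: real assume "e > 0"
    then have "e / 4 > 0" by simp
    from approx[OF this] obtain N where N: "\<forall>k\<ge>N. \<forall>t. cmod (P k (\<beta> t) - f (Complex \<sigma> t)) \<le> e / 4" by blast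
    have "dist (P m x) (P n x) < e" if mn: "m \<ge> N" "n \<ge> N" for m n x
    proof -
      have "cmod (P m x - P n x) \<le> e / 4 + e / 4"
      proof (rule dense_le[where F = "\<lambda>x. cmod (P m x - P n x)"])
        show "continuous_on UNIV (\<lambda>x. cmod (P m x - P n x))" by (intro continuous_intros Pc)
        fix t
        have "cmod (f (Complex \<sigma> t) - P m (\<beta> t)) \<le> e / 4" "cmod (f (Complex \<sigma> t) - P n (\<beta> t)) \<le> e / 4"
          using N mn by (simp_all add: norm_minus_commute)
        then show "cmod (P m (\<beta> t) - P n (\<beta> t)) \<le> e / 4 + e / 4" by (rule cmod_diff_le_via)
      qed
      then show ?thesis using \<open>e > 0\<close> by (simp add: dist_norm)
    qed
    then show "\<exists>M. \<forall>x\<in>UNIV. \<forall>m\<ge>M. \<forall>n\<ge>M. dist (P m x) (P n x) < e" by blast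
  qed
  then obtain F where lim: "uniform_limit UNIV P F sequentially"
    using Cauchy_uniformly_convergent unfolding uniformly_convergent_on_def by blast
  have Fc: "continuous_on UNIV F"
    by (rule uniform_limit_theorem[OF _ lim]) (auto intro: always_eventually Pc)
  have Fline: "F (\<beta> t) = f (Complex \<sigma> t)" for t
  proof (rule LIMSEQ_unique)
    show "(\<lambda>k. P k (\<beta> t)) \<longlonglongrightarrow> F (\<beta> t)" by (rule tendsto_uniform_limitI[OF lim]) simp
    show "(\<lambda>k. P k (\<beta> t)) \<longlonglongrightarrow> f (Complex \<sigma> t)"
      unfolding LIMSEQ_def
    proof (intro allI impI)
      fix e :: real assume e: "e > 0"
      obtain N where N: "\<forall>k\<ge>N. \<forall>t. cmod (P k (\<beta> t) - f (Complex \<sigma> t)) \<le> e / 2"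
        using approx[OF half_gt_zero[OF e]] by blast
      have "dist (P k (\<beta> t)) (f (Complex \<sigma> t)) < e" if "k \<ge> N" for k
      proof -
        have "cmod (P k (\<beta> t) - f (Complex \<sigma> t)) \<le> e / 2" using N that by blast
        then show ?thesis using e by (simp add: dist_norm)
      qed
      then show "\<exists>N. \<forall>k\<ge>N. dist (P k (\<beta> t)) (f (Complex \<sigma> t)) < e" by blast
    qed
  qed
  have FL: "F \<in> L_inf \<mu>" by (rule L_inf_norm_continuous_le_iff(1)[OF Fc])
  have PL: "P k \<in> L_inf \<mu>" for k by (rule L_inf_norm_continuous_le_iff(1)[OF Pc])
  have coeff_lim: "(\<lambda>k. fourier_coeff \<mu> (P k) h) \<longlonglongrightarrow> fourier_coeff \<mu> F h" if h: "group_character h" for h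
    unfolding LIMSEQ_def
  proof (intro allI impI)
    fix e :: real assume e: "e > 0"
    have "\<forall>\<^sub>F k in sequentially. \<forall>x\<in>UNIV. dist (P k x) (F x) < e / 2"
      using lim half_gt_zero[OF e] unfolding uniform_limit_iff by blast
    then obtain N where N: "\<And>k x. k \<ge> N \<Longrightarrow> cmod (P k x - F x) < e / 2"
      unfolding eventually_sequentially by (auto simp: dist_norm)
    have "dist (fourier_coeff \<mu> (P k) h) (fourier_coeff \<mu> F h) < e" if "k \<ge> N" for k
    proof -
      have "cmod (fourier_coeff \<mu> (\<lambda>x. P k x - F x) h) \<le> e / 2"
        by (rule fourier_coeff_bound[OF less_imp_le[OF N[OF that]] h])
          (intro continuous_measurable continuous_intros Pc Fc)
      then show ?thesis using e by (simp add: fourier_coeff_diff[OF PL FL h] dist_norm)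
    qed
    then show "\<exists>N. \<forall>k\<ge>N. dist (fourier_coeff \<mu> (P k) h) (fourier_coeff \<mu> F h) < e" by blast
  qed
  have zero: "fourier_coeff \<mu> F h = 0" if h: "group_character h" and "h \<notin> range (\<lambda>n. freq_character \<beta> (lam n))" for h
  proof -
    have "fourier_coeff \<mu> (P k) h = 0" for k
      unfolding P_def fourier_coeff_character_sum[OF h] using that(2) by (intro sum.neutral) auto
    then have "(\<lambda>k. fourier_coeff \<mu> (P k) h) \<longlonglongrightarrow> 0" by simp
    from LIMSEQ_unique[OF coeff_lim[OF h] this] show ?thesis .
  qed
  have val: "fourier_coeff \<mu> F (freq_character \<beta> (lam m)) = of_real (exp (- lam m * \<sigma>)) * a m" for m
  proof (rule LIMSEQ_unique[OF coeff_lim[OF freq_character_group]])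
    let ?b = "complex_of_real (exp (- lam m * \<sigma>)) * a m"
    have cm: "fourier_coeff \<mu> (P k) (freq_character \<beta> (lam m)) =
        (if m \<in> riesz_index lam (real (Suc k)) then c (real (Suc k)) m else 0)" for k
    proof -
      have "fourier_coeff \<mu> (P k) (freq_character \<beta> (lam m)) =
          (\<Sum>n\<in>riesz_index lam (real (Suc k)). if m = n then c (real (Suc k)) n else 0)"
        unfolding P_def fourier_coeff_character_sum[OF freq_character_group] freq_character_inj
        by (intro sum.cong refl) simp
      then show ?thesis by (simp only: sum.delta'[OF finite_riesz_index[OF freq]])
    qed
    obtain N :: nat where N: "lam m \<le> real N" using real_arch_simple by blast
    have "(\<lambda>k. lam m / real (Suc k)) \<longlonglongrightarrow> 0"
      using LIMSEQ_Suc[OF lim_const_over_n[of "lam m"]] by simp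
    then have "(\<lambda>k. complex_of_real (1 - lam m / real (Suc k)) * ?b) \<longlonglongrightarrow> complex_of_real (1 - 0) * ?b"
      by (intro tendsto_intros)
    moreover have "\<forall>\<^sub>F k in sequentially. complex_of_real (1 - lam m / real (Suc k)) * ?b =
        fourier_coeff \<mu> (P k) (freq_character \<beta> (lam m))"
      using eventually_ge_at_top[of N]
      by eventually_elim (use N in \<open>auto simp: cm c_def riesz_index_def\<close>)
    ultimately show "(\<lambda>k. fourier_coeff \<mu> (P k) (freq_character \<beta> (lam m))) \<longlonglongrightarrow> ?b"
      using Lim_transform_eventually by fastforce
  qed
  have "represents lam \<beta> \<mu> F (translate_series lam \<sigma> a)"
    unfolding represents_def H_inf_group_def using FL zero
    by (auto simp: val translate_series_def)
  then show ?thesis by (intro that[OF Fc Fline]) (simp add: a_def)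
qed

theorem coefficient_map_isometry:
  assumes f: "f \<in> H_inf_plus lam"
  shows "(\<lambda>n. bohr_coeff f (lam n)) \<in> DH_inf_plus lam \<beta> \<mu>"
    "DH_inf_plus_norm lam \<beta> \<mu> k (\<lambda>n. bohr_coeff f (lam n)) = H_inf_plus_norm k f"
proof -
  show "(\<lambda>n. bohr_coeff f (lam n)) \<in> DH_inf_plus lam \<beta> \<mu>"
    unfolding DH_inf_plus_def DH_inf_def using H_inf_plus_line_on_group[OF f] by blast
  have hp: "ap_half_plane f" using f by (simp add: H_inf_plus_alt)
  define \<sigma> where "\<sigma> = 1 / real (Suc k)"
  have \<sigma>: "\<sigma> > 0" by (simp add: \<sigma>_def)
  obtain F where F: "continuous_on UNIV F" "\<And>t. F (\<beta> t) = f (Complex \<sigma> t)"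
    "represents lam \<beta> \<mu> F (translate_series lam \<sigma> (\<lambda>n. bohr_coeff f (lam n)))"
    using H_inf_plus_line_on_group[OF f \<sigma>] by blast
  have "L_inf_norm \<mu> F \<le> B \<longleftrightarrow> H_inf_plus_norm k f \<le> B" for B
    unfolding L_inf_norm_continuous_le_iff(2)[OF F(1)] H_inf_plus_norm_le_iff[OF hp] F(2) \<sigma>_def ..
  then have "L_inf_norm \<mu> F = H_inf_plus_norm k f" by (meson antisym order_refl)
  then show "DH_inf_plus_norm lam \<beta> \<mu> k (\<lambda>n. bohr_coeff f (lam n)) = H_inf_plus_norm k f"
    unfolding DH_inf_plus_norm_def \<sigma>_def[symmetric] DH_inf_norm_eq[OF F(3)] .
qed

end

section \<open>Isometric isomorphisms of Frechet spaces\<close>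

lemma topspace_seminorm_topology:
  assumes "\<And>k. r k (\<lambda>_. 0) = 0" shows "topspace (seminorm_topology Z r) = Z"
proof
  show "topspace (seminorm_topology Z r) \<subseteq> Z"
    unfolding seminorm_topology_def topology_generated_by_topspace by blast
  show "Z \<subseteq> topspace (seminorm_topology Z r)"
  proof
    fix u assume u: "u \<in> Z"
    have "{v \<in> Z. r 0 (\<lambda>i. v i - u i) < 1} \<in> {{v \<in> Z. r k (\<lambda>i. v i - u i) < e} | u k e. u \<in> Z \<and> 0 < e}"
      using u zero_less_one by blast
    moreover have "u \<in> {v \<in> Z. r 0 (\<lambda>i. v i - u i) < 1}" using u assms by simp
    ultimately show "u \<in> topspace (seminorm_topology Z r)"
      unfolding seminorm_topology_def topology_generated_by_topspace by (rule UnionI)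
  qed
qed

lemma seminorm_topology_continuous:
  assumes maps: "\<And>v. v \<in> Y \<Longrightarrow> \<Psi> v \<in> X"
    and pre: "\<And>u k. u \<in> X \<Longrightarrow> \<exists>w\<in>Y. \<forall>v\<in>Y. p k (\<lambda>i. \<Psi> v i - u i) = q k (\<lambda>j. v j - w j)"
    and X: "\<And>k. p k (\<lambda>_. 0) = 0" and Y: "\<And>k. q k (\<lambda>_. 0) = 0"
  shows "continuous_map (seminorm_topology Y q) (seminorm_topology X p) \<Psi>"
proof -
  have topX: "topspace (seminorm_topology X p) = X" by (rule topspace_seminorm_topology) (rule X)
  have topY: "topspace (seminorm_topology Y q) = Y" by (rule topspace_seminorm_topology) (rule Y)
  show ?thesis
    unfolding seminorm_topology_def[of X p] continuous_on_generated_topo_iff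
  proof (intro conjI allI impI)
    fix U assume "U \<in> {{v \<in> X. p k (\<lambda>i. v i - u i) < e} | u k e. u \<in> X \<and> 0 < e}"
    then obtain u k e where U: "U = {v \<in> X. p k (\<lambda>i. v i - u i) < e}" "u \<in> X" "0 < e" by blast
    obtain w where w: "w \<in> Y" "\<forall>v\<in>Y. p k (\<lambda>i. \<Psi> v i - u i) = q k (\<lambda>j. v j - w j)"
      using pre[OF U(2)] by blast
    have eq: "\<Psi> -` U \<inter> topspace (seminorm_topology Y q) = {v \<in> Y. q k (\<lambda>j. v j - w j) < e}"
      unfolding topY U(1) using w(2) maps by auto
    show "openin (seminorm_topology Y q) (\<Psi> -` U \<inter> topspace (seminorm_topology Y q))"
      unfolding eq unfolding seminorm_topology_def
      by (rule topology_generated_by_Basis) (use w(1) U(3) in blast)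
  next
    have "\<Psi> ` topspace (seminorm_topology Y q) \<subseteq> topspace (seminorm_topology X p)"
      unfolding topX topY using maps by blast
    then show "\<Psi> ` topspace (seminorm_topology Y q) \<subseteq> \<Union> {{v \<in> X. p k (\<lambda>i. v i - u i) < e} | u k e. u \<in> X \<and> 0 < e}"
      unfolding seminorm_topology_def[of X p] topology_generated_by_topspace .
  qed
qed

text \<open>
  A linear map that preserves all seminorms maps the generating balls of the two topologies onto
  each other.
\<close>

theorem frechet_isomorphism_of_isometry:
  assumes X: "frechet_space X p" and lin: "function_linear_on X \<Phi>" and onto: "\<Phi> ` X = Y"
    and iso: "\<And>u k. u \<in> X \<Longrightarrow> q k (\<Phi> u) = p k u"
  shows "frechet_isomorphism X p Y q \<Phi>"
proof -
  have Xsub: "function_subspace X" and Xsemi: "\<And>k. seminorm_on X (p k)"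
    and Xsep: "\<And>u. u \<in> X \<Longrightarrow> (\<forall>k. p k u = 0) \<Longrightarrow> u = (\<lambda>_. 0)"
    and Xcompl: "\<And>u. (\<forall>n. u n \<in> X) \<and> (\<forall>k. \<forall>e>0. \<exists>N. \<forall>m\<ge>N. \<forall>n\<ge>N. p k (\<lambda>i. u m i - u n i) < e) \<Longrightarrow>
          (\<exists>v\<in>X. \<forall>k. (\<lambda>n. p k (\<lambda>i. u n i - v i)) \<longlonglongrightarrow> 0)"
    using X unfolding frechet_space_def by blast+
  have X0: "(\<lambda>_. 0) \<in> X" and Xadd: "\<And>u v. u \<in> X \<Longrightarrow> v \<in> X \<Longrightarrow> (\<lambda>i. u i + v i) \<in> X"
    and Xmul: "\<And>c u. u \<in> X \<Longrightarrow> (\<lambda>i. c * u i) \<in> X"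
    using Xsub unfolding function_subspace_def by blast+
  have padd: "\<And>k u v. u \<in> X \<Longrightarrow> v \<in> X \<Longrightarrow> p k (\<lambda>i. u i + v i) \<le> p k u + p k v"
    and pmul: "\<And>k c u. u \<in> X \<Longrightarrow> p k (\<lambda>i. c * u i) = cmod c * p k u" and pnn: "\<And>k u. u \<in> X \<Longrightarrow> 0 \<le> p k u"
    using Xsemi unfolding seminorm_on_def by blast+
  have Ladd: "\<And>u v. u \<in> X \<Longrightarrow> v \<in> X \<Longrightarrow> \<Phi> (\<lambda>i. u i + v i) = (\<lambda>j. \<Phi> u j + \<Phi> v j)"
    and Lmul: "\<And>c u. u \<in> X \<Longrightarrow> \<Phi> (\<lambda>i. c * u i) = (\<lambda>j. c * \<Phi> u j)"
    using lin unfolding function_linear_on_def by blast+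
  have Xdiff: "(\<lambda>i. u i - v i) \<in> X" if "u \<in> X" "v \<in> X" for u v
    using Xadd[OF that(1) Xmul[OF that(2), of "-1"]] by simp
  have Ldiff: "\<Phi> (\<lambda>i. u i - v i) = (\<lambda>j. \<Phi> u j - \<Phi> v j)" if "u \<in> X" "v \<in> X" for u v
    using Ladd[OF that(1) Xmul[OF that(2), of "-1"]] Lmul[OF that(2), of "-1"] by simp
  have L0: "\<Phi> (\<lambda>_. 0) = (\<lambda>_. 0)" using Lmul[OF X0, of 0] by simp
  have p0: "p k (\<lambda>_. 0) = 0" for k using pmul[OF X0, of k 0] by simp
  have dist: "q k (\<lambda>j. \<Phi> u j - \<Phi> v j) = p k (\<lambda>i. u i - v i)" if "u \<in> X" "v \<in> X" for u v k
    using iso[OF Xdiff[OF that], of k] Ldiff[OF that] by simp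
  have inj: "inj_on \<Phi> X"
  proof (rule inj_onI)
    fix u v assume uv: "u \<in> X" "v \<in> X" "\<Phi> u = \<Phi> v"
    have "p k (\<lambda>i. u i - v i) = 0" for k
      using dist[OF uv(1,2), of k] iso[OF X0, of k] uv(3) by (simp add: L0 p0)
    then have "(\<lambda>i. u i - v i) = (\<lambda>_. 0)" using Xsep[OF Xdiff[OF uv(1,2)]] by blast
    then show "u = v" by (simp add: fun_eq_iff)
  qed
  have Yrep: "\<exists>u\<in>X. w = \<Phi> u" if "w \<in> Y" for w using that onto by blast
  have YI: "\<Phi> u \<in> Y" if "u \<in> X" for u using that onto by blast
  have Y: "frechet_space Y q"
    unfolding frechet_space_def
  proof (intro conjI)
    show "function_subspace Y"
      unfolding function_subspace_def
    proof (intro conjI ballI allI)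
      show "(\<lambda>_. 0) \<in> Y" using YI[OF X0] by (simp add: L0)
      fix w w' assume "w \<in> Y" "w' \<in> Y"
      then obtain u u' where u: "u \<in> X" "w = \<Phi> u" "u' \<in> X" "w' = \<Phi> u'" using Yrep by meson
      then show "(\<lambda>i. w i + w' i) \<in> Y" using YI[OF Xadd[OF u(1,3)]] Ladd[OF u(1,3)] by simp
    next
      fix c w assume "w \<in> Y"
      then obtain u where u: "u \<in> X" "w = \<Phi> u" using Yrep by meson
      then show "(\<lambda>i. c * w i) \<in> Y" using YI[OF Xmul[OF u(1)]] Lmul[OF u(1)] by simp
    qed
    show "\<forall>k. seminorm_on Y (q k)"
      unfolding seminorm_on_def
    proof (intro conjI ballI allI)
      fix k w assume "w \<in> Y"
      then obtain u where u: "u \<in> X" "w = \<Phi> u" using Yrep by meson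
      then show "0 \<le> q k w" using pnn iso by simp
      fix w' assume "w' \<in> Y"
      then obtain u' where u': "u' \<in> X" "w' = \<Phi> u'" using Yrep by meson
      show "q k (\<lambda>i. w i + w' i) \<le> q k w + q k w'"
        using padd[OF u(1) u'(1), of k] iso[OF Xadd[OF u(1) u'(1)], of k] Ladd[OF u(1) u'(1)] iso[OF u(1), of k] iso[OF u'(1), of k]
        by (simp add: u u')
    next
      fix k c w assume "w \<in> Y"
      then obtain u where u: "u \<in> X" "w = \<Phi> u" using Yrep by meson
      show "q k (\<lambda>i. c * w i) = cmod c * q k w"
        using pmul[OF u(1), of k c] iso[OF Xmul[OF u(1)], of k c] Lmul[OF u(1), of c] iso[OF u(1), of k] by (simp add: u)
    qed
    show "\<forall>w\<in>Y. (\<forall>k. q k w = 0) \<longrightarrow> w = (\<lambda>_. 0)"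
    proof (intro ballI impI)
      fix w assume "w \<in> Y" and z: "\<forall>k. q k w = 0"
      then obtain u where u: "u \<in> X" "w = \<Phi> u" using Yrep by meson
      then have "u = (\<lambda>_. 0)" using Xsep[OF u(1)] iso[OF u(1)] z by simp
      then show "w = (\<lambda>_. 0)" using u L0 by simp
    qed
    show "\<forall>w. (\<forall>n. w n \<in> Y) \<and> (\<forall>k. \<forall>e>0. \<exists>N. \<forall>m\<ge>N. \<forall>n\<ge>N. q k (\<lambda>i. w m i - w n i) < e) \<longrightarrow>
          (\<exists>v\<in>Y. \<forall>k. (\<lambda>n. q k (\<lambda>i. w n i - v i)) \<longlonglongrightarrow> 0)"
    proof (intro allI impI)
      fix w :: "nat \<Rightarrow> 'b \<Rightarrow> complex"
      assume w: "(\<forall>n. w n \<in> Y) \<and> (\<forall>k. \<forall>e>0. \<exists>N. \<forall>m\<ge>N. \<forall>n\<ge>N. q k (\<lambda>i. w m i - w n i) < e)"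
      then have "\<forall>n. \<exists>u. u \<in> X \<and> w n = \<Phi> u" using Yrep by blast
      then obtain u where u: "\<And>n. u n \<in> X" "\<And>n. w n = \<Phi> (u n)" unfolding choice_iff by blast
      have "\<forall>k. \<forall>e>0. \<exists>N. \<forall>m\<ge>N. \<forall>n\<ge>N. p k (\<lambda>i. u m i - u n i) < e"
        using w by (simp add: u dist)
      then obtain v where v: "v \<in> X" "\<forall>k. (\<lambda>n. p k (\<lambda>i. u n i - v i)) \<longlonglongrightarrow> 0"
        using Xcompl[of u] u(1) by blast
      have "\<forall>k. (\<lambda>n. q k (\<lambda>i. w n i - \<Phi> v i)) \<longlonglongrightarrow> 0"
        using v by (simp add: u dist)
      then show "\<exists>v\<in>Y. \<forall>k. (\<lambda>n. q k (\<lambda>i. w n i - v i)) \<longlonglongrightarrow> 0" using YI[OF v(1)] by blast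
    qed
  qed
  define \<Psi> where "\<Psi> = inv_into X \<Phi>"
  have \<Psi>: "\<Psi> w \<in> X" "\<Phi> (\<Psi> w) = w" if "w \<in> Y" for w
    using that onto by (auto simp: \<Psi>_def inv_into_into f_inv_into_f)
  have \<Psi>': "\<Psi> (\<Phi> u) = u" if "u \<in> X" for u using that inj by (simp add: \<Psi>_def)
  have q0: "q k (\<lambda>_. 0) = 0" for k using iso[OF X0, of k] by (simp add: L0 p0)
  have c1: "continuous_map (seminorm_topology X p) (seminorm_topology Y q) \<Phi>"
  proof (rule seminorm_topology_continuous)
    show "\<Phi> u \<in> Y" if "u \<in> X" for u by (rule YI[OF that])
    fix w k assume w: "w \<in> Y"
    have "q k (\<lambda>j. \<Phi> v j - w j) = p k (\<lambda>i. v i - \<Psi> w i)" if "v \<in> X" for v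
      using dist[OF that \<Psi>(1)[OF w], of k] \<Psi>(2)[OF w] by simp
    then show "\<exists>u\<in>X. \<forall>v\<in>X. q k (\<lambda>j. \<Phi> v j - w j) = p k (\<lambda>i. v i - u i)"
      using \<Psi>(1)[OF w] by blast
  qed (rule q0 p0)+
  have c2: "continuous_map (seminorm_topology Y q) (seminorm_topology X p) \<Psi>"
  proof (rule seminorm_topology_continuous)
    show "\<Psi> w \<in> X" if "w \<in> Y" for w by (rule \<Psi>(1)[OF that])
    fix u k assume u: "u \<in> X"
    have "p k (\<lambda>i. \<Psi> v i - u i) = q k (\<lambda>j. v j - \<Phi> u j)" if "v \<in> Y" for v
      using dist[OF \<Psi>(1)[OF that] u, of k] \<Psi>(2)[OF that] by simp
    then show "\<exists>w\<in>Y. \<forall>v\<in>Y. p k (\<lambda>i. \<Psi> v i - u i) = q k (\<lambda>j. v j - w j)"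
      using YI[OF u] by blast
  qed (rule q0 p0)+
  have topX: "topspace (seminorm_topology X p) \<subseteq> X" and topY: "topspace (seminorm_topology Y q) \<subseteq> Y"
    unfolding seminorm_topology_def topology_generated_by_topspace by blast+
  have "homeomorphic_map (seminorm_topology X p) (seminorm_topology Y q) \<Phi>"
    unfolding homeomorphic_map_maps homeomorphic_maps_def
    using c1 c2 \<Psi>(2) \<Psi>' topX topY by (intro exI[of _ \<Psi>]) blast
  then show ?thesis unfolding frechet_isomorphism_def using X Y lin by blast
qed

theorem theorem5p19:
  fixes lam :: "nat \<Rightarrow> real"
    and \<beta> :: "real \<Rightarrow> 'g::{topological_ab_group_add,t2_space}"
    and \<mu> :: "'g measure"
  assumes "frequency lam"
    and "dirichlet_group lam \<beta>"
    and "haar_measure \<mu>"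
  shows "frechet_isomorphism
           (H_inf_plus lam) H_inf_plus_norm
           (DH_inf_plus lam \<beta> \<mu>) (DH_inf_plus_norm lam \<beta> \<mu>)
           (\<lambda>f n. bohr_coeff f (lam n))"
proof -
  interpret dirichlet_haar lam \<beta> \<mu> by (rule dirichlet_haar.intro) fact+
  show ?thesis
  proof (rule frechet_isomorphism_of_isometry[OF frechet_space_H_inf_plus])
    show "function_linear_on (H_inf_plus lam) (\<lambda>f n. bohr_coeff f (lam n))"
      unfolding function_linear_on_def
      by (simp add: H_inf_plus_alt bohr_coeff_add bohr_coeff_cmult)
    show "(\<lambda>f n. bohr_coeff f (lam n)) ` H_inf_plus lam = DH_inf_plus lam \<beta> \<mu>"
    proof
      show "(\<lambda>f n. bohr_coeff f (lam n)) ` H_inf_plus lam \<subseteq> DH_inf_plus lam \<beta> \<mu>"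
        using coefficient_map_isometry(1) by blast
      show "DH_inf_plus lam \<beta> \<mu> \<subseteq> (\<lambda>f n. bohr_coeff f (lam n)) ` H_inf_plus lam"
      proof
        fix a assume "a \<in> DH_inf_plus lam \<beta> \<mu>"
        then obtain f where "f \<in> H_inf_plus lam" "\<forall>n. bohr_coeff f (lam n) = a n"
          using DH_inf_plus_subset_image by blast
        then show "a \<in> (\<lambda>f n. bohr_coeff f (lam n)) ` H_inf_plus lam"
          by (intro image_eqI[of _ _ f]) auto
      qed
    qed
  qed (rule coefficient_map_isometry(2))
qed

end
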